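(* Let $K\subset\mathbb{R}^2$ be a $\pi/2$-symmetric convex body, i.e. a compact convex set with nonempty interior such that $(x_1,x_2)\in K\iff(-x_2,x_1)\in K$. For every $\delta>0$ there exist a function $f\in L^\infty(\mathbb{R}^2)$ with $f(0)=\|f\|_\infty=1$ and $\operatorname{supp}(\widehat f)\subset K$, a function $\varphi$ with $\varphi(0)=1$, and a $\varphi$-regular set $\Gamma\subset\mathbb{R}^2$ with $\Gamma\subset\{f=0\}$, such that $$\mathbf{D}^-(\Gamma)>\Big(\frac\pi2-\delta\Big)\mathbf{W}(K).$$
   Context: Here $d=2$. $m_2$ is Lebesgue measure on $\mathbb{R}^2$. The one-dimensional Hausdorff measure is normalized as $$\mathcal{H}^1(E)=\lim_{\delta\to0^+}\inf\Big\{2\sum_j r_j:\ E\subset\bigcup_j B(x_j,r_j),\ r_j\le\delta\Big\},$$ so that it equals length on lines. The Fourier transform is $\widehat f(\xi)=\int_{\mathbb{R}^2}f(x)e^{2\pi i\langle x,\xi\rangle}\,dm_2(x)$, extended to tempered distributions. A bounded function whose distributional Fourier transform has compact support is identified with its continuous representative; $\{f=0\}=\{x\in\mathbb{R}^2: f(x)=0\}$. For a function $\varphi:[0,1)\to[0,\infty)$ continuous at $0$, a measure $\mu$ on $\mathbb{R}^2$ is $\varphi$-regular if $\mu(B(x,r))\le 2\varphi(r)\,r$ for all $x\in\mathbb{R}^2$ and $r\in(0,1)$. A closed set $E\subset\mathbb{R}^2$ is $\varphi$-regular if the measure $\mathcal{H}^1|_E$ is $\varphi$-regular. The lower surface density of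 $\Gamma\subset\mathbb{R}^2$ is $$\mathbf{D}^-(\Gamma)=\liminf_{r\to\infty}\inf_{x\in\mathbb{R}^2}\frac{\mathcal{H}^1(\Gamma\cap B(x,r))}{m_2(B(x,r))}.$$ The mean width of $K$ (a $\pi/2$-symmetric set is automatically origin symmetric) is $$\mathbf{W}(K)=\frac{2}{\mathcal{H}^1(\mathbb{S}^1)}\int_{\mathbb{S}^1}h_K(\theta)\,d\mathcal{H}^1(\theta),\qquad h_K(\theta)=\max_{x\in K}\langle x,\theta\rangle.$$ *)

theory Defs
  imports "HOL-Analysis.Analysis" "HOL-Probability.Essential_Supremum"
begin

section \<open>One-dimensional Hausdorff measure\<close>

text \<open>Countable covers by open balls. Radius 0 is allowed and gives the empty ball, so finite
  covers are included.\<close>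

definition hausdorff_content :: "real \<Rightarrow> (real^2) set \<Rightarrow> ennreal" where
  "hausdorff_content \<delta> E = Inf {(\<Sum>j. ennreal (2 * r j)) | (x :: nat \<Rightarrow> real^2) (r :: nat \<Rightarrow> real).
     E \<subseteq> (\<Union>j. ball (x j) (r j)) \<and> (\<forall>j. 0 \<le> r j \<and> r j \<le> \<delta>)}"

definition hausdorff_outer :: "(real^2) set \<Rightarrow> ennreal" where
  "hausdorff_outer E = Lim (at_right 0) (\<lambda>\<delta>. hausdorff_content \<delta> E)"

text \<open>\<^const>\<open>measure_of\<close> gives the zero measure unless the set function is countably
  additive; that it is on the Borel sets is shown in \<open>emeasure_hausdorff_measure\<close> below.\<close>

definition hausdorff_measure :: "(real^2) measure" where
  "hausdorff_measure = measure_of UNIV (sets borel) hausdorff_outer"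

subsection \<open>The limit exists, and the set function is a Borel measure\<close>

lemma hausdorff_content_mono: "E \<subseteq> F \<Longrightarrow> hausdorff_content \<delta> E \<le> hausdorff_content \<delta> F"
  unfolding hausdorff_content_def by (rule Inf_superset_mono) blast

lemma hausdorff_content_antimono: "\<delta> \<le> \<delta>' \<Longrightarrow> hausdorff_content \<delta>' E \<le> hausdorff_content \<delta> E"
  unfolding hausdorff_content_def by (rule Inf_superset_mono) (blast intro: order_trans)

lemma hausdorff_content_empty: "0 < \<delta> \<Longrightarrow> hausdorff_content \<delta> {} = 0"
proof -
  assume d: "0 < \<delta>"
  have "hausdorff_content \<delta> {} \<le> (\<Sum>j. ennreal (2 * (\<lambda>_::nat. 0) j))"
    unfolding hausdorff_content_def
    by (rule Inf_lower) (use d in \<open>auto intro!: exI[of _ "\<lambda>_::nat. 0::real"]\<close>)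
  then show ?thesis by simp
qed

lemma hausdorff_content_tendsto:
  "((\<lambda>\<delta>. hausdorff_content \<delta> E) \<longlongrightarrow> (SUP \<delta>\<in>{0<..}. hausdorff_content \<delta> E)) (at_right 0)"
proof (rule order_tendstoI)
  fix a assume "a < (SUP \<delta>\<in>{0<..}. hausdorff_content \<delta> E)"
  then obtain d where d: "0 < d" "a < hausdorff_content d E"
    by (auto simp: less_SUP_iff)
  have "\<forall>\<^sub>F x in at_right 0. x \<in> {0<..<d}"
    using d by (intro eventually_at_right_real) auto
  then show "\<forall>\<^sub>F x in at_right 0. a < hausdorff_content x E"
    by eventually_elim
       (use d hausdorff_content_antimono in \<open>auto intro: less_le_trans\<close>)
next
  fix a assume a: "(SUP \<delta>\<in>{0<..}. hausdorff_content \<delta> E) < a"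
  have "\<forall>\<^sub>F x in at_right (0::real). x \<in> {0<..<1}"
    by (intro eventually_at_right_real) auto
  then show "\<forall>\<^sub>F x in at_right 0. hausdorff_content x E < a"
  proof eventually_elim
    case (elim x)
    then have "hausdorff_content x E \<le> (SUP \<delta>\<in>{0<..}. hausdorff_content \<delta> E)"
      by (intro SUP_upper) auto
    with a show ?case by (rule le_less_trans[rotated])
  qed
qed

lemma hausdorff_outer_eq_SUP: "hausdorff_outer E = (SUP \<delta>\<in>{0<..}. hausdorff_content \<delta> E)"
  unfolding hausdorff_outer_def
  by (rule tendsto_Lim[OF trivial_limit_at_right_real hausdorff_content_tendsto])

lemma hausdorff_content_le_outer: "0 < \<delta> \<Longrightarrow> hausdorff_content \<delta> E \<le> hausdorff_outer E"
  unfolding hausdorff_outer_eq_SUP by (intro SUP_upper) auto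

lemma hausdorff_outer_mono: "E \<subseteq> F \<Longrightarrow> hausdorff_outer E \<le> hausdorff_outer F"
  unfolding hausdorff_outer_eq_SUP by (intro SUP_mono) (auto intro: hausdorff_content_mono)

lemma hausdorff_outer_empty: "hausdorff_outer {} = 0"
  unfolding hausdorff_outer_eq_SUP by (intro antisym SUP_least) (auto simp: hausdorff_content_empty)

lemma hausdorff_content_UN_le:
  assumes "0 < \<delta>"
  shows "hausdorff_content \<delta> (\<Union>i::nat. A i) \<le> (\<Sum>i. hausdorff_content \<delta> (A i))"
proof (rule ennreal_le_epsilon)
  fix e :: real assume e: "0 < e" and fin: "(\<Sum>i. hausdorff_content \<delta> (A i)) < top"
  have finA: "hausdorff_content \<delta> (A i) < top" for i
  proof -
    have "hausdorff_content \<delta> (A i) \<le> (\<Sum>i. hausdorff_content \<delta> (A i))"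
      using sum_le_suminf[of "\<lambda>i. hausdorff_content \<delta> (A i)" "{i}"] by simp
    with fin show ?thesis by (rule le_less_trans[rotated])
  qed
  have "\<exists>x r. A i \<subseteq> (\<Union>j. ball (x j) (r j)) \<and> (\<forall>j. 0 \<le> r j \<and> r j \<le> \<delta>) \<and>
      (\<Sum>j::nat. ennreal (2 * r j)) \<le> hausdorff_content \<delta> (A i) + ennreal (e * (1/2)^Suc i)" for i
  proof -
    have "hausdorff_content \<delta> (A i) < hausdorff_content \<delta> (A i) + ennreal (e * (1/2)^Suc i)"
      using finA[of i] e ennreal_add_left_cancel_less[of "hausdorff_content \<delta> (A i)" 0] by simp
    then show ?thesis
      unfolding hausdorff_content_def[of \<delta> "A i"]
      by (subst (asm) (1) Inf_less_iff) (auto intro: less_imp_le)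
  qed
  then have "\<forall>i. \<exists>x r. A i \<subseteq> (\<Union>j. ball (x j) (r j)) \<and> (\<forall>j. 0 \<le> r j \<and> r j \<le> \<delta>) \<and>
      (\<Sum>j::nat. ennreal (2 * r j)) \<le> hausdorff_content \<delta> (A i) + ennreal (e * (1/2)^Suc i)" ..
  from choice[OF this] obtain x where
    "\<forall>i. \<exists>r. A i \<subseteq> (\<Union>j. ball (x i j) (r j)) \<and> (\<forall>j. 0 \<le> r j \<and> r j \<le> \<delta>) \<and>
      (\<Sum>j::nat. ennreal (2 * r j)) \<le> hausdorff_content \<delta> (A i) + ennreal (e * (1/2)^Suc i)" ..
  from choice[OF this] obtain r where
    "\<forall>i. A i \<subseteq> (\<Union>j. ball (x i j) (r i j)) \<and> (\<forall>j. 0 \<le> r i j \<and> r i j \<le> \<delta>) \<and>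
      (\<Sum>j::nat. ennreal (2 * r i j)) \<le> hausdorff_content \<delta> (A i) + ennreal (e * (1/2)^Suc i)" ..
  then have xr: "A i \<subseteq> (\<Union>j. ball (x i j) (r i j))" "0 \<le> r i j" "r i j \<le> \<delta>"
      "(\<Sum>j::nat. ennreal (2 * r i j)) \<le> hausdorff_content \<delta> (A i) + ennreal (e * (1/2)^Suc i)"
    for i j by (simp_all del: power_Suc)
  define y where "y n = (case prod_decode n of (i, j) \<Rightarrow> x i j)" for n
  define s where "s n = (case prod_decode n of (i, j) \<Rightarrow> r i j)" for n
  have "hausdorff_content \<delta> (\<Union>i. A i) \<le> (\<Sum>n. ennreal (2 * s n))"
    unfolding hausdorff_content_def
  proof (rule Inf_lower, intro CollectI exI conjI allI)
    show "(\<Union>i. A i) \<subseteq> (\<Union>n. ball (y n) (s n))"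
    proof
      fix z assume "z \<in> (\<Union>i. A i)"
      then obtain i j where "z \<in> ball (x i j) (r i j)" using xr(1) by blast
      then have "z \<in> ball (y (prod_encode (i, j))) (s (prod_encode (i, j)))"
        by (simp add: y_def s_def)
      then show "z \<in> (\<Union>n. ball (y n) (s n))" by blast
    qed
  qed (auto simp: s_def xr split: prod.split)
  also have "\<dots> = (\<Sum>i. \<Sum>j. ennreal (2 * r i j))"
  proof -
    have "(\<Sum>n. (\<lambda>(i, j). ennreal (2 * r i j)) (prod_decode n)) = (\<Sum>i. \<Sum>j. ennreal (2 * r i j))"
      by (rule suminf_ennreal_2dimen) auto
    moreover have "(\<lambda>n. ennreal (2 * s n)) = (\<lambda>n. (\<lambda>(i, j). ennreal (2 * r i j)) (prod_decode n))"
      by (auto simp: s_def fun_eq_iff split: prod.split)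
    ultimately show ?thesis by simp
  qed
  also have "\<dots> \<le> (\<Sum>i. hausdorff_content \<delta> (A i) + ennreal (e * (1/2)^Suc i))"
    by (intro suminf_le xr) auto
  also have "\<dots> = (\<Sum>i. hausdorff_content \<delta> (A i)) + (\<Sum>i. ennreal (e * (1/2)^Suc i))"
    by (rule suminf_add[symmetric]) auto
  also have "(\<Sum>i. ennreal (e * (1/2)^Suc i)) = ennreal e"
    by (rule suminf_ennreal_eq)
       (use e sums_mult[OF power_half_series, of e] in auto)
  finally show "hausdorff_content \<delta> (\<Union>i. A i) \<le> (\<Sum>i. hausdorff_content \<delta> (A i)) + ennreal e" .
qed

lemma hausdorff_outer_UN_le: "hausdorff_outer (\<Union>i::nat. A i) \<le> (\<Sum>i. hausdorff_outer (A i))"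
  unfolding hausdorff_outer_eq_SUP[of "\<Union>i. A i"]
proof (rule SUP_least)
  fix \<delta> :: real assume "\<delta> \<in> {0<..}"
  then have d: "0 < \<delta>" by simp
  from hausdorff_content_UN_le[OF d]
  have "hausdorff_content \<delta> (\<Union>i. A i) \<le> (\<Sum>i. hausdorff_content \<delta> (A i))" .
  also have "\<dots> \<le> (\<Sum>i. hausdorff_outer (A i))"
    by (intro suminf_le hausdorff_content_le_outer d) auto
  finally show "hausdorff_content \<delta> (\<Union>i. A i) \<le> (\<Sum>i. hausdorff_outer (A i))" .
qed

lemma hausdorff_outer_Un_le: "hausdorff_outer (A \<union> B) \<le> hausdorff_outer A + hausdorff_outer B"
proof -
  have "hausdorff_outer (\<Union>i. binaryset A B i) \<le> (\<Sum>i. hausdorff_outer (binaryset A B i))"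
    by (rule hausdorff_outer_UN_le)
  also have "(\<Sum>i. hausdorff_outer (binaryset A B i)) = hausdorff_outer A + hausdorff_outer B"
    by (rule suminf_binaryset_eq) (rule hausdorff_outer_empty)
  finally show ?thesis by (simp add: UN_binaryset_eq)
qed

lemma hausdorff_outer_separated:
  assumes d: "0 < d" and sep: "\<And>a b. a \<in> A \<Longrightarrow> b \<in> B \<Longrightarrow> d \<le> dist a b"
  shows "hausdorff_outer A + hausdorff_outer B \<le> hausdorff_outer (A \<union> B)"
proof -
  have content: "hausdorff_content \<delta> A + hausdorff_content \<delta> B \<le> hausdorff_outer (A \<union> B)"
    if \<delta>: "0 < \<delta>" "\<delta> \<le> d / 2" for \<delta>
  proof -
    have "hausdorff_content \<delta> A + hausdorff_content \<delta> B \<le> hausdorff_content \<delta> (A \<union> B)"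
      unfolding hausdorff_content_def[of \<delta> "A \<union> B"]
    proof (rule Inf_greatest, clarify)
      fix x :: "nat \<Rightarrow> real^2" and r :: "nat \<Rightarrow> real"
      assume cov: "A \<union> B \<subseteq> (\<Union>j. ball (x j) (r j))" and r: "\<forall>j. 0 \<le> r j \<and> r j \<le> \<delta>"
      define hit where "hit S j \<longleftrightarrow> S \<inter> ball (x j) (r j) \<noteq> {}" for S j
      define rr where "rr S j = (if hit S j then r j else 0)" for S j
      have le: "hausdorff_content \<delta> S \<le> (\<Sum>j. ennreal (2 * rr S j))" if "S \<subseteq> A \<union> B" for S
        unfolding hausdorff_content_def
      proof (rule Inf_lower, intro CollectI exI conjI allI)
        show "S \<subseteq> (\<Union>j. ball (x j) (rr S j))"
        proof
          fix z assume z: "z \<in> S"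
          with that cov obtain j where j: "z \<in> ball (x j) (r j)" by blast
          with z have "hit S j" by (auto simp: hit_def)
          with j show "z \<in> (\<Union>j. ball (x j) (rr S j))" by (auto simp: rr_def)
        qed
      qed (use r \<delta> in \<open>auto simp: rr_def\<close>)
      have notboth: "\<not> (hit A j \<and> hit B j)" for j
      proof
        assume "hit A j \<and> hit B j"
        then obtain a b where ab: "a \<in> A" "b \<in> B" "dist (x j) a < r j" "dist (x j) b < r j"
          by (auto simp: hit_def)
        have "dist a b \<le> dist (x j) a + dist (x j) b"
          by (rule dist_triangle3)
        also have "\<dots> < d" using ab r[rule_format, of j] \<delta> by linarith
        finally show False using sep[OF ab(1,2)] by simp
      qed
      have "hausdorff_content \<delta> A + hausdorff_content \<delta> B
          \<le> (\<Sum>j. ennreal (2 * rr A j)) + (\<Sum>j. ennreal (2 * rr B j))"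
        by (intro add_mono le) auto
      also have "\<dots> = (\<Sum>j. ennreal (2 * rr A j) + ennreal (2 * rr B j))"
        by (rule suminf_add) auto
      also have "\<dots> \<le> (\<Sum>j. ennreal (2 * r j))"
        using notboth r by (intro suminf_le) (auto simp: rr_def)
      finally show "hausdorff_content \<delta> A + hausdorff_content \<delta> B \<le> (\<Sum>j. ennreal (2 * r j))" .
    qed
    also have "\<dots> \<le> hausdorff_outer (A \<union> B)" by (rule hausdorff_content_le_outer[OF \<delta>(1)])
    finally show ?thesis .
  qed
  have "((\<lambda>\<delta>. hausdorff_content \<delta> A + hausdorff_content \<delta> B) \<longlongrightarrow>
      hausdorff_outer A + hausdorff_outer B) (at_right 0)"
    unfolding hausdorff_outer_eq_SUP by (intro tendsto_add hausdorff_content_tendsto)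
  moreover have "\<forall>\<^sub>F \<delta> in at_right (0::real). \<delta> \<in> {0<..<d/2}"
    using d by (intro eventually_at_right_real) auto
  then have "\<forall>\<^sub>F \<delta> in at_right 0.
      hausdorff_content \<delta> A + hausdorff_content \<delta> B \<le> hausdorff_outer (A \<union> B)"
    by eventually_elim (auto intro: content)
  ultimately show ?thesis
    by (rule tendsto_upperbound) simp
qed

lemma hausdorff_outer_UN_separated:
  assumes d: "\<And>i. 0 < d i"
    and sep: "\<And>i j a b. i < j \<Longrightarrow> a \<in> S i \<Longrightarrow> b \<in> S j \<Longrightarrow> d j \<le> dist a b"
  shows "(\<Sum>i<n. hausdorff_outer (S i)) \<le> hausdorff_outer (\<Union>i<n::nat. S i)"
proof (induction n)
  case (Suc n)
  have "(\<Sum>i<Suc n. hausdorff_outer (S i)) \<le> hausdorff_outer (\<Union>i<n. S i) + hausdorff_outer (S n)"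
    using Suc by (simp add: add_right_mono)
  also have "\<dots> \<le> hausdorff_outer ((\<Union>i<n. S i) \<union> S n)"
    by (rule hausdorff_outer_separated[OF d[of n]]) (auto intro: sep)
  also have "(\<Union>i<n. S i) \<union> S n = (\<Union>i<Suc n. S i)"
    by (auto simp: lessThan_Suc)
  finally show ?case .
qed simp

lemma hausdorff_outer_closed_split:
  assumes C: "closed C"
  shows "hausdorff_outer (X \<inter> C) + hausdorff_outer (X - C) \<le> hausdorff_outer X"
proof (cases "C = {} \<or> hausdorff_outer X = top")
  case True
  then show ?thesis by (auto simp: hausdorff_outer_empty)
next
  case False
  then have ne: "C \<noteq> {}" and fin: "hausdorff_outer X < top" by (auto simp: less_top)
  define e where "e n = 1 / real (Suc n)" for n
  define Y where "Y n = {x \<in> X. e n \<le> infdist x C}" for n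
  define R where "R n = {x \<in> X. e (Suc n) \<le> infdist x C \<and> infdist x C < e n}" for n
  have e_pos: "0 < e n" for n by (simp add: e_def)
  have e_dec: "e n \<le> e m" if "m \<le> n" for m n using that by (simp add: e_def field_simps)
  have e_sdec: "e n < e m" if "m < n" for m n using that by (simp add: e_def field_simps)
  have lip: "infdist a C - infdist b C \<le> dist a b" for a b
    using infdist_triangle[of a C b] by simp
  have YC: "hausdorff_outer (X \<inter> C) + hausdorff_outer (Y n) \<le> hausdorff_outer X" for n
  proof -
    have "hausdorff_outer (X \<inter> C) + hausdorff_outer (Y n) \<le> hausdorff_outer ((X \<inter> C) \<union> Y n)"
    proof (rule hausdorff_outer_separated[OF e_pos[of n]])
      fix a b assume "a \<in> X \<inter> C" "b \<in> Y n"
      then show "e n \<le> dist a b"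
        using lip[of b a] by (auto simp: Y_def dist_commute)
    qed
    also have "\<dots> \<le> hausdorff_outer X" by (rule hausdorff_outer_mono) (auto simp: Y_def)
    finally show ?thesis .
  qed
  have half: "(\<Sum>i<n. hausdorff_outer (R (2 * i + k))) \<le> hausdorff_outer X" for n k
  proof -
    have "(\<Sum>i<n. hausdorff_outer (R (2 * i + k))) \<le> hausdorff_outer (\<Union>i<n. R (2 * i + k))"
    proof (rule hausdorff_outer_UN_separated[where d = "\<lambda>j. e (2 * j + k - 1) - e (2 * j + k) + (if j = 0 then 1 else 0)"])
      fix j show "0 < e (2 * j + k - 1) - e (2 * j + k) + (if j = 0 then 1 else 0)"
        using e_sdec[of "2 * j + k - 1" "2 * j + k"] e_dec[of "2 * j + k - 1" "2 * j + k"] by auto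
    next
      fix i j a b assume ij: "i < j" and a: "a \<in> R (2 * i + k)" and b: "b \<in> R (2 * j + k)"
      have "e (2 * j + k - 1) \<le> e (Suc (2 * i + k))" using ij by (intro e_dec) simp
      then have "e (2 * j + k - 1) - e (2 * j + k) \<le> infdist a C - infdist b C"
        using a b by (auto simp: R_def)
      also have "\<dots> \<le> dist a b" by (rule lip)
      finally show "e (2 * j + k - 1) - e (2 * j + k) + (if j = 0 then 1 else 0) \<le> dist a b"
        using ij by simp
    qed
    also have "\<dots> \<le> hausdorff_outer X" by (rule hausdorff_outer_mono) (auto simp: R_def)
    finally show ?thesis .
  qed
  have total: "(\<Sum>i. hausdorff_outer (R i)) \<le> hausdorff_outer X + hausdorff_outer X"
  proof (rule suminf_le_const[OF summableI])
    fix n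
    have "(\<Sum>i<n. hausdorff_outer (R i)) \<le> (\<Sum>i<2*n. hausdorff_outer (R i))"
      by (intro sum_mono2) auto
    also have "\<dots> = (\<Sum>i<n. hausdorff_outer (R (2 * i + 0))) + (\<Sum>i<n. hausdorff_outer (R (2 * i + 1)))"
      by (induction n) (auto simp: algebra_simps)
    also have "\<dots> \<le> hausdorff_outer X + hausdorff_outer X" by (intro add_mono half)
    finally show "(\<Sum>i<n. hausdorff_outer (R i)) \<le> hausdorff_outer X + hausdorff_outer X" .
  qed
  have tail: "(\<lambda>n. \<Sum>i. hausdorff_outer (R (i + n))) \<longlonglongrightarrow> 0"
  proof -
    have "(\<Sum>i. hausdorff_outer (R i)) < top"
      using total fin by (auto intro: le_less_trans)
    then have nt: "(\<Sum>i. ennreal (enn2real (hausdorff_outer (R i)))) \<noteq> top"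
      and R_eq: "ennreal (enn2real (hausdorff_outer (R i))) = hausdorff_outer (R i)" for i
      using ennreal_suminf_lessD[of "\<lambda>i. hausdorff_outer (R i)" top] by (auto simp: less_top)
    define a where "a i = enn2real (hausdorff_outer (R i))" for i
    have a: "summable a"
      unfolding a_def by (rule summable_suminf_not_top[OF _ nt]) simp
    have "(\<Sum>i. hausdorff_outer (R (i + n))) = ennreal (\<Sum>i. a (i + n))" for n
    proof -
      have "(\<Sum>i. hausdorff_outer (R (i + n))) = (\<Sum>i. ennreal (a (i + n)))"
        by (simp add: a_def R_eq)
      also have "\<dots> = ennreal (\<Sum>i. a (i + n))"
        by (intro suminf_ennreal2 summable_ignore_initial_segment[OF a]) (simp add: a_def)
      finally show ?thesis .
    qed
    moreover have "(\<lambda>n. ennreal (\<Sum>i. a (i + n))) \<longlonglongrightarrow> ennreal 0"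
      by (intro tendsto_ennrealI suminf_exist_split2 a)
    ultimately show ?thesis by simp
  qed
  have cover: "hausdorff_outer (X - C) \<le> hausdorff_outer (Y n) + (\<Sum>i. hausdorff_outer (R (i + n)))" for n
  proof -
    have "X - C \<subseteq> Y n \<union> (\<Union>i. R (i + n))"
    proof
      fix x assume x: "x \<in> X - C"
      then have pos: "0 < infdist x C"
        using C ne in_closed_iff_infdist_zero[of C x] infdist_nonneg[of x C] by fastforce
      show "x \<in> Y n \<union> (\<Union>i. R (i + n))"
      proof (cases "e n \<le> infdist x C")
        case True
        with x show ?thesis by (simp add: Y_def)
      next
        case False
        obtain m where m: "e m < infdist x C"
          using reals_Archimedean[OF pos] by (auto simp: e_def inverse_eq_divide)
        define p where "p = (LEAST p. e p \<le> infdist x C)"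
        have p1: "e p \<le> infdist x C" unfolding p_def by (rule LeastI[of _ m]) (use m in simp)
        have np: "n < p"
        proof (rule ccontr)
          assume "\<not> n < p"
          then have "e n \<le> e p" by (intro e_dec) simp
          with p1 False show False by simp
        qed
        then obtain q where q: "p = Suc q" by (cases p) auto
        have "\<not> e q \<le> infdist x C"
          using not_less_Least[of q "\<lambda>p. e p \<le> infdist x C"] q by (simp add: p_def)
        then have "x \<in> R q" using x p1 q by (simp add: R_def)
        moreover have "q = (q - n) + n" using np q by simp
        ultimately show ?thesis by (metis UN_I UNIV_I UnI2)
      qed
    qed
    then have "hausdorff_outer (X - C) \<le> hausdorff_outer (Y n \<union> (\<Union>i. R (i + n)))"
      by (rule hausdorff_outer_mono)
    also have "\<dots> \<le> hausdorff_outer (Y n) + hausdorff_outer (\<Union>i. R (i + n))"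
      by (rule hausdorff_outer_Un_le)
    also have "\<dots> \<le> hausdorff_outer (Y n) + (\<Sum>i. hausdorff_outer (R (i + n)))"
      by (intro add_left_mono hausdorff_outer_UN_le)
    finally show ?thesis .
  qed
  have bound: "hausdorff_outer (X \<inter> C) + hausdorff_outer (X - C)
      \<le> hausdorff_outer X + (\<Sum>i. hausdorff_outer (R (i + n)))" for n
  proof -
    have "hausdorff_outer (X \<inter> C) + hausdorff_outer (X - C)
        \<le> (hausdorff_outer (X \<inter> C) + hausdorff_outer (Y n)) + (\<Sum>i. hausdorff_outer (R (i + n)))"
      using add_left_mono[OF cover[of n]] by (simp add: add.assoc)
    also have "\<dots> \<le> hausdorff_outer X + (\<Sum>i. hausdorff_outer (R (i + n)))"
      by (intro add_right_mono YC)
    finally show ?thesis .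
  qed
  have "(\<lambda>n. hausdorff_outer X + (\<Sum>i. hausdorff_outer (R (i + n)))) \<longlonglongrightarrow> hausdorff_outer X + 0"
    by (intro tendsto_add tail tendsto_const)
  then have "(\<lambda>n. hausdorff_outer X + (\<Sum>i. hausdorff_outer (R (i + n)))) \<longlonglongrightarrow> hausdorff_outer X"
    by simp
  then show ?thesis
    by (rule tendsto_lowerbound) (use bound in auto)
qed

lemma measure_space_hausdorff_outer: "measure_space UNIV (sets borel) hausdorff_outer"
proof -
  interpret P: sigma_algebra UNIV "UNIV :: (real^2) set set"
    using sigma_algebra_Pow[of "UNIV :: (real^2) set"] by simp
  have oms: "outer_measure_space UNIV hausdorff_outer"
    unfolding outer_measure_space_def
  proof (intro conjI)
    show "positive UNIV hausdorff_outer" by (simp add: positive_def hausdorff_outer_empty)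
    show "increasing UNIV hausdorff_outer" by (simp add: increasing_def hausdorff_outer_mono)
    show "countably_subadditive UNIV hausdorff_outer"
      by (simp add: countably_subadditive_def hausdorff_outer_UN_le)
  qed
  let ?L = "lambda_system UNIV UNIV hausdorff_outer"
  have ms: "measure_space UNIV ?L hausdorff_outer"
    by (rule P.caratheodory_lemma[OF oms])
  have closed_L: "C \<in> ?L" if "closed C" for C
  proof -
    have "hausdorff_outer (X \<inter> C) + hausdorff_outer (X - C) = hausdorff_outer X" for X
    proof (rule antisym)
      show "hausdorff_outer (X \<inter> C) + hausdorff_outer (X - C) \<le> hausdorff_outer X"
        by (rule hausdorff_outer_closed_split[OF that])
      show "hausdorff_outer X \<le> hausdorff_outer (X \<inter> C) + hausdorff_outer (X - C)"
        using hausdorff_outer_Un_le[of "X \<inter> C" "X - C"] by (simp add: Int_Diff_Un)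
    qed
    then show ?thesis by (simp add: P.lambda_system_eq)
  qed
  have sa: "sigma_algebra UNIV ?L" using ms by (simp add: measure_space_def)
  have sub: "sets (borel :: (real^2) measure) \<subseteq> ?L"
    unfolding borel_eq_closed
    by (subst sets_measure_of) (auto intro!: sigma_algebra.sigma_sets_subset[OF sa] closed_L)
  have "sigma_algebra UNIV (sets (borel :: (real^2) measure))"
    using sets.sigma_algebra_axioms[of "borel :: (real^2) measure"] by simp
  with ms sub show ?thesis
    by (auto simp: measure_space_def positive_def countably_additive_def)
qed

lemma sets_hausdorff_measure [simp, measurable_cong]: "sets hausdorff_measure = sets borel"
  unfolding hausdorff_measure_def
  by (simp add: sigma_algebra.sigma_sets_eq[OF sets.sigma_algebra_axioms, of borel, simplified])

lemma space_hausdorff_measure [simp]: "space hausdorff_measure = UNIV"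
  by (simp add: hausdorff_measure_def)

lemma emeasure_hausdorff_measure:
  "A \<in> sets borel \<Longrightarrow> emeasure hausdorff_measure A = hausdorff_outer A"
  by (rule emeasure_measure_of[OF hausdorff_measure_def])
     (use measure_space_hausdorff_outer in \<open>auto simp: measure_space_def\<close>)

section \<open>Regular sets and lower surface density\<close>

text \<open>Only the values of \<open>\<phi>\<close> on \<open>[0,1)\<close> matter.\<close>

definition gauge_function :: "(real \<Rightarrow> real) \<Rightarrow> bool" where
  "gauge_function \<phi> \<longleftrightarrow> (\<forall>r\<in>{0..<1}. 0 \<le> \<phi> r) \<and> continuous (at 0 within {0..<1}) \<phi>"

definition regular_measure :: "(real \<Rightarrow> real) \<Rightarrow> (real^2) measure \<Rightarrow> bool" where
  "regular_measure \<phi> \<mu> \<longleftrightarrow>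
     (\<forall>x. \<forall>r\<in>{0<..<1}. emeasure \<mu> (ball x r) \<le> ennreal (2 * \<phi> r * r))"

text \<open>For Borel \<open>E\<close>, \<open>density hausdorff_measure (indicator E)\<close> is the restriction
  \<open>A \<mapsto> hausdorff_measure (A \<inter> E)\<close>.\<close>

definition regular_set :: "(real \<Rightarrow> real) \<Rightarrow> (real^2) set \<Rightarrow> bool" where
  "regular_set \<phi> E \<longleftrightarrow>
     closed E \<and> regular_measure \<phi> (density hausdorff_measure (indicator E))"

definition lower_surface_density :: "(real^2) set \<Rightarrow> ennreal" where
  "lower_surface_density \<Gamma> =
     Liminf at_top (\<lambda>r::real. INF x. hausdorff_outer (\<Gamma> \<inter> ball x r) / emeasure lborel (ball x r))"

section \<open>Convex bodies\<close>

definition convex_body :: "(real^2) set \<Rightarrow> bool" where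
  "convex_body K \<longleftrightarrow> compact K \<and> convex K \<and> interior K \<noteq> {}"

definition quarter_turn_symmetric :: "(real^2) set \<Rightarrow> bool" where
  "quarter_turn_symmetric K \<longleftrightarrow> (\<forall>x. x \<in> K \<longleftrightarrow> vector [- (x $ 2), x $ 1] \<in> K)"

definition support_function :: "(real^2) set \<Rightarrow> real^2 \<Rightarrow> real" where
  "support_function K \<theta> = (SUP x\<in>K. x \<bullet> \<theta>)"

definition mean_width :: "(real^2) set \<Rightarrow> real" where
  "mean_width K = 2 / measure hausdorff_measure (sphere 0 1) *
     (LINT \<theta>:sphere 0 1|hausdorff_measure. support_function K \<theta>)"

section \<open>Bounded functions and the support of their Fourier transform\<close>

definition Linf_norm :: "(real^2 \<Rightarrow> complex) \<Rightarrow> ereal" where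
  "Linf_norm f = esssup lborel (\<lambda>x. ereal (norm (f x)))"

definition Linf :: "(real^2 \<Rightarrow> complex) set" where
  "Linf = {f \<in> borel_measurable lborel. Linf_norm f < \<infinity>}"

fun iterated_partial :: "2 list \<Rightarrow> (real^2 \<Rightarrow> complex) \<Rightarrow> real^2 \<Rightarrow> complex" where
  "iterated_partial [] \<psi> = \<psi>"
| "iterated_partial (i # is) \<psi> =
     (\<lambda>x. frechet_derivative (iterated_partial is \<psi>) (at x) (axis i 1))"

text \<open>Total differentiability of all iterated partials is equivalent to being of class
  $C^\infty$, and makes the unspecified case of \<^const>\<open>frechet_derivative\<close> irrelevant.\<close>

definition smooth :: "(real^2 \<Rightarrow> complex) \<Rightarrow> bool" where
  "smooth \<psi> \<longleftrightarrow> (\<forall>is x. iterated_partial is \<psi> differentiable (at x))"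

definition schwartz :: "(real^2 \<Rightarrow> complex) set" where
  "schwartz = {\<psi>. smooth \<psi> \<and>
     (\<forall>is (N::nat). bounded (range (\<lambda>x. (1 + norm x) ^ N * norm (iterated_partial is \<psi> x))))}"

definition fourier :: "(real^2 \<Rightarrow> complex) \<Rightarrow> real^2 \<Rightarrow> complex" where
  "fourier \<psi> \<xi> = (LINT x|lborel. \<psi> x * exp (2 * pi * \<i> * of_real (x \<bullet> \<xi>)))"

text \<open>Tempered distributions are represented by functionals that are only ever applied to
  elements of \<^const>\<open>schwartz\<close>.\<close>

type_synonym distribution = "(real^2 \<Rightarrow> complex) \<Rightarrow> complex"

definition dist_of_fun :: "(real^2 \<Rightarrow> complex) \<Rightarrow> distribution" where
  "dist_of_fun f = (\<lambda>\<psi>. LINT x|lborel. f x * \<psi> x)"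

definition dist_fourier :: "distribution \<Rightarrow> distribution" where
  "dist_fourier T = (\<lambda>\<psi>. T (fourier \<psi>))"

definition dist_vanishes_on :: "distribution \<Rightarrow> (real^2) set \<Rightarrow> bool" where
  "dist_vanishes_on T U \<longleftrightarrow>
     (\<forall>\<psi>\<in>schwartz. compact (closure {x. \<psi> x \<noteq> 0}) \<and> closure {x. \<psi> x \<noteq> 0} \<subseteq> U \<longrightarrow> T \<psi> = 0)"

definition dist_support :: "distribution \<Rightarrow> (real^2) set" where
  "dist_support T = - \<Union>{U. open U \<and> dist_vanishes_on T U}"

end

theory Submission
  imports Defs "HOL-Probability.Characteristic_Functions" "HOL-Probability.Sinc_Integral"
begin

text \<open>For vectors \<open>\<xi>\<^sub>1, \<dots>, \<xi>\<^sub>n\<close> the product of the functions \<open>cos (2\<pi>\<langle>x, \<xi>\<^sub>i\<rangle>)\<close> has its spectrum in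
  the sign sums \<open>\<plusminus>\<xi>\<^sub>1 \<plusminus> \<dots> \<plusminus> \<xi>\<^sub>n\<close>, the extreme ones of which are the vertices of a zonotope, and it vanishes on
  \<open>n\<close> families of parallel lines of total density \<open>2 (|\<xi>\<^sub>1| + \<dots> + |\<xi>\<^sub>n|)\<close>, half the perimeter of the zonotope,
  which is \<open>\<pi>/2\<close> times its mean width. In the plane every symmetric convex body is
  approximated from inside by zonotopes: take the polygon circumscribed about \<open>K\<close> with \<open>2N\<close> equidistributed
  edge normals and shrink it by \<open>1 + O(1/N)\<close>. Its perimeter is a multiple of the sum of the support function over the
  grid of normals, and for a suitable rotation of the grid this sum is at least the average of the support function over
  the circle. Crossings of the lines are the only obstruction to regularity at small scales; cutting out a thin
  neighbourhood of them costs little density, and leaves a set that in small balls is contained in a single line.\<close>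

section \<open>Hausdorff measure of segments\<close>

text \<open>Only the behaviour of \<open>\<phi>\<close> at 0 is prescribed, so no uniformity between
  the parameters is needed and they can be fixed one after the other: \<open>N\<close> determines
  the generators and the total density of the lines, then \<open>\<tau>\<close> the width of the
  cut, then \<open>sep\<close> the scale below which a single line is seen. A narrow angle between
  two families does no harm. Along a line of one family, the gaps cut by another grow longer as the
  angle shrinks, but they become rarer at the same rate, so the removed proportion stays at
  \<open>2 * \<tau> / pi\<close>; the angle enters only a bounded error per chord, and hence an O(r)
  error in a disc of radius r. Passing to a polygon loses no length, because a circumscribed polygon
  has at least the perimeter of the body, here in the form tan x >= x. On the spectral side, the
  support of the transform is tested against functions \<open>\<psi>\<close> that vanish near
  \<open>K\<close>. Fourier inversion is therefore needed only at points near which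
  \<open>\<psi>\<close> is 0, and there a Gaussian tail bound replaces the usual
  approximate-identity argument.\<close>

lemma hausdorff_content_le:
  assumes "E \<subseteq> (\<Union>j<n. ball (x j) \<rho>)" "0 \<le> \<rho>" "\<rho> \<le> \<delta>"
  shows "hausdorff_content \<delta> E \<le> ennreal (real n * (2 * \<rho>))"
proof -
  define r where "r j = (if j < n then \<rho> else 0)" for j
  have "hausdorff_content \<delta> E \<le> (\<Sum>j. ennreal (2 * r j))"
    unfolding hausdorff_content_def
  proof (rule Inf_lower, intro CollectI exI conjI allI)
    show "E \<subseteq> (\<Union>j. ball (x j) (r j))" using assms(1) by (force simp: r_def)
  qed (use assms in \<open>auto simp: r_def\<close>)
  also have "\<dots> = (\<Sum>j<n. ennreal (2 * r j))"
    by (rule suminf_finite) (auto simp: r_def)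
  also have "\<dots> = ennreal (real n * (2 * \<rho>))"
    using assms(2) by (simp add: r_def ennreal_of_nat_eq_real_of_nat ennreal_mult)
  finally show ?thesis .
qed

text \<open>Cut the segment into n equal pieces and place a ball at the midpoint of each. This is
  the sharp constant that \<open>\<phi> 0 = 1\<close> calls for.\<close>

lemma hausdorff_outer_segment_le:
  fixes p v :: "real^2"
  assumes v: "norm v = 1" and r: "0 < r"
  shows "hausdorff_outer ((\<lambda>t. p + t *\<^sub>R v) ` {-r<..<r}) \<le> ennreal (2 * r)"
  unfolding hausdorff_outer_eq_SUP
proof (rule SUP_least)
  fix \<delta> :: real assume "\<delta> \<in> {0<..}"
  then have d: "0 < \<delta>" by simp
  \<comment> \<open>Half the length of a piece is r/n; the factor above 1 makes the open balls
    contain the endpoints, and it disappears in the limit.\<close>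
  define \<rho> where "\<rho> n = r / real n * (1 + 1 / real n)" for n :: nat
  have cov: "(\<lambda>t. p + t *\<^sub>R v) ` {-r<..<r} \<subseteq> (\<Union>j<n. ball (p + (2 * r * (real j + 1/2) / real n - r) *\<^sub>R v) (\<rho> n))"
    if n: "0 < n" for n
  proof
    fix y assume "y \<in> (\<lambda>t. p + t *\<^sub>R v) ` {-r<..<r}"
    then obtain t where t: "-r < t" "t < r" and y: "y = p + t *\<^sub>R v" by auto
    define z where "z = (t + r) * real n / (2 * r)"
    have "t * real n < r * real n" using t n by simp
    have z: "0 \<le> z" "z < real n"
      unfolding z_def using t r n
       apply (intro divide_nonneg_pos mult_nonneg_nonneg) apply auto[3]
      using \<open>t * real n < r * real n\<close> r by (simp add: field_simps)
    define j where "j = nat \<lfloor>z\<rfloor>"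
    have j: "real j \<le> z" "z < real j + 1" using z by (auto simp: j_def)
    have jn: "j < n" using j z by linarith
    have tz: "t = 2 * r * z / real n - r" using r n by (simp add: z_def field_simps)
    have "dist (p + (2 * r * (real j + 1/2) / real n - r) *\<^sub>R v) y
       = \<bar>(2 * r * (real j + 1/2) / real n - r) - t\<bar>"
      using v by (simp add: y dist_norm scaleR_diff_left[symmetric] del: scaleR_diff_left)
    also have "\<dots> = (2 * r / real n) * \<bar>real j + 1/2 - z\<bar>"
    proof -
      have "(2 * r * (real j + 1/2) / real n - r) - t = (2 * r / real n) * (real j + 1/2 - z)"
        using n by (simp add: tz field_simps)
      then show ?thesis using r n by (simp add: abs_mult)
    qed
    also have "\<dots> \<le> (2 * r / real n) * (1/2)"
    proof (rule mult_left_mono)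
      show "\<bar>real j + 1/2 - z\<bar> \<le> 1/2" using j unfolding abs_le_iff by linarith
    qed (use r in simp)
    also have "\<dots> < \<rho> n" using r n by (simp add: \<rho>_def field_simps)
    finally show "y \<in> (\<Union>j<n. ball (p + (2 * r * (real j + 1/2) / real n - r) *\<^sub>R v) (\<rho> n))"
      using jn by auto
  qed
  have lim: "(\<lambda>n. ennreal (real n * (2 * \<rho> n))) \<longlonglongrightarrow> ennreal (2 * r)"
  proof (intro tendsto_ennrealI)
    have "(\<lambda>n. 2 * r * (1 + 1 / real n)) \<longlonglongrightarrow> 2 * r * (1 + 0)"
      by (intro tendsto_intros lim_1_over_n)
    moreover have "\<forall>\<^sub>F n in sequentially. 2 * r * (1 + 1 / real n) = real n * (2 * \<rho> n)"
      using eventually_gt_at_top[of 0] by eventually_elim (simp add: \<rho>_def)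
    ultimately show "(\<lambda>n. real n * (2 * \<rho> n)) \<longlonglongrightarrow> 2 * r"
      by (auto intro: Lim_transform_eventually)
  qed
  have "(\<lambda>n. r * (1 / real n) * (1 + 1 / real n)) \<longlonglongrightarrow> r * 0 * (1 + 0)"
    by (intro tendsto_intros lim_1_over_n)
  then have "\<rho> \<longlonglongrightarrow> 0" by (simp add: \<rho>_def[abs_def])
  then have "\<forall>\<^sub>F n in sequentially. \<rho> n < \<delta>" using d by (rule order_tendstoD)
  then have "\<forall>\<^sub>F n in sequentially. hausdorff_content \<delta> ((\<lambda>t. p + t *\<^sub>R v) ` {-r<..<r})
      \<le> ennreal (real n * (2 * \<rho> n))"
    using eventually_gt_at_top[of 0]
    by eventually_elim (rule hausdorff_content_le[OF cov], use r in \<open>auto simp: \<rho>_def\<close>)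
  then show "hausdorff_content \<delta> ((\<lambda>t. p + t *\<^sub>R v) ` {-r<..<r}) \<le> ennreal (2 * r)"
    by (intro tendsto_lowerbound[OF lim]) auto
qed

text \<open>Projecting a ball onto the line gives an interval of length twice its radius.\<close>

lemma hausdorff_outer_line_ge:
  fixes p v :: "real^2"
  assumes v: "norm v = 1" and T: "\<And>t. t \<in> T \<Longrightarrow> p + t *\<^sub>R v \<in> E"
  shows "emeasure lborel T \<le> hausdorff_outer E"
proof -
  have "emeasure lborel T \<le> hausdorff_content 1 E"
    unfolding hausdorff_content_def
  proof (rule Inf_greatest, clarify)
    fix x :: "nat \<Rightarrow> real^2" and r :: "nat \<Rightarrow> real"
    assume cov: "E \<subseteq> (\<Union>j. ball (x j) (r j))" and r: "\<forall>j. 0 \<le> r j \<and> r j \<le> 1"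
    define c where "c j = (x j - p) \<bullet> v" for j
    have "T \<subseteq> (\<Union>j. {c j - r j .. c j + r j})"
    proof
      fix t assume "t \<in> T"
      then obtain j where j: "p + t *\<^sub>R v \<in> ball (x j) (r j)" using T cov by blast
      have "\<bar>(x j - (p + t *\<^sub>R v)) \<bullet> v\<bar> \<le> norm (x j - (p + t *\<^sub>R v)) * norm v"
        by (rule Cauchy_Schwarz_ineq2)
      also have "\<dots> < r j" using j v by (simp add: dist_norm)
      also have "(x j - (p + t *\<^sub>R v)) \<bullet> v = c j - t"
        using v by (simp add: c_def inner_diff_left inner_add_left dot_square_norm)
      finally show "t \<in> (\<Union>j. {c j - r j .. c j + r j})" by (auto intro!: exI[of _ j])
    qed
    then have "emeasure lborel T \<le> emeasure lborel (\<Union>j. {c j - r j .. c j + r j})"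
      by (intro emeasure_mono) auto
    also have "\<dots> \<le> (\<Sum>j. emeasure lborel {c j - r j .. c j + r j})"
      by (rule emeasure_subadditive_countably) auto
    also have "\<dots> = (\<Sum>j. ennreal (2 * r j))" using r by simp
    finally show "emeasure lborel T \<le> (\<Sum>j. ennreal (2 * r j))" .
  qed
  also have "\<dots> \<le> hausdorff_outer E" by (rule hausdorff_content_le_outer) simp
  finally show ?thesis .
qed

section \<open>Invariance of the Hausdorff measure under surjective isometries\<close>

lemma hausdorff_content_vimage_le:
  fixes R :: "real^2 \<Rightarrow> real^2"
  assumes R: "\<And>x y. dist (R x) (R y) = dist x y" and Q: "\<And>y. R (Q y) = y"
  shows "hausdorff_content \<delta> (R -` A) \<le> hausdorff_content \<delta> A"
  unfolding hausdorff_content_def[of \<delta> A]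
proof (rule Inf_greatest, clarify)
  fix x :: "nat \<Rightarrow> real^2" and r :: "nat \<Rightarrow> real"
  assume cov: "A \<subseteq> (\<Union>j. ball (x j) (r j))" and r: "\<forall>j. 0 \<le> r j \<and> r j \<le> \<delta>"
  show "hausdorff_content \<delta> (R -` A) \<le> (\<Sum>j. ennreal (2 * r j))"
    unfolding hausdorff_content_def
  proof (rule Inf_lower, intro CollectI exI conjI allI)
    show "R -` A \<subseteq> (\<Union>j. ball (Q (x j)) (r j))"
    proof
      fix y assume "y \<in> R -` A"
      then obtain j where "R y \<in> ball (x j) (r j)" using cov by blast
      then have "y \<in> ball (Q (x j)) (r j)" using R[of "Q (x j)" y] Q by simp
      then show "y \<in> (\<Union>j. ball (Q (x j)) (r j))" by blast
    qed
  qed (use r in auto)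
qed

text \<open>Ball covers correspond under \<open>R\<close> and \<open>Q\<close> with the same radii,
  so the contents agree at every scale. Rotations are the intended case: they allow averaging over
  the circle.\<close>

lemma distr_hausdorff_measure:
  fixes R Q :: "real^2 \<Rightarrow> real^2"
  assumes R: "\<And>x y. dist (R x) (R y) = dist x y" and RQ: "\<And>y. R (Q y) = y"
  shows "distr hausdorff_measure borel R = hausdorff_measure"
proof (rule measure_eqI)
  have QR: "Q (R x) = x" for x
    using R[of "Q (R x)" x] RQ[of "R x"] by simp
  have Q: "dist (Q x) (Q y) = dist x y" for x y
    using R[of "Q x" "Q y"] by (simp add: RQ)
  have "continuous_on UNIV R"
    by (rule continuous_onI) (use R in \<open>auto intro: exI\<close>)
  then have m: "R \<in> borel_measurable borel" by (rule borel_measurable_continuous_onI)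
  fix A assume "A \<in> sets (distr hausdorff_measure borel R)"
  then have A: "A \<in> sets borel" by simp
  have vA: "R -` A \<in> sets borel" using measurable_sets[OF m A] by simp
  have "hausdorff_content \<delta> (R -` A) = hausdorff_content \<delta> A" for \<delta>
  proof (rule antisym)
    have "Q -` (R -` A) = A" by (auto simp: RQ)
    then show "hausdorff_content \<delta> A \<le> hausdorff_content \<delta> (R -` A)"
      using hausdorff_content_vimage_le[of Q R \<delta> "R -` A"] Q QR by simp
  qed (rule hausdorff_content_vimage_le[OF R RQ])
  then have "hausdorff_outer (R -` A) = hausdorff_outer A"
    by (simp add: hausdorff_outer_eq_SUP)
  then show "emeasure (distr hausdorff_measure borel R) A = emeasure hausdorff_measure A"
    using m A vA by (simp add: emeasure_distr emeasure_hausdorff_measure cong: measurable_cong_sets)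
qed simp

section \<open>Circumscribed polygons and zonotopes\<close>

definition dir :: "real \<Rightarrow> real^2" where
  "dir t = vector [cos t, sin t]"

lemma inner_vec2: "(x::real^2) \<bullet> y = x $ 1 * y $ 1 + x $ 2 * y $ 2"
  by (simp add: inner_vec_def sum_2)

lemma inner_dir: "dir s \<bullet> dir t = cos (s - t)"
  by (simp add: inner_vec2 dir_def cos_diff)

lemma norm_dir [simp]: "norm (dir t) = 1"
  by (simp add: norm_eq_sqrt_inner inner_dir)

lemma dir_exists:
  assumes "norm (x::real^2) = 1"
  obtains t where "0 \<le> t" "t < 2 * pi" "x = dir t"
proof -
  have "(x $ 1)\<^sup>2 + (x $ 2)\<^sup>2 = 1"
    using assms by (simp add: norm_eq_sqrt_inner inner_vec2 power2_eq_square)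
  then obtain t where "0 \<le> t" "t < 2 * pi" "x $ 1 = cos t" "x $ 2 = sin t"
    using sincos_total_2pi by metis
  then show ?thesis by (intro that[of t]) (auto simp: dir_def vec_eq_iff forall_2)
qed

lemma dir_add_pi: "dir (t + pi) = - dir t"
  by (simp add: dir_def vec_eq_iff forall_2)

lemma dir_add_dir: "dir (t + d) + dir (t - d) = (2 * cos d) *\<^sub>R dir t"
  by (simp add: dir_def vec_eq_iff forall_2 cos_add cos_diff sin_add sin_diff)

text \<open>A chord is twice the sine of half its arc, hence no longer than the arc.\<close>

lemma dist_dir_le: "dist (dir s) (dir t) \<le> \<bar>s - t\<bar>"
proof -
  have "(dist (dir s) (dir t))\<^sup>2 = 2 - 2 * cos (s - t)"
    by (simp add: dist_norm power2_norm_eq_inner inner_diff_left inner_diff_right inner_dir)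
       (simp add: cos_diff)
  also have "\<dots> = (2 * sin ((s - t) / 2))\<^sup>2"
  proof -
    have half: "2 * ((s - t) / 2) = s - t" by simp
    show ?thesis using cos_double_sin[of "(s - t) / 2"] unfolding half by (simp add: power_mult_distrib)
  qed
  also have "\<dots> \<le> \<bar>s - t\<bar>\<^sup>2"
    using abs_sin_x_le_abs_x[of "(s - t) / 2"] abs_le_square_iff[of "2 * sin ((s - t) / 2)" "s - t"]
    by (simp add: abs_mult)
  finally show ?thesis by (rule power2_le_imp_le) simp
qed

text \<open>Two quarter turns make the point reflection.\<close>

lemma convex_body_symmetric:
  assumes "quarter_turn_symmetric K" "x \<in> K"
  shows "- x \<in> K"
proof -
  let ?q = "\<lambda>x::real^2. (vector [- (x $ 2), x $ 1] :: real^2)"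
  have "?q (?q x) \<in> K" using assms unfolding quarter_turn_symmetric_def by blast
  moreover have "?q (?q x) = - x" by (simp add: vec_eq_iff forall_2)
  ultimately show ?thesis by simp
qed

text \<open>The radii \<open>\<rho>\<close> and \<open>B\<close> bound the support function on unit
  vectors from below and above, and \<open>B\<close> is also its Lipschitz constant. They are
  parameters because the shrinking factor is expressed through their ratio.\<close>

locale symmetric_body =
  fixes K :: "(real^2) set" and \<rho> B :: real
  assumes compact: "compact K" and conv: "convex K"
    and sym: "x \<in> K \<Longrightarrow> - x \<in> K"
    and rho: "0 < \<rho>" "ball 0 \<rho> \<subseteq> K"
    and B: "\<And>x. x \<in> K \<Longrightarrow> norm x \<le> B"
begin

abbreviation h :: "real^2 \<Rightarrow> real" where "h \<equiv> support_function K"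

lemma K_ne: "K \<noteq> {}" using rho by auto

lemma inner_le_h: "x \<in> K \<Longrightarrow> x \<bullet> \<theta> \<le> h \<theta>"
proof -
  have "bdd_above ((\<lambda>x. x \<bullet> \<theta>) ` K)"
    by (intro bounded_imp_bdd_above compact_imp_bounded compact_continuous_image compact continuous_intros)
  then show "x \<in> K \<Longrightarrow> x \<bullet> \<theta> \<le> h \<theta>"
    unfolding support_function_def by (rule cSUP_upper[rotated])
qed

lemma h_le: "(\<And>x. x \<in> K \<Longrightarrow> x \<bullet> \<theta> \<le> c) \<Longrightarrow> h \<theta> \<le> c"
  unfolding support_function_def by (rule cSUP_least[OF K_ne])

lemma h_add_le: "h (\<theta> + \<eta>) \<le> h \<theta> + h \<eta>"
  by (rule h_le) (simp add: inner_add_right add_mono inner_le_h)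

lemma h_scaleR: assumes "0 \<le> c" shows "h (c *\<^sub>R \<theta>) = c * h \<theta>"
proof (cases "c = 0")
  case True
  then show ?thesis using K_ne by (simp add: support_function_def)
next
  case False
  with assms have c: "0 < c" by simp
  have le: "h (c *\<^sub>R \<theta>) \<le> c * h \<theta>" if "0 < c" for c \<theta>
    using that by (intro h_le) (simp add: inner_le_h)
  have "h \<theta> \<le> inverse c * h (c *\<^sub>R \<theta>)"
    using le[of "inverse c" "c *\<^sub>R \<theta>"] c by simp
  with le[OF c, of \<theta>] c show ?thesis by (simp add: field_simps)
qed

lemma h_uminus: "h (- \<theta>) = h \<theta>"
proof -
  have "h (- \<theta>) \<le> h \<theta>" for \<theta>
    by (rule h_le) (use inner_le_h[OF sym] in auto)
  from this[of \<theta>] this[of "- \<theta>"] show ?thesis by simp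
qed

lemma zero_mem: "0 \<in> K"
  using rho centre_in_ball[of "0::real^2" \<rho>] by blast

lemma B_pos: "0 \<le> B"
  using B[OF zero_mem] by simp

lemma h_diff_le: "h \<theta> - h \<eta> \<le> B * dist \<theta> \<eta>"
proof -
  have "h \<theta> \<le> h \<eta> + B * dist \<theta> \<eta>"
  proof (rule h_le)
    fix x assume x: "x \<in> K"
    have "x \<bullet> \<theta> = x \<bullet> \<eta> + x \<bullet> (\<theta> - \<eta>)" by (simp add: inner_diff_right)
    also have "\<dots> \<le> h \<eta> + norm x * norm (\<theta> - \<eta>)"
      by (intro add_mono inner_le_h x norm_cauchy_schwarz)
    also have "\<dots> \<le> h \<eta> + B * dist \<theta> \<eta>"
      using B[OF x] by (simp add: dist_norm mult_right_mono)
    finally show "x \<bullet> \<theta> \<le> h \<eta> + B * dist \<theta> \<eta>" .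
  qed
  then show ?thesis by simp
qed

lemma continuous_on_h: "continuous_on S h"
proof (rule continuous_onI)
  fix x :: "real^2" and e :: real assume e: "0 < e"
  show "\<exists>d>0. \<forall>x'\<in>S. dist x' x < d \<longrightarrow> dist (h x') (h x) \<le> e"
  proof (intro exI conjI ballI impI)
    show "0 < e / (B + 1)" using e B_pos by simp
    fix x' assume "dist x' x < e / (B + 1)"
    then have "(B + 1) * dist x' x < e" using B_pos by (simp add: field_simps)
    moreover have "\<bar>h x' - h x\<bar> \<le> B * dist x' x"
      using h_diff_le[of x' x] h_diff_le[of x x'] by (simp add: dist_commute)
    moreover have "B * dist x' x \<le> (B + 1) * dist x' x" by (intro mult_right_mono) auto
    ultimately show "dist (h x') (h x) \<le> e" by (simp add: dist_real_def)
  qed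
qed

lemma rho_le_h: assumes "norm \<theta> = 1" shows "\<rho> \<le> h \<theta>"
proof (rule field_le_mult_one_interval)
  \<comment> \<open>The ball is open, so the point at distance exactly \<open>\<rho>\<close> is only
    approached.\<close>
  fix z :: real assume z: "0 < z" "z < 1"
  have "(z * \<rho>) *\<^sub>R \<theta> \<in> ball 0 \<rho>" using z rho assms by simp
  then have "((z * \<rho>) *\<^sub>R \<theta>) \<bullet> \<theta> \<le> h \<theta>" using rho by (intro inner_le_h) auto
  then show "z * \<rho> \<le> h \<theta>" using assms by (simp add: dot_square_norm)
qed

lemma h_le_B: assumes "norm \<theta> = 1" shows "h \<theta> \<le> B"
proof (rule h_le)
  fix x assume "x \<in> K"
  then show "x \<bullet> \<theta> \<le> B" using norm_cauchy_schwarz[of x \<theta>] B[of x] assms by simp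
qed

text \<open>A compact convex set is the intersection of its supporting half-planes: a hyperplane
  separating \<open>s\<close> from \<open>K\<close> would have a normal that violates the
  assumption, once normalised.\<close>

lemma mem_if_inner_le:
  assumes "\<And>\<theta>. norm \<theta> = 1 \<Longrightarrow> s \<bullet> \<theta> \<le> h \<theta>"
  shows "s \<in> K"
proof (rule ccontr)
  assume "s \<notin> K"
  from separating_hyperplane_closed_point[OF conv compact_imp_closed[OF compact] this]
  obtain a b where ab: "a \<bullet> s < b" "\<And>x. x \<in> K \<Longrightarrow> b < a \<bullet> x" by metis
  have "0 \<in> K" using rho by auto
  with ab have a: "a \<noteq> 0" by fastforce
  have "h (- a) \<le> - b"
    using ab(2) by (intro h_le) (auto simp: inner_commute less_imp_le)
  moreover have "s \<bullet> (- a) > - b" using ab(1) by (simp add: inner_commute)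
  moreover have "s \<bullet> (inverse (norm a) *\<^sub>R (- a)) \<le> h (inverse (norm a) *\<^sub>R (- a))"
    by (rule assms) (use a in simp)
  then have "inverse (norm a) * (s \<bullet> (- a)) \<le> inverse (norm a) * h (- a)"
    by (simp add: h_scaleR del: scaleR_minus_right inner_minus_right)
  then have "s \<bullet> (- a) \<le> h (- a)" by (rule mult_left_le_imp_le) (use a in simp)
  ultimately show False by simp
qed

end

section \<open>Edge lengths of the circumscribed polygon and its generators\<close>

lemma sum_periodic_shift:
  fixes g :: "nat \<Rightarrow> real"
  assumes "\<And>m. g (m + N) = g m"
  shows "(\<Sum>m<N. g (m + j)) = (\<Sum>m<N. g m)"
proof (induction j)
  case (Suc j)
  have "(\<Sum>m<N. g (m + Suc j)) = (\<Sum>m<N. g (Suc m + j))" by simp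
  also have "\<dots> = (\<Sum>m<Suc N. g (m + j)) - g j"
    by (subst sum.lessThan_Suc_shift) simp
  also have "\<dots> = (\<Sum>m<N. g (m + j))"
    using assms[of j] by (simp add: add.commute)
  finally show ?case using Suc by simp
qed simp

text \<open>The circumscribed polygon with edge normals \<open>dir (\<alpha> + \<pi>m/N)\<close>: \<open>edge m\<close> is the
  length of its \<open>m\<close>-th edge, and the edges are parallel to \<open>dir (\<alpha> + \<pi>m/N + \<pi>/2)\<close>.\<close>

locale circumscribed = symmetric_body +
  fixes \<alpha> :: real and N :: nat
  assumes N: "2 \<le> N"
begin

definition ang :: "int \<Rightarrow> real" where "ang m = \<alpha> + pi * real_of_int m / real N"
definition hh :: "int \<Rightarrow> real" where "hh m = h (dir (ang m))"
text \<open>On the m-th supporting line the two neighbouring lines cut at distances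
  \<open>(hh (m + 1) - cos d * hh m) / sin d\<close> and
  \<open>(hh (m - 1) - cos d * hh m) / sin d\<close> on either side of the foot of the normal, with
  d = pi/N; the formula adds them. Integer indices keep m - 1 meaningful at m = 0.\<close>

definition edge :: "int \<Rightarrow> real" where
  "edge m = (hh (m + 1) + hh (m - 1) - 2 * cos (pi / real N) * hh m) / sin (pi / real N)"

lemma sin_pos: "0 < sin (pi / real N)"
  using N by (intro sin_gt_zero) (auto simp: field_simps)

lemma cos_nonneg: "0 \<le> cos (pi / real N)"
  using N by (intro cos_ge_zero) (auto simp: field_simps intro: order_trans[of _ 0])

lemma ang_add: "ang (m + k) = ang m + pi * real_of_int k / real N"
  by (simp add: ang_def ring_distribs add_divide_distrib)

lemma hh_period: "hh (m + int N) = hh m"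
  using N by (simp add: hh_def ang_add dir_add_pi h_uminus)

lemma edge_period: "edge (m + int N) = edge m"
proof -
  have "hh (m + int N + 1) = hh (m + 1)" "hh (m + int N - 1) = hh (m - 1)"
    using hh_period[of "m + 1"] hh_period[of "m - 1"] by (simp_all add: algebra_simps)
  then show ?thesis by (simp add: edge_def hh_period)
qed

text \<open>Subadditivity of the support function, applied to the two neighbouring normals, whose
  sum is a multiple of the middle one. Equality is possible: the edge then degenerates to a
  vertex.\<close>

lemma edge_nonneg: "0 \<le> edge m"
proof -
  let ?d = "pi / real N"
  have "2 * cos ?d * hh m = h ((2 * cos ?d) *\<^sub>R dir (ang m))"
    using cos_nonneg by (simp add: h_scaleR hh_def)
  also have "\<dots> = h (dir (ang m + ?d) + dir (ang m - ?d))" by (simp add: dir_add_dir)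
  also have "\<dots> \<le> hh (m + 1) + hh (m - 1)"
    using h_add_le by (simp add: hh_def ang_add[of m 1] ang_add[of m "-1", simplified])
  finally show ?thesis using sin_pos by (simp add: edge_def)
qed

text \<open>By periodicity each support value enters with total coefficient (2 - 2 cos d) / sin d,
  which is 2 tan(d/2) for d = pi/N.\<close>

lemma sum_edge: "(\<Sum>m<N. edge (int m)) = 2 * tan (pi / (2 * real N)) * (\<Sum>m<N. hh (int m))"
proof -
  let ?d = "pi / real N"
  have 1: "(\<Sum>m<N. hh (int m + 1)) = (\<Sum>m<N. hh (int m))"
    using sum_periodic_shift[of "\<lambda>m. hh (int m)" N 1] hh_period by (simp add: add.commute)
  have 2: "(\<Sum>m<N. hh (int m - 1)) = (\<Sum>m<N. hh (int m))"
    using sum_periodic_shift[of "\<lambda>m. hh (int m - 1)" N 1] hh_period[of "int _ - 1"]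
    by (simp add: algebra_simps)
  have "(\<Sum>m<N. edge (int m)) = ((2 - 2 * cos ?d) / sin ?d) * (\<Sum>m<N. hh (int m))"
  proof -
    have "(\<Sum>m<N. edge (int m)) = ((\<Sum>m<N. hh (int m + 1)) + (\<Sum>m<N. hh (int m - 1))
        - 2 * cos ?d * (\<Sum>m<N. hh (int m))) / sin ?d"
      by (simp add: edge_def sum_divide_distrib[symmetric] sum.distrib sum_subtractf sum_distrib_left)
    then show ?thesis unfolding 1 2 by (simp add: algebra_simps)
  qed
  also have "(2 - 2 * cos ?d) / sin ?d = 2 * tan (pi / (2 * real N))"
  proof -
    define u where "u = pi / (2 * real N)"
    have u: "?d = 2 * u" using N by (simp add: u_def)
    have "0 < 2 * sin u * cos u" using sin_pos unfolding u sin_double .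
    then have "sin u \<noteq> 0" "cos u \<noteq> 0" by auto
    then show ?thesis
      unfolding u u_def[symmetric] sin_double cos_double_sin
      by (simp add: tan_def field_simps power2_eq_square)
  qed
  finally show ?thesis .
qed

text \<open>\<open>sin (k\<pi>/N)\<close> solves the recurrence of which \<open>sin (\<pi>/N) * edge\<close> is the residual,
  so the sum telescopes to a difference of Wronskians.\<close>

lemma sum_edge_sin: "(\<Sum>k<N. edge (j + int k) * sin (pi * real k / real N)) = 2 * hh j"
proof -
  let ?d = "pi / real N"
  define a where "a k = sin (pi * real_of_int k / real N)" for k
  have rec: "a (k + 1) + a (k - 1) = 2 * cos ?d * a k" for k
    by (simp add: a_def ring_distribs add_divide_distrib diff_divide_distrib sin_add sin_diff)
  define w where "w k = a (k - 1) * hh (j + k) - a k * hh (j + k - 1)" for k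
  have step: "sin ?d * (edge (j + int k) * a (int k)) = w (int (Suc k)) - w (int k)" for k
  proof -
    have "sin ?d * (edge (j + int k) * a (int k)) =
        a (int k) * (hh (j + int k + 1) + hh (j + int k - 1)) - (2 * cos ?d * a (int k)) * hh (j + int k)"
      using sin_pos by (simp add: edge_def field_simps)
    also have "\<dots> = w (int (Suc k)) - w (int k)"
      unfolding rec[symmetric] by (simp add: w_def algebra_simps)
    finally show ?thesis .
  qed
  have "sin ?d * (\<Sum>k<N. edge (j + int k) * a (int k)) = w (int N) - w (int 0)"
    unfolding sum_distrib_left step by (rule sum_lessThan_telescope)
  \<comment> \<open>At the two ends only \<open>a (N - 1) = sin d\<close> and
    \<open>a (-1) = - sin d\<close> survive. They multiply \<open>hh (j + N)\<close> and
    \<open>hh j\<close>, which agree by central symmetry.\<close>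
  also have "\<dots> = sin ?d * (2 * hh j)"
  proof -
    have "a (int N - 1) = sin ?d"
      using N sin_pi_minus[of ?d] by (simp add: a_def ring_distribs diff_divide_distrib)
    moreover have "a (int N) = 0" "a 0 = 0" "a (-1) = - sin ?d" using N by (simp_all add: a_def)
    ultimately show ?thesis using hh_period[of j] by (simp add: w_def)
  qed
  finally show ?thesis using sin_pos by (simp add: a_def)
qed

text \<open>Half of the left side is the support function, at the j-th normal, of the zonotope built
  from the edges. So this zonotope and \<open>K\<close> have the same supporting lines at all grid
  normals. Summing from index j onwards keeps the sine nonnegative and removes the absolute
  value.\<close>

lemma sum_edge_abs_sin:
  "(\<Sum>m<N. edge (int m) * \<bar>sin (pi * (real m - real j) / real N)\<bar>) = 2 * hh (int j)"
proof -
  define g where "g m = edge (int m) * \<bar>sin (pi * (real m - real j) / real N)\<bar>" for m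
  have per: "g (m + N) = g m" for m
  proof -
    have "pi * (real (m + N) - real j) / real N = pi * (real m - real j) / real N + pi"
      using N by (simp add: field_simps)
    then show ?thesis using edge_period[of "int m"] by (simp add: g_def)
  qed
  have "(\<Sum>m<N. g m) = (\<Sum>k<N. g (k + j))"
    by (rule sum_periodic_shift[symmetric, of g N j]) (rule per)
  also have "\<dots> = (\<Sum>k<N. edge (int j + int k) * sin (pi * real k / real N))"
  proof (intro sum.cong refl)
    fix k assume k: "k \<in> {..<N}"
    then have "0 \<le> sin (pi * real k / real N)"
      by (intro sin_ge_zero) (auto simp: field_simps)
    then show "g (k + j) = edge (int j + int k) * sin (pi * real k / real N)"
      by (simp add: g_def add.commute)
  qed
  also have "\<dots> = 2 * hh (int j)" by (rule sum_edge_sin)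
  finally show ?thesis by (simp add: g_def)
qed

text \<open>Half an edge vector: a coefficient running from -1 to 1 sweeps out the whole
  edge.\<close>

definition gen :: "nat \<Rightarrow> real^2" where
  "gen m = (edge (int m) / 2) *\<^sub>R dir (ang (int m) + pi / 2)"

lemma norm_gen: "norm (gen m) = edge (int m) / 2"
  using edge_nonneg by (simp add: gen_def)

lemma sign_sum_le:
  assumes \<epsilon>: "\<And>m. \<bar>\<epsilon> m\<bar> \<le> 1"
  shows "(\<Sum>m<N. \<epsilon> m *\<^sub>R gen m) \<bullet> dir (ang (int j)) \<le> hh (int j)"
proof -
  have "(\<Sum>m<N. \<epsilon> m *\<^sub>R gen m) \<bullet> dir (ang (int j)) \<le>
      (\<Sum>m<N. edge (int m) * \<bar>sin (pi * (real m - real j) / real N)\<bar> / 2)"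
    unfolding inner_sum_left
  proof (rule sum_mono)
    fix m
    have arg: "ang (int m) + pi / 2 - ang (int j) = pi * (real m - real j) / real N + pi / 2"
      by (simp add: ang_def right_diff_distrib diff_divide_distrib)
    have "(\<epsilon> m *\<^sub>R gen m) \<bullet> dir (ang (int j)) = (edge (int m) / 2) * (\<epsilon> m * - sin (pi * (real m - real j) / real N))"
      by (simp add: gen_def inner_dir arg cos_add)
    also have "\<dots> \<le> (edge (int m) / 2) * \<bar>sin (pi * (real m - real j) / real N)\<bar>"
    proof (intro mult_left_mono)
      have "\<epsilon> m * - sin (pi * (real m - real j) / real N) \<le> \<bar>\<epsilon> m * - sin (pi * (real m - real j) / real N)\<bar>"
        by (rule abs_ge_self)
      also have "\<dots> \<le> 1 * \<bar>sin (pi * (real m - real j) / real N)\<bar>"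
        unfolding abs_mult abs_minus_cancel by (intro mult_right_mono \<epsilon>) simp
      finally show "\<epsilon> m * - sin (pi * (real m - real j) / real N) \<le> \<bar>sin (pi * (real m - real j) / real N)\<bar>"
        by simp
    qed (use edge_nonneg in simp)
    finally show "(\<epsilon> m *\<^sub>R gen m) \<bullet> dir (ang (int j)) \<le> edge (int m) * \<bar>sin (pi * (real m - real j) / real N)\<bar> / 2"
      by simp
  qed
  also have "\<dots> = hh (int j)" using sum_edge_abs_sin[of j] by (simp add: sum_divide_distrib[symmetric])
  finally show ?thesis .
qed

lemma near_grid:
  assumes "norm \<theta> = 1"
  obtains j :: nat where "dist \<theta> (dir (ang (int j))) \<le> pi / real N"
proof -
  obtain s where s: "\<theta> = dir s" using dir_exists[OF assms] by metis
  \<comment> \<open>Full turns are added to the angle until it exceeds \<open>\<alpha>\<close>, so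
    that the nearest grid point below it has a natural index. The index may be larger than N: the
    grid simply winds round the circle.\<close>
  obtain k :: nat where k: "(\<alpha> - s) / (2 * pi) \<le> real k" using real_arch_simple by blast
  define s' where "s' = s + real k * (2 * pi)"
  have "dir s' = dir s"
  proof -
    have "cos (s + real k * (2 * pi)) = cos s" "sin (s + real k * (2 * pi)) = sin s"
      using sin_cos_eq_iff[of "s + real k * (2 * pi)" s]
      by (auto intro!: exI[of _ "int k"])
    then show ?thesis by (simp add: dir_def s'_def)
  qed
  have s': "\<alpha> \<le> s'" using k by (simp add: s'_def field_simps)
  define z where "z = (s' - \<alpha>) * real N / pi"
  have z: "0 \<le> z" using s' by (simp add: z_def)
  define j where "j = nat \<lfloor>z\<rfloor>"
  have j: "real j \<le> z" "z < real j + 1" using z by (auto simp: j_def)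
  have "s' = \<alpha> + pi * z / real N" using N by (simp add: z_def)
  then have "s' - ang (int j) = (pi / real N) * (z - real j)"
    by (simp add: ang_def right_diff_distrib diff_divide_distrib)
  moreover have "(pi / real N) * (z - real j) \<le> (pi / real N) * 1" using j by (intro mult_left_mono) auto
  moreover have "0 \<le> (pi / real N) * (z - real j)" using j by simp
  ultimately have "\<bar>s' - ang (int j)\<bar> \<le> pi / real N" by simp
  with dist_dir_le[of s' "ang (int j)"] \<open>dir s' = dir s\<close> s show ?thesis
    by (intro that[of j]) auto
qed

text \<open>A sign sum \<open>s\<close> obeys the constraints of \<open>K\<close> exactly at the
  grid normals. In between, the Lipschitz constants \<open>B\<close> of the support function and
  \<open>norm s\<close> of the linear form cost \<open>(B + norm s) * pi / N\<close>. Testing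
  \<open>s\<close> in its own direction, with \<open>pi / N <= 1/2\<close> from
  \<open>8 <= N\<close>, gives \<open>norm s <= 4 * B\<close>; hence the 5. Since the support
  function is at least \<open>\<rho>\<close> on unit vectors, the additive error becomes a
  factor.\<close>

lemma scaled_sum_mem:
  assumes \<epsilon>: "\<And>m. \<bar>\<epsilon> m\<bar> \<le> 1" and N8: "8 \<le> N"
  shows "(\<Sum>m<N. \<epsilon> m *\<^sub>R (inverse (1 + 5 * B * pi / (\<rho> * real N)) *\<^sub>R gen m)) \<in> K"
proof -
  define s where "s = (\<Sum>m<N. \<epsilon> m *\<^sub>R gen m)"
  have est: "s \<bullet> \<theta> \<le> h \<theta> + (B + norm s) * (pi / real N)" if \<theta>: "norm \<theta> = 1" for \<theta>
  proof -
    obtain j where j: "dist \<theta> (dir (ang (int j))) \<le> pi / real N" using near_grid[OF \<theta>] .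
    have "s \<bullet> \<theta> = s \<bullet> dir (ang (int j)) + s \<bullet> (\<theta> - dir (ang (int j)))"
      by (simp add: inner_diff_right)
    also have "\<dots> \<le> hh (int j) + norm s * dist \<theta> (dir (ang (int j)))"
      unfolding dist_norm s_def by (intro add_mono sign_sum_le \<epsilon> norm_cauchy_schwarz)
    also have "\<dots> \<le> (h \<theta> + B * dist \<theta> (dir (ang (int j)))) + norm s * dist \<theta> (dir (ang (int j)))"
      using h_diff_le[of "dir (ang (int j))" \<theta>] by (simp add: hh_def dist_commute)
    also have "\<dots> = h \<theta> + (B + norm s) * dist \<theta> (dir (ang (int j)))" by (simp add: algebra_simps)
    also have "\<dots> \<le> h \<theta> + (B + norm s) * (pi / real N)"
      using j B_pos by (intro add_left_mono mult_left_mono) auto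
    finally show ?thesis .
  qed
  have piN: "pi / real N \<le> 1/2" using N8 pi_less_4 by (simp add: field_simps)
  have ns: "norm s \<le> 4 * B"
  proof (cases "s = 0")
    case True then show ?thesis using B_pos by simp
  next
    case False
    define \<theta> where "\<theta> = inverse (norm s) *\<^sub>R s"
    have \<theta>: "norm \<theta> = 1" using False by (simp add: \<theta>_def)
    have "norm s = s \<bullet> \<theta>" using False by (simp add: \<theta>_def dot_square_norm power2_eq_square)
    also have "\<dots> \<le> B + (B + norm s) * (1/2)"
      using est[OF \<theta>] h_le_B[OF \<theta>] mult_left_mono[OF piN, of "B + norm s"] B_pos
        norm_ge_zero[of s] by linarith
    finally have "2 * norm s \<le> 3 * B + norm s" by argo
    then show ?thesis using B_pos by linarith
  qed
  define c where "c = 1 + 5 * B * pi / (\<rho> * real N)"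
  have c: "1 \<le> c" using B_pos rho N by (simp add: c_def)
  have "inverse c *\<^sub>R s \<in> K"
  proof (rule mem_if_inner_le)
    fix \<theta> :: "real^2" assume \<theta>: "norm \<theta> = 1"
    have "s \<bullet> \<theta> \<le> h \<theta> + (B + norm s) * (pi / real N)" by (rule est[OF \<theta>])
    also have "\<dots> \<le> h \<theta> + (5 * B) * (pi / real N)"
      using ns by (intro add_left_mono mult_right_mono) auto
    also have "\<dots> = h \<theta> + \<rho> * (5 * B * pi / (\<rho> * real N))" using rho by simp
    also have "\<dots> \<le> h \<theta> + h \<theta> * (5 * B * pi / (\<rho> * real N))"
      using rho_le_h[OF \<theta>] B_pos rho by (intro add_left_mono mult_right_mono) auto
    also have "\<dots> = c * h \<theta>" by (simp add: c_def algebra_simps)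
    finally show "(inverse c *\<^sub>R s) \<bullet> \<theta> \<le> h \<theta>" using c by (simp add: field_simps)
  qed
  also have "inverse c *\<^sub>R s = (\<Sum>m<N. \<epsilon> m *\<^sub>R (inverse c *\<^sub>R gen m))"
    by (simp add: s_def scaleR_sum_right mult.commute)
  finally show ?thesis unfolding c_def .
qed

text \<open>The determinant is the product of the lengths times the sine of the angle between the
  normals, and two distinct normals of the grid differ by an angle strictly between 0 and pi. Thus
  any two families of zero lines cross transversally.\<close>

lemma gen_not_parallel:
  assumes "i < N" "j < N" "i \<noteq> j" "0 < edge (int i)" "0 < edge (int j)"
  shows "gen i $ 1 * gen j $ 2 \<noteq> gen i $ 2 * gen j $ 1"
proof
  assume *: "gen i $ 1 * gen j $ 2 = gen i $ 2 * gen j $ 1"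
  have "gen i $ 1 * gen j $ 2 - gen i $ 2 * gen j $ 1 =
      (edge (int i) / 2) * (edge (int j) / 2) * sin (ang (int j) - ang (int i))"
    by (simp add: gen_def dir_def sin_add cos_add sin_diff algebra_simps)
  moreover have sin_abs_zero: "sin \<bar>x\<bar> = 0" if "sin x = 0" for x :: real
    using that by (simp add: abs_if)
  ultimately have "sin (ang (int j) - ang (int i)) = 0" using * assms by simp
  then have "sin \<bar>ang (int j) - ang (int i)\<bar> = 0"
    using sin_abs_zero by blast
  moreover have "\<bar>ang (int j) - ang (int i)\<bar> = pi * \<bar>real j - real i\<bar> / real N"
    using N by (simp add: ang_def abs_mult diff_divide_distrib[symmetric] right_diff_distrib[symmetric])
  moreover have "0 < pi * \<bar>real j - real i\<bar> / real N" using assms N by simp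
  moreover have "\<bar>real j - real i\<bar> < real N" using assms by (auto simp: abs_if)
  then have "pi * \<bar>real j - real i\<bar> / real N < pi" using N by (simp add: field_simps)
  ultimately show False using sin_gt_zero by fastforce
qed

end

section \<open>Mean width\<close>

definition rot :: "real \<Rightarrow> real^2 \<Rightarrow> real^2" where
  "rot \<beta> x = vector [cos \<beta> * x $ 1 - sin \<beta> * x $ 2, sin \<beta> * x $ 1 + cos \<beta> * x $ 2]"

lemma rot_dir: "rot \<beta> (dir t) = dir (t + \<beta>)"
  by (simp add: rot_def dir_def vec_eq_iff forall_2 cos_add sin_add mult.commute)

lemma norm_rot: "norm (rot \<beta> x) = norm x"
proof -
  have "(rot \<beta> x $ 1)\<^sup>2 + (rot \<beta> x $ 2)\<^sup>2 = ((x $ 1)\<^sup>2 + (x $ 2)\<^sup>2) * ((sin \<beta>)\<^sup>2 + (cos \<beta>)\<^sup>2)"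
    unfolding rot_def vector_2 by algebra
  then show ?thesis
    by (simp add: norm_eq_sqrt_inner inner_vec2 flip: power2_eq_square)
qed

lemma dist_rot: "dist (rot \<beta> x) (rot \<beta> y) = dist x y"
proof -
  have "rot \<beta> x - rot \<beta> y = rot \<beta> (x - y)"
    by (simp add: rot_def vec_eq_iff forall_2 algebra_simps)
  then show ?thesis by (simp add: dist_norm norm_rot)
qed

lemma rot_rot_uminus: "rot \<beta> (rot (- \<beta>) x) = x"
proof -
  have "c * (c * a + s * b) - s * (- (s * a) + c * b) = (s\<^sup>2 + c\<^sup>2) * a"
    "s * (c * a + s * b) + c * (- (s * a) + c * b) = (s\<^sup>2 + c\<^sup>2) * b" for a b s c :: real
    by algebra+
  from this[where a = "x $ 1" and b = "x $ 2" and s = "sin \<beta>" and c = "cos \<beta>"] show ?thesis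
    by (simp add: rot_def vec_eq_iff forall_2)
qed

lemma continuous_on_rot: "continuous_on S (rot \<beta>)"
  by (rule continuous_onI) (use dist_rot in \<open>auto intro: exI\<close>)

context symmetric_body
begin

lemma sphere_borel: "sphere 0 1 \<in> sets hausdorff_measure"
  by (simp add: closed_sphere borel_closed)

lemma set_integral_rot:
  "(LINT \<theta>:sphere 0 1|hausdorff_measure. h (rot \<beta> \<theta>)) = (LINT \<theta>:sphere 0 1|hausdorff_measure. h \<theta>)"
proof -
  have d: "distr hausdorff_measure borel (rot \<beta>) = hausdorff_measure"
    by (rule distr_hausdorff_measure[where Q = "rot (- \<beta>)"]) (simp_all add: dist_rot rot_rot_uminus)
  have m: "rot \<beta> \<in> borel_measurable hausdorff_measure"
    using borel_measurable_continuous_onI[OF continuous_on_rot] by (simp cong: measurable_cong_sets)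
  have mh: "h \<in> borel_measurable borel"
    by (rule borel_measurable_continuous_onI[OF continuous_on_h])
  have mi: "(\<lambda>\<theta>. indicator (sphere 0 1) \<theta> *\<^sub>R h \<theta>) \<in> borel_measurable borel"
    using mh sphere_borel by (intro borel_measurable_scaleR borel_measurable_indicator) simp_all
  have "(LINT \<theta>:sphere 0 1|hausdorff_measure. h \<theta>) =
      (LINT \<theta>|distr hausdorff_measure borel (rot \<beta>). indicator (sphere 0 1) \<theta> *\<^sub>R h \<theta>)"
    unfolding d set_lebesgue_integral_def ..
  also have "\<dots> = (LINT \<theta>|hausdorff_measure. indicator (sphere 0 1) (rot \<beta> \<theta>) *\<^sub>R h (rot \<beta> \<theta>))"
    by (rule integral_distr[OF m mi])
  also have "\<dots> = (LINT \<theta>:sphere 0 1|hausdorff_measure. h (rot \<beta> \<theta>))"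
    unfolding set_lebesgue_integral_def by (simp add: indicator_def norm_rot)
  finally show ?thesis by simp
qed

lemma mean_width_nonneg: "0 \<le> mean_width K"
  unfolding mean_width_def set_lebesgue_integral_def
  using rho_le_h rho by (intro mult_nonneg_nonneg integral_nonneg_AE AE_I2)
    (auto simp: indicator_def intro: order_trans[of 0 \<rho>])

text \<open>Rotation invariance makes the integral of the grid sum equal to \<open>N\<close> times that of \<open>h\<close>. The total
  mass of the circle need not be known: if it were 0 or infinite, \<open>mean_width\<close> would be 0 by \<open>x / 0 = 0\<close>.\<close>

lemma mean_width_le_grid_sum:
  assumes N: "0 < N"
  obtains \<alpha> where "real N * mean_width K \<le> 2 * (\<Sum>m<N. h (dir (\<alpha> + pi * real m / real N)))"
proof -
  define g where "g \<theta> = (\<Sum>m<N. h (rot (pi * real m / real N) \<theta>))" for \<theta>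
  have cont: "continuous_on S (\<lambda>\<theta>. h (rot \<beta> \<theta>))" for S \<beta>
    by (rule continuous_on_compose2[OF continuous_on_h[of UNIV] continuous_on_rot]) auto
  have contg: "continuous_on S g" for S
    unfolding g_def by (intro continuous_on_sum cont)
  let ?\<sigma> = hausdorff_measure and ?S = "sphere 0 1 :: (real^2) set"
  have "?S \<noteq> {}" using norm_dir[of 0] by (metis empty_iff mem_sphere_0)
  \<comment> \<open>The grid rotation is chosen where the grid sum is largest on the circle, so its
    value there dominates the average.\<close>
  then obtain \<theta>0 where \<theta>0: "\<theta>0 \<in> ?S" "\<And>\<theta>. \<theta> \<in> ?S \<Longrightarrow> g \<theta> \<le> g \<theta>0"
    using continuous_attains_sup[OF compact_sphere _ contg] by metis
  from \<theta>0(1) obtain \<alpha> where \<alpha>: "\<theta>0 = dir \<alpha>" using dir_exists[of \<theta>0] by auto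
  have g\<alpha>: "g \<theta>0 = (\<Sum>m<N. h (dir (\<alpha> + pi * real m / real N)))"
    by (simp add: g_def \<alpha> rot_dir)
  have "real N * mean_width K \<le> 2 * g \<theta>0"
  proof (cases "measure ?\<sigma> ?S = 0")
    case True
    have "0 \<le> g \<theta>0"
      unfolding g\<alpha> using rho_le_h rho by (intro sum_nonneg) (auto intro: order_trans[of 0 \<rho>])
    with True show ?thesis by (simp add: mean_width_def)
  next
    case False
    \<comment> \<open>\<open>measure\<close> returns 0 on infinite mass, so a nonzero value also
      certifies finiteness.\<close>
    then have fin: "emeasure ?\<sigma> ?S < \<infinity>" using less_top by (fastforce simp: measure_def)
    have int: "integrable ?\<sigma> (\<lambda>\<theta>. indicator ?S \<theta> *\<^sub>R F \<theta>)" if F: "\<And>S. continuous_on S F" for F :: "_ \<Rightarrow> real"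
    proof -
      obtain C where C: "\<And>\<theta>. \<theta> \<in> ?S \<Longrightarrow> norm (F \<theta>) \<le> C"
        using compact_imp_bounded[OF compact_continuous_image[OF F compact_sphere]]
        unfolding bounded_iff by blast
      have "F \<in> borel_measurable ?\<sigma>"
        using borel_measurable_continuous_onI[OF F] by (simp cong: measurable_cong_sets)
      then show ?thesis
        using C by (intro integrableI_bounded_set_indicator[OF sphere_borel _ fin, of _ C]) auto
    qed
    have "real N * (LINT \<theta>:?S|?\<sigma>. h \<theta>) = (\<Sum>m<N. LINT \<theta>:?S|?\<sigma>. h (rot (pi * real m / real N) \<theta>))"
      by (simp add: set_integral_rot)
    also have "\<dots> = (LINT \<theta>|?\<sigma>. indicator ?S \<theta> *\<^sub>R g \<theta>)"
      unfolding set_lebesgue_integral_def g_def scaleR_sum_right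
      by (rule Bochner_Integration.integral_sum[symmetric]) (rule int, rule cont)
    also have "\<dots> \<le> (LINT \<theta>|?\<sigma>. indicator ?S \<theta> *\<^sub>R g \<theta>0)"
      by (intro integral_mono int contg continuous_on_const) (auto simp: indicator_def \<theta>0)
    also have "\<dots> = measure ?\<sigma> ?S * g \<theta>0"
      using fin sphere_borel by (simp add: less_top)
    finally have "real N * (LINT \<theta>:?S|?\<sigma>. h \<theta>) \<le> measure ?\<sigma> ?S * g \<theta>0" .
    moreover have "0 < measure ?\<sigma> ?S" using False by (simp add: less_le)
    ultimately show ?thesis by (simp add: mean_width_def field_simps)
  qed
  then show ?thesis using that g\<alpha> by simp
qed

end

section \<open>The zero lines with their crossings cut out\<close>

text \<open>\<open>ennreal\<close> sends negative reals to 0, so converting term by term can only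
  increase the sum. The bounds for short chords below may indeed be negative.\<close>

lemma sum_ennreal_ge: "ennreal (sum f A) \<le> (\<Sum>x\<in>A. ennreal (f x))"
proof -
  have "ennreal (sum f A) \<le> ennreal (\<Sum>x\<in>A. max 0 (f x))"
    by (intro ennreal_leI sum_mono) simp
  also have "\<dots> = (\<Sum>x\<in>A. ennreal (f x))"
    by (subst sum_ennreal[symmetric]) (simp_all add: ennreal_max_0)
  finally show ?thesis .
qed

text \<open>A chord of the disc of radius \<open>r - s\<close>, moved by at most \<open>s\<close>, stays inside the concentric disc of
  radius \<open>r\<close>; so the chords of the latter at spacing \<open>s\<close> dominate the area of the former.\<close>

lemma chord_sum_ge:
  fixes r s t0 :: real and n :: nat
  assumes s: "0 < s" "s < r" and t0: "-r \<le> t0" "t0 \<le> -r + s" and n: "2 * r \<le> real n * s"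
  shows "pi * (r - s)\<^sup>2 \<le> s * (\<Sum>k<n. 2 * sqrt (max 0 (r\<^sup>2 - (t0 + real k * s)\<^sup>2)))"
proof -
  define R where "R = r - s"
  have R: "0 < R" using s by (simp add: R_def)
  \<comment> \<open>\<open>A\<close> is an antiderivative of the chord length of the disc of radius
    R. Clipping the grid points to the interval from -R to R lets the increments of \<open>A\<close>
    telescope to the full area.\<close>
  define A where "A t = R\<^sup>2 * arcsin (t / R) + t * sqrt (R\<^sup>2 - t\<^sup>2)" for t
  define clip where "clip t = max (-R) (min R t)" for t
  define t where "t k = t0 + real k * s" for k
  have step: "A (clip (t (Suc k))) - A (clip (t k)) \<le> s * (2 * sqrt (max 0 (r\<^sup>2 - (t k)\<^sup>2)))" for k
  proof (cases "clip (t k) < clip (t (Suc k))")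
    case False
    then have "clip (t (Suc k)) = clip (t k)" using s by (auto simp: clip_def t_def ring_distribs)
    then show ?thesis using s by simp
  next
    case True
    define a b where "a = clip (t k)" and "b = clip (t (Suc k))"
    have ab: "a < b" "- R \<le> a" "b \<le> R" "t k \<le> a" "b \<le> t k + s"
      using True s R by (auto simp: a_def b_def clip_def t_def ring_distribs split: if_splits)
    have der: "DERIV A z :> 2 * sqrt (R\<^sup>2 - z\<^sup>2)" if z: "a < z" "z < b" for z
    proof -
      have zR: "\<bar>z\<bar> < R" using z ab by auto
      then have pos: "0 < R\<^sup>2 - z\<^sup>2" using abs_square_less_1[of "z / R"] R
        by (simp add: power_divide field_simps)
      define q where "q = sqrt (R\<^sup>2 - z\<^sup>2)"
      have q: "0 < q" "q * q = R\<^sup>2 - z\<^sup>2" using pos by (simp_all add: q_def)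
      have "sqrt (1 - (z / R)\<^sup>2) = sqrt ((R\<^sup>2 - z\<^sup>2) / R\<^sup>2)"
        using R by (simp add: field_simps power_divide)
      also have "\<dots> = q / R" using R by (simp add: real_sqrt_divide q_def)
      finally have q': "sqrt (1 - (z / R)\<^sup>2) = q / R" .
      have "DERIV A z :> R\<^sup>2 * (inverse (sqrt (1 - (z / R)\<^sup>2)) * (1 / R))
          + (1 * sqrt (R\<^sup>2 - z\<^sup>2) + (inverse (sqrt (R\<^sup>2 - z\<^sup>2)) / 2 * (- (2 * z))) * z)"
        unfolding A_def using zR R pos
        by (auto intro!: derivative_eq_intros simp: field_simps)
      also have "R\<^sup>2 * (inverse (sqrt (1 - (z / R)\<^sup>2)) * (1 / R))
          + (1 * sqrt (R\<^sup>2 - z\<^sup>2) + (inverse (sqrt (R\<^sup>2 - z\<^sup>2)) / 2 * (- (2 * z))) * z) = 2 * q"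
        unfolding q' q_def[symmetric] using q R by (simp add: field_simps power2_eq_square)
      finally show ?thesis by (simp add: q_def)
    qed
    have "continuous_on {a..b} A"
      unfolding A_def using ab R by (intro continuous_intros) (auto simp: field_simps)
    then obtain l z where z: "a < z" "z < b" "DERIV A z :> l" "A b - A a = (b - a) * l"
      using MVT[of a b A] ab(1) der real_differentiable_def by metis
    have l: "l = 2 * sqrt (R\<^sup>2 - z\<^sup>2)" using DERIV_unique[OF z(3) der] z by simp
    \<comment> \<open>The mean value point \<open>z\<close> is within \<open>s\<close> of
      \<open>t k\<close>, and R + s = r; so the chord of the smaller disc at \<open>z\<close> is no
      longer than that of the larger disc at \<open>t k\<close>.\<close>
    have zk: "\<bar>t k\<bar> \<le> \<bar>z\<bar> + s" "\<bar>z\<bar> \<le> R" using z ab by auto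
    have "(t k)\<^sup>2 \<le> (\<bar>z\<bar> + s)\<^sup>2" using zk(1) power_mono[of "\<bar>t k\<bar>" "\<bar>z\<bar> + s" 2] by simp
    also have "\<dots> = z\<^sup>2 + s * (2 * \<bar>z\<bar> + s)" by (simp add: power2_eq_square algebra_simps)
    also have "\<dots> \<le> z\<^sup>2 + s * (2 * R + s)" using zk s by simp
    also have "\<dots> = z\<^sup>2 + r\<^sup>2 - R\<^sup>2" by (simp add: R_def power2_eq_square algebra_simps)
    finally have le: "R\<^sup>2 - z\<^sup>2 \<le> r\<^sup>2 - (t k)\<^sup>2" by simp
    have "0 \<le> R\<^sup>2 - z\<^sup>2" using zk(2) power_mono[of "\<bar>z\<bar>" R 2] by simp
    then have "0 \<le> l" by (simp add: l)
    have "A b - A a \<le> s * l" using z(4) ab \<open>0 \<le> l\<close> by (simp add: mult_right_mono)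
    also have "\<dots> \<le> s * (2 * sqrt (max 0 (r\<^sup>2 - (t k)\<^sup>2)))"
      unfolding l using le s by (intro mult_left_mono real_sqrt_le_mono) auto
    finally show ?thesis by (simp add: a_def b_def)
  qed
  have "A (clip (t n)) - A (clip (t 0)) = (\<Sum>k<n. A (clip (t (Suc k))) - A (clip (t k)))"
    by (rule sum_lessThan_telescope[symmetric])
  also have "\<dots> \<le> (\<Sum>k<n. s * (2 * sqrt (max 0 (r\<^sup>2 - (t k)\<^sup>2))))"
    by (intro sum_mono step)
  finally have "A (clip (t n)) - A (clip (t 0)) \<le> s * (\<Sum>k<n. 2 * sqrt (max 0 (r\<^sup>2 - (t0 + real k * s)\<^sup>2)))"
    by (simp add: sum_distrib_left t_def)
  moreover have "clip (t n) = R" "clip (t 0) = - R"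
    using t0 n s R by (auto simp: clip_def t_def R_def)
  moreover have "A R = pi * R\<^sup>2 / 2" "A (- R) = - (pi * R\<^sup>2 / 2)" using R by (simp_all add: A_def)
  ultimately show ?thesis by (simp add: R_def)
qed

section \<open>Near-zeros of a cosine along a line\<close>

lemma abs_cos_small:
  assumes \<tau>: "0 < \<tau>" "\<tau> < pi / 2" and u: "\<bar>cos u\<bar> < sin \<tau>"
  obtains k :: int where "\<bar>u - (real_of_int k + 1/2) * pi\<bar> < \<tau>"
proof -
  define k where "k = \<lfloor>u / pi\<rfloor>"
  define w where "w = u - (real_of_int k + 1/2) * pi"
  have "real_of_int k \<le> u / pi" "u / pi < real_of_int k + 1" by (auto simp: k_def)
  then have "real_of_int k * pi \<le> u" "u < (real_of_int k + 1) * pi" by (simp_all add: field_simps)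
  then have w: "\<bar>w\<bar> \<le> pi / 2" unfolding w_def abs_le_iff distrib_right by linarith
  have "u = (w + pi / 2) + pi * real_of_int k" by (simp add: w_def algebra_simps)
  then have "cos u = - sin w * cos (pi * real_of_int k)"
    by (simp only: cos_add) (simp add: cos_add sin_npi_int)
  then have "\<bar>cos u\<bar> = \<bar>sin w\<bar>" by (simp add: abs_mult cos_npi_int)
  also have "\<dots> = sin \<bar>w\<bar>"
    using sin_ge_zero[of "\<bar>w\<bar>"] w by (cases "w < 0") auto
  finally have "sin \<bar>w\<bar> < sin \<tau>" using u by simp
  then have "\<bar>w\<bar> < \<tau>" using w \<tau> by (subst (asm) sin_mono_less_eq) auto
  then show ?thesis using that by (simp add: w_def)
qed

text \<open>The set lies in intervals of length \<open>2 * \<tau> / \<bar>\<beta>\<bar>\<close>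
  about the zeros of the cosine, whose number is at most
  \<open>\<bar>\<beta>\<bar> * L / pi + 2\<close>. In the product the frequency cancels from the
  main term and stays only in the boundary term.\<close>

lemma emeasure_abs_cos_small:
  fixes \<alpha> \<beta> a L \<tau> :: real
  assumes \<tau>: "0 < \<tau>" "\<tau> < pi / 2" and \<beta>: "\<beta> \<noteq> 0" and L: "0 \<le> L"
  shows "emeasure lborel {t\<in>{a..a+L}. \<bar>cos (\<alpha> + \<beta> * t)\<bar> < sin \<tau>} \<le> ennreal (2 * \<tau> * (L / pi + 2 / \<bar>\<beta>\<bar>))"
proof -
  define lo where "lo = min (\<alpha> + \<beta> * a) (\<alpha> + \<beta> * (a + L))"
  define hi where "hi = lo + \<bar>\<beta>\<bar> * L"
  have range: "lo \<le> \<alpha> + \<beta> * t \<and> \<alpha> + \<beta> * t \<le> hi" if "t \<in> {a..a+L}" for t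
  proof (cases "0 < \<beta>")
    case True
    then have "\<beta> * a \<le> \<beta> * t" "\<beta> * t \<le> \<beta> * (a + L)" "0 \<le> \<beta> * L" using that L by simp_all
    then show ?thesis using True by (simp add: lo_def hi_def algebra_simps)
  next
    case False
    then have "\<beta> * t \<le> \<beta> * a" "\<beta> * (a + L) \<le> \<beta> * t" "\<beta> * L \<le> 0"
      using that L \<beta> by (simp_all add: mult_le_cancel_left mult_nonpos_nonneg)
    then show ?thesis using False by (simp add: lo_def hi_def algebra_simps)
  qed
  \<comment> \<open>A zero just outside the phase range still has an interval reaching into it, so
    the range of indices is widened by \<open>\<tau>\<close> on both sides. This is where the 2 in
    the count comes from, by \<open>\<tau> < pi / 2\<close>.\<close>
  define x where "x = (lo - \<tau>) / pi - 1/2"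
  define y where "y = (hi + \<tau>) / pi - 1/2"
  define c where "c k = ((real_of_int k + 1/2) * pi - \<alpha>) / \<beta>" for k
  define I where "I k = {c k - \<tau> / \<bar>\<beta>\<bar> .. c k + \<tau> / \<bar>\<beta>\<bar>}" for k
  have cov: "{t\<in>{a..a+L}. \<bar>cos (\<alpha> + \<beta> * t)\<bar> < sin \<tau>} \<subseteq> (\<Union>k\<in>{\<lceil>x\<rceil>..\<lfloor>y\<rfloor>}. I k)"
  proof
    fix t assume "t \<in> {t\<in>{a..a+L}. \<bar>cos (\<alpha> + \<beta> * t)\<bar> < sin \<tau>}"
    then have t: "t \<in> {a..a+L}" and "\<bar>cos (\<alpha> + \<beta> * t)\<bar> < sin \<tau>" by auto
    then obtain k where k: "\<bar>\<alpha> + \<beta> * t - (real_of_int k + 1/2) * pi\<bar> < \<tau>"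
      using abs_cos_small[OF \<tau>] by blast
    have "\<beta> * (t - c k) = \<alpha> + \<beta> * t - (real_of_int k + 1/2) * pi"
      unfolding c_def right_diff_distrib using \<beta> by simp
    then have "\<bar>\<beta>\<bar> * \<bar>t - c k\<bar> = \<bar>\<alpha> + \<beta> * t - (real_of_int k + 1/2) * pi\<bar>"
      by (simp flip: abs_mult)
    with k have "\<bar>\<beta>\<bar> * \<bar>t - c k\<bar> \<le> \<tau>" by simp
    then have "\<bar>t - c k\<bar> \<le> \<tau> / \<bar>\<beta>\<bar>" using \<beta> by (simp add: pos_le_divide_eq mult.commute)
    then have "t \<in> I k" by (auto simp: I_def abs_le_iff)
    moreover have "lo - \<tau> \<le> (real_of_int k + 1/2) * pi" "(real_of_int k + 1/2) * pi \<le> hi + \<tau>"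
      using k range[OF t] by linarith+
    then have "x \<le> real_of_int k" "real_of_int k \<le> y"
      by (simp_all add: x_def y_def field_simps)
    then have "k \<in> {\<lceil>x\<rceil>..\<lfloor>y\<rfloor>}" by (simp add: ceiling_le_iff le_floor_iff)
    ultimately show "t \<in> (\<Union>k\<in>{\<lceil>x\<rceil>..\<lfloor>y\<rfloor>}. I k)" by blast
  qed
  have "emeasure lborel {t\<in>{a..a+L}. \<bar>cos (\<alpha> + \<beta> * t)\<bar> < sin \<tau>} \<le> emeasure lborel (\<Union>k\<in>{\<lceil>x\<rceil>..\<lfloor>y\<rfloor>}. I k)"
    by (intro emeasure_mono cov) (auto simp: I_def)
  also have "\<dots> \<le> (\<Sum>k\<in>{\<lceil>x\<rceil>..\<lfloor>y\<rfloor>}. emeasure lborel (I k))"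
    by (rule emeasure_subadditive_finite) (auto simp: I_def)
  also have "\<dots> = (\<Sum>k\<in>{\<lceil>x\<rceil>..\<lfloor>y\<rfloor>}. ennreal (2 * \<tau> / \<bar>\<beta>\<bar>))"
    using \<tau> by (intro sum.cong refl) (simp add: I_def)
  also have "\<dots> = ennreal (real (card {\<lceil>x\<rceil>..\<lfloor>y\<rfloor>}) * (2 * \<tau> / \<bar>\<beta>\<bar>))"
    using \<tau> by (subst ennreal_mult) (simp_all del: card_atLeastAtMost_int add: ennreal_of_nat_eq_real_of_nat)
  also have "\<dots> \<le> ennreal (2 * \<tau> * (L / pi + 2 / \<bar>\<beta>\<bar>))"
  proof (rule ennreal_leI)
    have yx: "y - x = \<bar>\<beta>\<bar> * L / pi + 2 * \<tau> / pi"
      by (simp add: x_def y_def hi_def diff_divide_distrib[symmetric] add_divide_distrib[symmetric])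
    have "0 \<le> y - x" unfolding yx using \<tau> L by simp
    then have "real (card {\<lceil>x\<rceil>..\<lfloor>y\<rfloor>}) \<le> y - x + 1"
      by (simp, linarith)
    also have "\<dots> \<le> \<bar>\<beta>\<bar> * L / pi + 2"
      unfolding yx using \<tau> by (simp add: field_simps)
    finally have "real (card {\<lceil>x\<rceil>..\<lfloor>y\<rfloor>}) * (2 * \<tau> / \<bar>\<beta>\<bar>) \<le> (\<bar>\<beta>\<bar> * L / pi + 2) * (2 * \<tau> / \<bar>\<beta>\<bar>)"
      using \<tau> by (intro mult_right_mono) auto
    also have "\<dots> = 2 * \<tau> * (L / pi + 2 / \<bar>\<beta>\<bar>)" using \<beta> by (simp add: field_simps)
    finally show "real (card {\<lceil>x\<rceil>..\<lfloor>y\<rfloor>}) * (2 * \<tau> / \<bar>\<beta>\<bar>) \<le> 2 * \<tau> * (L / pi + 2 / \<bar>\<beta>\<bar>)" .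
  qed
  finally show ?thesis .
qed

section \<open>The families of zero lines\<close>

lemma dir_decompose: "w = (w \<bullet> dir a) *\<^sub>R dir a + (w \<bullet> dir (a + pi / 2)) *\<^sub>R dir (a + pi / 2)"
proof -
  have "(x * c + y * s) * c + (- (x * s) + y * c) * (- s) = x * (s\<^sup>2 + c\<^sup>2)"
    "(x * c + y * s) * s + (- (x * s) + y * c) * c = y * (s\<^sup>2 + c\<^sup>2)" for x y c s :: real
    by algebra+
  from this[where c = "cos a" and s = "sin a" and x = "w $ 1" and y = "w $ 2"] show ?thesis
    by (simp add: inner_vec2 vec_eq_iff forall_2 dir_def sin_add cos_add)
qed

lemma cos_lipschitz: "\<bar>cos s - cos t\<bar> \<le> \<bar>s - t :: real\<bar>"
proof -
  have "\<bar>cos s - cos t\<bar> = \<bar>(dir s - dir t) $ 1\<bar>" by (simp add: dir_def)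
  also have "\<dots> \<le> dist (dir s) (dir t)" unfolding dist_norm by (rule component_le_norm_cart)
  also have "\<dots> \<le> \<bar>s - t\<bar>" by (rule dist_dir_le)
  finally show ?thesis .
qed

text \<open>The sine of the phase difference vanishes, so the zeros have spacing 1/2. Points of one
  family with close phases are thereby on the same line.\<close>

lemma cos_eq_0_both_imp:
  assumes "cos (2 * pi * a) = 0" "cos (2 * pi * b) = 0" "a \<noteq> b"
  shows "1/2 \<le> \<bar>a - b :: real\<bar>"
proof -
  have "sin (2 * pi * (a - b)) = 0" using assms by (simp add: right_diff_distrib sin_diff)
  then obtain k :: int where k: "2 * pi * (a - b) = real_of_int k * pi"
    using sin_zero_iff_int2 by blast
  then have k': "a - b = real_of_int k / 2"
    using mult_left_cancel[of pi "2 * (a - b)" "real_of_int k"] by (simp add: mult.commute mult.left_commute)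
  with assms(3) have "k \<noteq> 0" by auto
  then have "1 \<le> \<bar>real_of_int k\<bar>" by linarith
  then show ?thesis by (simp add: k')
qed

locale line_system =
  fixes I :: "'i set" and \<xi> :: "'i \<Rightarrow> real^2" and \<tau> :: real
  assumes fin: "finite I" and ne: "I \<noteq> {}"
    and nz: "i \<in> I \<Longrightarrow> \<xi> i \<noteq> 0"
    and np: "i \<in> I \<Longrightarrow> j \<in> I \<Longrightarrow> i \<noteq> j \<Longrightarrow> \<xi> i $ 1 * \<xi> j $ 2 \<noteq> \<xi> i $ 2 * \<xi> j $ 1"
    and \<tau>: "0 < \<tau>" "\<tau> < pi / 2" "2 * real (card I) * \<tau> \<le> pi"
begin

definition z :: "'i \<Rightarrow> real^2 \<Rightarrow> real" where "z i x = cos (2 * pi * (x \<bullet> \<xi> i))"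

text \<open>The neighbourhoods of the crossings are cut out by the size of the other cosines instead
  of by distance. What is left is closed, and along each line the cut is an explicit sublevel set of
  cosines.\<close>

definition G :: "'i \<Rightarrow> (real^2) set" where
  "G j = {x. z j x = 0 \<and> (\<forall>i\<in>I - {j}. sin \<tau> \<le> \<bar>z i x\<bar>)}"

definition \<Gamma> :: "(real^2) set" where "\<Gamma> = (\<Union>j\<in>I. G j)"

lemma sin_\<tau>: "0 < sin \<tau>" "sin \<tau> \<le> 1"
  using \<tau> by (auto intro: sin_gt_zero)

lemma continuous_on_z: "continuous_on S (z i)"
  unfolding z_def by (intro continuous_intros)

lemma closed_G: "closed (G j)"
proof -
  have "G j = {x. z j x = 0} \<inter> (\<Inter>i\<in>I - {j}. {x. sin \<tau> \<le> \<bar>z i x\<bar>})"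
    by (auto simp: G_def)
  also have "closed \<dots>"
    by (intro closed_Int closed_INT ballI closed_Collect_eq closed_Collect_le
        continuous_on_rabs continuous_on_z continuous_on_const)
  finally show ?thesis .
qed

lemma closed_\<Gamma>: "closed \<Gamma>"
  unfolding \<Gamma>_def by (intro closed_UN fin ballI closed_G)

lemma \<Gamma>_subset: "\<Gamma> \<subseteq> {x. (\<Prod>i\<in>I. z i x) = 0}"
  using fin by (auto simp: \<Gamma>_def G_def)

text \<open>The lines of family j have direction \<open>dir (a + pi / 2)\<close>. Non-parallelism
  says that every other phase moves along them with nonzero speed, which is the condition
  \<open>\<beta> \<noteq> 0\<close> of \<open>emeasure_abs_cos_small\<close>.\<close>

lemma frame:
  assumes "j \<in> I"
  obtains a where "\<xi> j = norm (\<xi> j) *\<^sub>R dir a"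
    "\<And>i. i \<in> I \<Longrightarrow> i \<noteq> j \<Longrightarrow> dir (a + pi / 2) \<bullet> \<xi> i \<noteq> 0"
proof -
  obtain a where "inverse (norm (\<xi> j)) *\<^sub>R \<xi> j = dir a"
    using dir_exists[of "inverse (norm (\<xi> j)) *\<^sub>R \<xi> j"] nz[OF assms] by auto
  then have a: "\<xi> j = norm (\<xi> j) *\<^sub>R dir a"
    using nz[OF assms] by (metis norm_eq_zero right_inverse scaleR_one scaleR_scaleR)
  moreover have "dir (a + pi / 2) \<bullet> \<xi> i \<noteq> 0" if "i \<in> I" "i \<noteq> j" for i
  proof
    assume "dir (a + pi / 2) \<bullet> \<xi> i = 0"
    then have "cos a * \<xi> i $ 2 = sin a * \<xi> i $ 1"
      by (simp add: inner_vec2 dir_def sin_add cos_add)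
    moreover have "\<xi> j $ 1 = norm (\<xi> j) * cos a" "\<xi> j $ 2 = norm (\<xi> j) * sin a"
      by (subst a, simp add: dir_def)+
    ultimately have "\<xi> i $ 1 * \<xi> j $ 2 = \<xi> i $ 2 * \<xi> j $ 1" by algebra
    with np[OF that(1) assms that(2)] show False ..
  qed
  ultimately show ?thesis by (rule that)
qed

text \<open>Bound for the proportion of a line that is cut away, namely
  \<open>2 * \<tau> / pi\<close> for each family.\<close>

definition defect :: real where
  "defect = 2 * real (card I) * \<tau> / pi"

lemma defect: "0 \<le> defect" "defect \<le> 1"
  using \<tau> by (auto simp: defect_def field_simps)

text \<open>The lines of family j have spacing \<open>s = 1 / (2 * norm (\<xi> j))\<close>. Each
  chord loses at most the proportion \<open>defect\<close> and a constant \<open>D\<close> that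
  collects the boundary terms; \<open>chord_sum_ge\<close> bounds the total chord length from below,
  and at most \<open>2 * r / s + 1\<close> chords are used. \<open>D\<close> depends on neither
  centre nor radius, which gives the uniformity that the lower density asks for.\<close>

lemma G_ball_ge:
  assumes j: "j \<in> I"
  obtains D where "0 \<le> D"
    "\<And>x r. 1 / (2 * norm (\<xi> j)) < r \<Longrightarrow>
      ennreal ((1 - defect) * pi * (r - 1 / (2 * norm (\<xi> j)))\<^sup>2 * (2 * norm (\<xi> j))
        - D * (4 * norm (\<xi> j) * r + 1))
      \<le> emeasure hausdorff_measure (G j \<inter> ball x r)"
proof -
  obtain a where a: "\<xi> j = norm (\<xi> j) *\<^sub>R dir a"
    and v: "\<And>i. i \<in> I \<Longrightarrow> i \<noteq> j \<Longrightarrow> dir (a + pi / 2) \<bullet> \<xi> i \<noteq> 0"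
    using frame[OF j] by metis
  define s where "s = 1 / (2 * norm (\<xi> j))"
  have s: "0 < s" "2 * norm (\<xi> j) = 1 / s" using nz[OF j] by (auto simp: s_def)
  define u v where "u = dir a" and "v = dir (a + pi / 2)"
  have uv: "norm u = 1" "norm v = 1" "u \<bullet> v = 0" "v \<bullet> u = 0"
    by (simp_all add: u_def v_def inner_dir cos_add)
  define \<beta> where "\<beta> i = 2 * pi * (v \<bullet> \<xi> i)" for i
  have \<beta>: "\<beta> i \<noteq> 0" if "i \<in> I - {j}" for i using v that by (simp add: \<beta>_def v_def)
  define D where "D = (\<Sum>i\<in>I - {j}. 4 * \<tau> / \<bar>\<beta> i\<bar>)"
  have D0: "0 \<le> D" unfolding D_def using \<tau> by (intro sum_nonneg) auto
  have main: "ennreal ((1 - defect) * pi * (r - s)\<^sup>2 * (1 / s) - D * (2 * r / s + 1))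
      \<le> emeasure hausdorff_measure (G j \<inter> ball x r)" if r: "s < r" for x r
  proof -
    \<comment> \<open>The lines are where the coordinate along \<open>u\<close> equals
      \<open>s * (m + 1/2)\<close>; \<open>m0\<close> is the first index whose line is not to the
      left of the disc, so \<open>t0\<close> is within \<open>s\<close> of its left end.\<close>
    define m0 where "m0 = \<lceil>(x \<bullet> u - r) / s - 1/2\<rceil>"
    define t0 where "t0 = s * (real_of_int m0 + 1/2) - x \<bullet> u"
    have "(x \<bullet> u - r) / s - 1/2 \<le> real_of_int m0" "real_of_int m0 \<le> (x \<bullet> u - r) / s + 1/2"
      unfolding m0_def by linarith+
    then have t0: "- r \<le> t0" "t0 \<le> - r + s" using s by (simp_all add: t0_def field_simps)
    define n where "n = nat \<lceil>2 * r / s\<rceil>"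
    have "0 \<le> 2 * r / s" using s r by simp
    then have n: "2 * r / s \<le> real n" "real n \<le> 2 * r / s + 1" unfolding n_def by linarith+
    have n': "2 * r \<le> real n * s" using n(1) s by (simp add: field_simps)
    define t where "t k = t0 + real k * s" for k
    define w where "w k = sqrt (max 0 (r\<^sup>2 - (t k)\<^sup>2))" for k
    define E where "E k = {y \<in> G j \<inter> ball x r. (y - x) \<bullet> u = t k}" for k
    have E_borel: "E k \<in> sets borel" for k
    proof -
      have "E k = G j \<inter> ball x r \<inter> {y. (y - x) \<bullet> u = t k}" by (auto simp: E_def)
      moreover have "closed {y. (y - x) \<bullet> u = t k}"
        by (intro closed_Collect_eq continuous_intros)
      ultimately show ?thesis using closed_G by (simp add: borel_closed borel_open sets.Int)
    qed
    have single: "ennreal ((1 - defect) * (2 * w k) - D) \<le> hausdorff_outer (E k)" for k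
    proof -
      define p where "p = x + t k *\<^sub>R u"
      define J where "J = {- w k<..<w k}"
      define bad where "bad i = {q \<in> {- w k..- w k + 2 * w k}. \<bar>cos (2 * pi * (p \<bullet> \<xi> i) + \<beta> i * q)\<bar> < sin \<tau>}" for i
      define T where "T = {q \<in> J. \<forall>i\<in>I - {j}. sin \<tau> \<le> \<bar>cos (2 * pi * (p \<bullet> \<xi> i) + \<beta> i * q)\<bar>}"
      have w0: "0 \<le> w k" by (simp add: w_def)
      have zi: "z i (p + q *\<^sub>R v) = cos (2 * pi * (p \<bullet> \<xi> i) + \<beta> i * q)" for i q
        by (simp add: z_def \<beta>_def inner_add_left algebra_simps)
      have TE: "p + q *\<^sub>R v \<in> E k" if q: "q \<in> T" for q
      proof -
        have qw: "\<bar>q\<bar> < w k" using q by (auto simp: T_def J_def)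
        then have "q\<^sup>2 < (w k)\<^sup>2" using power_strict_mono[of "\<bar>q\<bar>" "w k" 2] by simp
        moreover have pos: "0 < w k" using qw by linarith
        then have "(w k)\<^sup>2 = r\<^sup>2 - (t k)\<^sup>2" by (auto simp: w_def max_def split: if_splits)
        moreover have diff: "p + q *\<^sub>R v - x = t k *\<^sub>R u + q *\<^sub>R v" by (simp add: p_def)
        have "(norm (p + q *\<^sub>R v - x))\<^sup>2 = (t k)\<^sup>2 + q\<^sup>2"
        proof -
          have "u \<bullet> u = 1" "v \<bullet> v = 1" using uv by (simp_all add: dot_square_norm)
          then show ?thesis unfolding diff power2_norm_eq_inner inner_add_left inner_add_right
            using uv by (simp add: power2_eq_square)
        qed
        ultimately have "(norm (p + q *\<^sub>R v - x))\<^sup>2 < r\<^sup>2" by simp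
        then have "p + q *\<^sub>R v \<in> ball x r"
          using r s power_less_imp_less_base[of "norm (p + q *\<^sub>R v - x)" 2 r]
          by (simp add: dist_norm norm_minus_commute)
        moreover have "(p + q *\<^sub>R v - x) \<bullet> u = t k"
          unfolding diff using uv by (simp add: inner_add_left dot_square_norm)
        moreover have "z j (p + q *\<^sub>R v) = 0"
        proof -
          have "(p + q *\<^sub>R v) \<bullet> u = s * (real_of_int (m0 + int k) + 1/2)"
            using uv by (simp add: p_def t_def t0_def inner_add_left dot_square_norm algebra_simps)
          then have "2 * pi * ((p + q *\<^sub>R v) \<bullet> \<xi> j) = (2 * norm (\<xi> j)) * s * pi * (real_of_int (m0 + int k) + 1/2)"
            by (subst a) (simp add: u_def)
          also have "\<dots> = pi * real_of_int (m0 + int k) + pi / 2" using s by (simp add: distrib_left)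
          finally show ?thesis unfolding z_def by (simp only: cos_add sin_npi_int) simp
        qed
        ultimately show ?thesis using q by (auto simp: E_def G_def T_def zi)
      qed
      have bad_meas: "bad i \<in> sets lborel" for i unfolding bad_def by measurable
      have "T = J \<inter> (\<Inter>i\<in>I - {j}. {q. sin \<tau> \<le> \<bar>cos (2 * pi * (p \<bullet> \<xi> i) + \<beta> i * q)\<bar>})"
        by (auto simp: T_def)
      then have T_meas: "T \<in> sets lborel" using fin
        by (cases "I - {j} = {}") (auto simp: J_def intro!: sets.Int sets.finite_INT borel_closed closed_Collect_le continuous_intros)
      have "ennreal (2 * w k) = emeasure lborel J" using w0 by (simp add: J_def)
      also have "\<dots> \<le> emeasure lborel (T \<union> (\<Union>i\<in>I - {j}. bad i))"
      proof (rule emeasure_mono)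
        show "J \<subseteq> T \<union> (\<Union>i\<in>I - {j}. bad i)" by (force simp: T_def bad_def J_def)
        show "T \<union> (\<Union>i\<in>I - {j}. bad i) \<in> sets lborel" using T_meas bad_meas fin by auto
      qed
      also have "\<dots> \<le> emeasure lborel T + (\<Sum>i\<in>I - {j}. emeasure lborel (bad i))"
      proof -
        have "emeasure lborel (T \<union> (\<Union>i\<in>I - {j}. bad i)) \<le> emeasure lborel T + emeasure lborel (\<Union>i\<in>I - {j}. bad i)"
          using T_meas bad_meas fin by (intro emeasure_subadditive) auto
        also have "\<dots> \<le> emeasure lborel T + (\<Sum>i\<in>I - {j}. emeasure lborel (bad i))"
          using bad_meas fin by (intro add_left_mono emeasure_subadditive_finite) auto
        finally show ?thesis .
      qed
      also have "\<dots> \<le> emeasure lborel T + (\<Sum>i\<in>I - {j}. ennreal (2 * \<tau> * (2 * w k / pi + 2 / \<bar>\<beta> i\<bar>)))"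
        unfolding bad_def using w0 \<beta>
        by (intro add_left_mono sum_mono emeasure_abs_cos_small \<tau>) auto
      also have "(\<Sum>i\<in>I - {j}. ennreal (2 * \<tau> * (2 * w k / pi + 2 / \<bar>\<beta> i\<bar>))) =
          ennreal (\<Sum>i\<in>I - {j}. 2 * \<tau> * (2 * w k / pi + 2 / \<bar>\<beta> i\<bar>))"
        using \<tau> w0 by (intro sum_ennreal) auto
      also have "(\<Sum>i\<in>I - {j}. 2 * \<tau> * (2 * w k / pi + 2 / \<bar>\<beta> i\<bar>)) =
          real (card (I - {j})) * (2 * \<tau> * (2 * w k / pi)) + D"
        by (simp add: distrib_left sum.distrib D_def)
      also have "emeasure lborel T + ennreal (real (card (I - {j})) * (2 * \<tau> * (2 * w k / pi)) + D)
          \<le> emeasure lborel T + ennreal (defect * (2 * w k) + D)"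
      proof (intro add_left_mono ennreal_leI add_right_mono)
        have "real (card (I - {j})) * (2 * \<tau> * (2 * w k / pi)) \<le> real (card I) * (2 * \<tau> * (2 * w k / pi))"
          using fin \<tau> w0 by (intro mult_right_mono) (auto intro: card_mono)
        then show "real (card (I - {j})) * (2 * \<tau> * (2 * w k / pi)) \<le> defect * (2 * w k)"
          by (simp add: defect_def mult_ac)
      qed
      finally have "ennreal (2 * w k) \<le> emeasure lborel T + ennreal (defect * (2 * w k) + D)" .
      then have "ennreal (2 * w k) - ennreal (defect * (2 * w k) + D) \<le> emeasure lborel T"
        by (simp add: ennreal_minus_le_iff add.commute)
      also have "ennreal (2 * w k) - ennreal (defect * (2 * w k) + D) = ennreal ((1 - defect) * (2 * w k) - D)"
        using \<open>0 \<le> D\<close> defect w0 by (subst ennreal_minus) (auto simp: algebra_simps)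
      finally have "ennreal ((1 - defect) * (2 * w k) - D) \<le> emeasure lborel T" .
      also have "\<dots> \<le> hausdorff_outer (E k)"
        by (rule hausdorff_outer_line_ge[OF uv(2) TE])
      finally show ?thesis .
    qed
    have "(1 - defect) * pi * (r - s)\<^sup>2 * (1 / s) - D * (2 * r / s + 1) \<le> (\<Sum>k<n. (1 - defect) * (2 * w k) - D)"
    proof -
      have "pi * (r - s)\<^sup>2 \<le> s * (\<Sum>k<n. 2 * w k)"
        unfolding w_def t_def by (rule chord_sum_ge[OF s(1) r t0 n'])
      then have "pi * (r - s)\<^sup>2 * (1 / s) \<le> (\<Sum>k<n. 2 * w k)" using s by (simp add: field_simps)
      then have "(1 - defect) * (pi * (r - s)\<^sup>2 * (1 / s)) \<le> (1 - defect) * (\<Sum>k<n. 2 * w k)"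
        using defect by (intro mult_left_mono) auto
      moreover have "D * real n \<le> D * (2 * r / s + 1)" using n \<open>0 \<le> D\<close> by (intro mult_left_mono)
      moreover have "(\<Sum>k<n. (1 - defect) * (2 * w k) - D) = (1 - defect) * (\<Sum>k<n. 2 * w k) - D * real n"
        unfolding sum_subtractf sum_distrib_left[symmetric] by simp
      moreover have "(1 - defect) * pi * (r - s)\<^sup>2 * (1 / s) = (1 - defect) * (pi * (r - s)\<^sup>2 * (1 / s))"
        by (simp only: mult.assoc)
      ultimately show ?thesis by (metis diff_mono)
    qed
    then have "ennreal ((1 - defect) * pi * (r - s)\<^sup>2 * (1 / s) - D * (2 * r / s + 1))
        \<le> ennreal (\<Sum>k<n. (1 - defect) * (2 * w k) - D)"
      by (rule ennreal_leI)
    also have "\<dots> \<le> (\<Sum>k<n. ennreal ((1 - defect) * (2 * w k) - D))" by (rule sum_ennreal_ge)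
    also have "\<dots> \<le> (\<Sum>k<n. emeasure hausdorff_measure (E k))"
      unfolding emeasure_hausdorff_measure[OF E_borel] by (intro sum_mono single)
    also have "\<dots> = emeasure hausdorff_measure (\<Union>k<n. E k)"
    proof (rule sum_emeasure)
      have "E k \<inter> E l = {}" if "k \<noteq> l" for k l
      proof -
        have "t k \<noteq> t l" using s(1) that by (simp add: t_def)
        then show ?thesis by (auto simp: E_def)
      qed
      then show "disjoint_family_on E {..<n}" by (simp add: disjoint_family_on_def)
      show "E ` {..<n} \<subseteq> sets hausdorff_measure" unfolding sets_hausdorff_measure by (intro image_subsetI E_borel)
    qed simp
    also have "\<dots> \<le> emeasure hausdorff_measure (G j \<inter> ball x r)"
    proof (rule emeasure_mono)
      show "(\<Union>k<n. E k) \<subseteq> G j \<inter> ball x r" by (auto simp: E_def)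
      show "G j \<inter> ball x r \<in> sets hausdorff_measure"
        unfolding sets_hausdorff_measure by (intro sets.Int borel_closed closed_G borel_open open_ball)
    qed
    finally show ?thesis .
  qed
  show ?thesis
  proof (rule that[OF D0])
    fix x r assume r: "1 / (2 * norm (\<xi> j)) < r"
    have "4 * norm (\<xi> j) * r = 2 * r * (2 * norm (\<xi> j))" by simp
    also have "\<dots> = 2 * r / s" unfolding s(2) by simp
    finally have "4 * norm (\<xi> j) * r = 2 * r / s" .
    with main[of r x] r show "ennreal ((1 - defect) * pi * (r - 1 / (2 * norm (\<xi> j)))\<^sup>2 * (2 * norm (\<xi> j))
        - D * (4 * norm (\<xi> j) * r + 1)) \<le> emeasure hausdorff_measure (G j \<inter> ball x r)"
      unfolding s_def[symmetric] s(2) by simp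
  qed
qed

text \<open>The pieces are disjoint: \<open>z i\<close> vanishes on \<open>G i\<close> but has
  absolute value at least \<open>sin \<tau> > 0\<close> on every other \<open>G j\<close>.\<close>

lemma \<Gamma>_ball_eq_sum:
  "emeasure hausdorff_measure (\<Gamma> \<inter> ball x r) = (\<Sum>j\<in>I. emeasure hausdorff_measure (G j \<inter> ball x r))"
proof -
  have "\<Gamma> \<inter> ball x r = (\<Union>j\<in>I. G j \<inter> ball x r)" by (auto simp: \<Gamma>_def)
  moreover have "(\<Sum>j\<in>I. emeasure hausdorff_measure (G j \<inter> ball x r)) =
      emeasure hausdorff_measure (\<Union>j\<in>I. G j \<inter> ball x r)"
  proof (rule sum_emeasure)
    show "(\<lambda>j. G j \<inter> ball x r) ` I \<subseteq> sets hausdorff_measure"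
      unfolding sets_hausdorff_measure
      by (intro image_subsetI sets.Int borel_closed closed_G borel_open open_ball)
    have "G i \<inter> G j = {}" if "i \<in> I" "j \<in> I" "i \<noteq> j" for i j
      using that sin_\<tau> by (force simp: G_def)
    then show "disjoint_family_on (\<lambda>j. G j \<inter> ball x r) I"
      by (fastforce simp: disjoint_family_on_def)
  qed (rule fin)
  ultimately show ?thesis by simp
qed

text \<open>Summed over the families, the bounds of \<open>G_ball_ge\<close> have main term
  proportional to the area of the disc and errors of order r, uniformly in the centre. A value
  strictly below the limit is reached for all large radii.\<close>

lemma lower_surface_density_ge:
  assumes c: "c < (1 - defect) * (2 * (\<Sum>j\<in>I. norm (\<xi> j)))"
  shows "ennreal c \<le> lower_surface_density \<Gamma>"
proof -
  have "\<forall>j\<in>I. \<exists>D. \<forall>x r. 1 / (2 * norm (\<xi> j)) < r \<longrightarrow>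
      ennreal ((1 - defect) * pi * (r - 1 / (2 * norm (\<xi> j)))\<^sup>2 * (2 * norm (\<xi> j))
        - D * (4 * norm (\<xi> j) * r + 1))
      \<le> emeasure hausdorff_measure (G j \<inter> ball x r)"
    using G_ball_ge by metis
  then obtain D where D: "\<And>j x r. j \<in> I \<Longrightarrow> 1 / (2 * norm (\<xi> j)) < r \<Longrightarrow>
      ennreal ((1 - defect) * pi * (r - 1 / (2 * norm (\<xi> j)))\<^sup>2 * (2 * norm (\<xi> j))
        - D j * (4 * norm (\<xi> j) * r + 1))
      \<le> emeasure hausdorff_measure (G j \<inter> ball x r)"
    by (auto dest!: bchoice)
  define A where "A r = (\<Sum>j\<in>I. (1 - defect) * pi * (r - 1 / (2 * norm (\<xi> j)))\<^sup>2 * (2 * norm (\<xi> j))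
        - D j * (4 * norm (\<xi> j) * r + 1))" for r
  \<comment> \<open>This is \<open>A r / (pi * r\<^sup>2)\<close> rewritten as a polynomial in
    \<open>inverse r\<close>, so that its limit can be read off.\<close>
  define A' where "A' r = (\<Sum>j\<in>I. (1 - defect) * (1 - 1 / (2 * norm (\<xi> j)) * inverse r)\<^sup>2 * (2 * norm (\<xi> j))
        - D j / pi * (4 * norm (\<xi> j) * inverse r + (inverse r)\<^sup>2))" for r
  have "((\<lambda>r::real. A' r) \<longlongrightarrow> (\<Sum>j\<in>I. (1 - defect) * (1 - 1 / (2 * norm (\<xi> j)) * 0)\<^sup>2 * (2 * norm (\<xi> j))
        - D j / pi * (4 * norm (\<xi> j) * 0 + 0\<^sup>2))) at_top"
    unfolding A'_def by (intro tendsto_intros tendsto_inverse_0_at_top filterlim_ident)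
  then have "(A' \<longlongrightarrow> (1 - defect) * (2 * (\<Sum>j\<in>I. norm (\<xi> j)))) at_top"
    by (simp add: sum_distrib_left)
  then have ev: "\<forall>\<^sub>F r in at_top. c < A' r" using c by (rule order_tendstoD)
  define R where "R = (\<Sum>j\<in>I. 1 / (2 * norm (\<xi> j)))"
  have R: "1 / (2 * norm (\<xi> j)) \<le> R" if "j \<in> I" for j
    unfolding R_def by (rule member_le_sum[OF that _ fin]) simp
  show ?thesis
    unfolding lower_surface_density_def
  proof (rule Liminf_bounded)
    show "\<forall>\<^sub>F r in at_top. ennreal c \<le> (INF x. hausdorff_outer (\<Gamma> \<inter> ball x r) / emeasure lborel (ball x r))"
      using ev eventually_gt_at_top[of 0] eventually_gt_at_top[of R]
    proof eventually_elim
      case (elim r)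
      have AA: "A r / (pi * r\<^sup>2) = A' r"
        unfolding A_def A'_def sum_divide_distrib
      proof (rule sum.cong[OF refl])
        fix j assume "j \<in> I"
        then have n: "norm (\<xi> j) \<noteq> 0" using nz by simp
        show "((1 - defect) * pi * (r - 1 / (2 * norm (\<xi> j)))\<^sup>2 * (2 * norm (\<xi> j))
            - D j * (4 * norm (\<xi> j) * r + 1)) / (pi * r\<^sup>2) =
          (1 - defect) * (1 - 1 / (2 * norm (\<xi> j)) * inverse r)\<^sup>2 * (2 * norm (\<xi> j))
            - D j / pi * (4 * norm (\<xi> j) * inverse r + (inverse r)\<^sup>2)"
        proof -
          have e: "r - 1 / (2 * norm (\<xi> j)) = r * (1 - 1 / (2 * norm (\<xi> j)) * inverse r)"
            using elim by (simp add: field_simps)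
          have "(d * pi * (r\<^sup>2 * Q) * m - D j * (n * r + 1)) / (pi * r\<^sup>2) =
              d * Q * m - D j / pi * (n * inverse r + (inverse r)\<^sup>2)" for d Q m n
            using elim by (simp add: field_simps power2_eq_square)
          then show ?thesis unfolding e power_mult_distrib .
        qed
      qed
      show ?case
      proof (rule INF_greatest)
        fix x
        have "ennreal (A r) \<le> (\<Sum>j\<in>I. emeasure hausdorff_measure (G j \<inter> ball x r))"
          unfolding A_def using R elim
          by (intro order_trans[OF sum_ennreal_ge] sum_mono D) (auto intro: le_less_trans)
        also have "\<dots> = hausdorff_outer (\<Gamma> \<inter> ball x r)"
          unfolding \<Gamma>_ball_eq_sum[symmetric]
          by (intro emeasure_hausdorff_measure sets.Int borel_closed closed_\<Gamma> borel_open open_ball)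
        finally have "ennreal (A r) / ennreal (pi * r\<^sup>2) \<le> hausdorff_outer (\<Gamma> \<inter> ball x r) / ennreal (pi * r\<^sup>2)"
          by (rule divide_right_mono_ennreal)
        moreover have "emeasure lborel (ball x r) = ennreal (pi * r\<^sup>2)"
          using elim by (simp add: emeasure_ball unit_ball_vol_2)
        moreover have "ennreal c \<le> ennreal (A r) / ennreal (pi * r\<^sup>2)"
        proof (cases "0 \<le> A r")
          case True
          then have "ennreal (A r) / ennreal (pi * r\<^sup>2) = ennreal (A' r)"
            using elim by (subst divide_ennreal) (auto simp: AA)
          then show ?thesis using elim by (auto intro: ennreal_leI)
        next
          \<comment> \<open>Here \<open>c < A' r <= 0\<close>, so \<open>ennreal c\<close> is 0 and
            the claim is trivial.\<close>
          case False
          then have "A' r \<le> 0" using elim unfolding AA[symmetric] by (simp add: divide_nonpos_pos)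
          then show ?thesis using elim by (simp add: ennreal_neg)
        qed
        ultimately show "ennreal c \<le> hausdorff_outer (\<Gamma> \<inter> ball x r) / emeasure lborel (ball x r)" by simp
      qed
    qed
  qed
qed

section \<open>Regularity at small scales\<close>

definition sep :: real where "sep = sin \<tau> / (4 * pi * (\<Sum>i\<in>I. norm (\<xi> i)))"

lemma sum_norm_pos: "0 < (\<Sum>i\<in>I. norm (\<xi> i))"
  using fin ne nz by (intro sum_pos) auto

lemma sep_pos: "0 < sep"
  using sin_\<tau> sum_norm_pos by (simp add: sep_def)

text \<open>\<open>sep\<close> is made so that two points of a ball of that radius have phases
  differing by less than \<open>sin \<tau> / (2 * pi)\<close>. Such a step cannot take
  \<open>z j\<close> from 0 to absolute value \<open>sin \<tau>\<close>, so both points belong to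
  family j. The phases are then less than 1/3 apart, while different lines of the family have phases
  at least 1/2 apart.\<close>

lemma close_imp_collinear:
  assumes x: "x \<in> \<Gamma>" and y: "y \<in> G j" "j \<in> I" and d: "dist x y < 2 * sep"
  shows "(x - y) \<bullet> \<xi> j = 0"
proof -
  obtain i where i: "i \<in> I" "x \<in> G i" using x by (auto simp: \<Gamma>_def)
  have "norm (\<xi> j) \<le> (\<Sum>i\<in>I. norm (\<xi> i))"
    by (rule member_le_sum[OF y(2) _ fin]) simp
  have "\<bar>(x - y) \<bullet> \<xi> j\<bar> \<le> dist x y * norm (\<xi> j)"
    unfolding dist_norm by (rule Cauchy_Schwarz_ineq2)
  also have "\<dots> \<le> dist x y * (\<Sum>i\<in>I. norm (\<xi> i))"
    using \<open>norm (\<xi> j) \<le> _\<close> by (rule mult_left_mono) simp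
  also have "\<dots> < 2 * sep * (\<Sum>i\<in>I. norm (\<xi> i))"
    using d sum_norm_pos by simp
  also have "\<dots> = sin \<tau> / (2 * pi)" using sum_norm_pos by (simp add: sep_def)
  finally have *: "\<bar>(x - y) \<bullet> \<xi> j\<bar> < sin \<tau> / (2 * pi)" .
  have yj: "z j y = 0" using y by (simp add: G_def)
  have ij: "i = j"
  proof (rule ccontr)
    assume "i \<noteq> j"
    then have "sin \<tau> \<le> \<bar>z j x - z j y\<bar>" using i y yj by (auto simp: G_def)
    also have "\<dots> \<le> \<bar>2 * pi * (x \<bullet> \<xi> j) - 2 * pi * (y \<bullet> \<xi> j)\<bar>"
      unfolding z_def by (rule cos_lipschitz)
    also have "\<dots> = 2 * pi * \<bar>(x - y) \<bullet> \<xi> j\<bar>"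
      by (simp add: inner_diff_left right_diff_distrib[symmetric] abs_mult)
    also have "\<dots> < sin \<tau>" using * by (simp add: field_simps)
    finally show False by simp
  qed
  show ?thesis
  proof (rule ccontr)
    assume "(x - y) \<bullet> \<xi> j \<noteq> 0"
    then have "1/2 \<le> \<bar>x \<bullet> \<xi> j - y \<bullet> \<xi> j\<bar>"
      using i ij yj by (intro cos_eq_0_both_imp) (auto simp: G_def z_def inner_diff_left)
    also have "\<dots> < sin \<tau> / (2 * pi)" using * by (simp add: inner_diff_left)
    also have "\<dots> \<le> 1 / (2 * pi)" using sin_\<tau> by (simp add: divide_right_mono)
    also have "\<dots> \<le> 1/3" using pi_gt3 by (simp add: field_simps)
    finally show False by simp
  qed
qed

text \<open>Within such a ball all points of the set are on one line, and a chord has length at most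
  the diameter. This is where \<open>\<phi> 0 = 1\<close> comes from.\<close>

lemma small_ball_le:
  assumes r: "0 < r" "r \<le> sep"
  shows "hausdorff_outer (\<Gamma> \<inter> ball x r) \<le> ennreal (2 * r)"
proof (cases "\<Gamma> \<inter> ball x r = {}")
  case True
  then show ?thesis by (simp add: hausdorff_outer_empty)
next
  case False
  then obtain p j where p: "p \<in> G j" "j \<in> I" "p \<in> ball x r" by (auto simp: \<Gamma>_def)
  obtain a where a: "\<xi> j = norm (\<xi> j) *\<^sub>R dir a" using frame[OF p(2)] by metis
  define u v where "u = dir a" and "v = dir (a + pi / 2)"
  \<comment> \<open>The foot of the perpendicular from the centre to the line through
    \<open>p\<close>; measured from it, points of the ball have parameters between -r and r.\<close>
  define q where "q = x + ((p - x) \<bullet> u) *\<^sub>R u"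
  have "\<Gamma> \<inter> ball x r \<subseteq> (\<lambda>t. q + t *\<^sub>R v) ` {-r<..<r}"
  proof
    fix y assume y: "y \<in> \<Gamma> \<inter> ball x r"
    have "dist y p \<le> dist x y + dist x p" by (metis dist_triangle3 dist_commute)
    then have "dist y p < 2 * sep" using y p r by simp
    then have "(y - p) \<bullet> \<xi> j = 0" using close_imp_collinear[of y p j] y p by auto
    then have "(y - p) \<bullet> u = 0" using nz[OF p(2)] by (subst (asm) a) (simp add: u_def)
    then have yu: "(y - x) \<bullet> u = (p - x) \<bullet> u" by (simp add: inner_diff_left)
    have "y = x + (((y - x) \<bullet> u) *\<^sub>R u + ((y - x) \<bullet> v) *\<^sub>R v)"
      unfolding u_def v_def dir_decompose[symmetric] by simp
    then have "y = q + ((y - x) \<bullet> v) *\<^sub>R v" by (simp add: q_def yu add.assoc)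
    moreover have "\<bar>(y - x) \<bullet> v\<bar> \<le> norm (y - x) * norm v" by (rule Cauchy_Schwarz_ineq2)
    then have "\<bar>(y - x) \<bullet> v\<bar> < r" using y by (simp add: v_def dist_norm norm_minus_commute)
    then have "(y - x) \<bullet> v \<in> {-r<..<r}" by (simp add: abs_less_iff)
    ultimately show "y \<in> (\<lambda>t. q + t *\<^sub>R v) ` {-r<..<r}" by (rule image_eqI)
  qed
  then have "hausdorff_outer (\<Gamma> \<inter> ball x r) \<le> hausdorff_outer ((\<lambda>t. q + t *\<^sub>R v) ` {-r<..<r})"
    by (rule hausdorff_outer_mono)
  also have "\<dots> \<le> ennreal (2 * r)" by (rule hausdorff_outer_segment_le[OF _ r(1)]) (simp add: v_def)
  finally show ?thesis .
qed

text \<open>Translates of one finite cover by balls of radius \<open>sep\<close> serve all centres,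
  so the bound is uniform.\<close>

lemma unit_ball_le:
  obtains M where "0 \<le> M" "\<And>x. hausdorff_outer (\<Gamma> \<inter> ball x 1) \<le> ennreal M"
proof -
  have "cball (0::real^2) 1 \<subseteq> (\<Union>y\<in>cball 0 1. ball y sep)" using sep_pos by auto
  then obtain C where C: "C \<subseteq> cball (0::real^2) 1" "finite C" "cball (0::real^2) 1 \<subseteq> (\<Union>y\<in>C. ball y sep)"
    by (rule compactE_image[OF compact_cball, rotated]) simp_all
  have meas: "\<Gamma> \<inter> ball y r \<in> sets borel" for y r
    by (intro sets.Int borel_closed closed_\<Gamma> borel_open open_ball)
  have "hausdorff_outer (\<Gamma> \<inter> ball x 1) \<le> ennreal (real (card C) * (2 * sep))" for x
  proof -
    have "\<Gamma> \<inter> ball x 1 \<subseteq> (\<Union>y\<in>C. \<Gamma> \<inter> ball (x + y) sep)"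
    proof
      fix w assume w: "w \<in> \<Gamma> \<inter> ball x 1"
      then have "w - x \<in> cball 0 1" by (simp add: dist_norm norm_minus_commute)
      then obtain y where "y \<in> C" "w - x \<in> ball y sep" using C(3) by blast
      then show "w \<in> (\<Union>y\<in>C. \<Gamma> \<inter> ball (x + y) sep)"
        using w by (auto simp: dist_norm algebra_simps)
    qed
    then have "hausdorff_outer (\<Gamma> \<inter> ball x 1) \<le> emeasure hausdorff_measure (\<Union>y\<in>C. \<Gamma> \<inter> ball (x + y) sep)"
      by (subst emeasure_hausdorff_measure) (intro sets.finite_UN C meas, rule hausdorff_outer_mono)
    also have "\<dots> \<le> (\<Sum>y\<in>C. emeasure hausdorff_measure (\<Gamma> \<inter> ball (x + y) sep))"
      using C(2) meas by (intro emeasure_subadditive_finite) auto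
    also have "\<dots> \<le> (\<Sum>y\<in>C. ennreal (2 * sep))"
      using sep_pos small_ball_le by (intro sum_mono) (simp add: emeasure_hausdorff_measure[OF meas])
    also have "\<dots> = ennreal (real (card C) * (2 * sep))"
      using sep_pos by (subst ennreal_mult) (simp_all add: ennreal_of_nat_eq_real_of_nat)
    finally show ?thesis .
  qed
  then show ?thesis using sep_pos by (intro that[of "real (card C) * (2 * sep)"]) auto
qed

text \<open>Continuity is demanded only at 0, so \<open>\<phi>\<close> may jump at
  \<open>sep\<close> from 1 to a constant large enough to absorb the bound for unit balls.\<close>

lemma regular_\<Gamma>:
  obtains \<phi> where "gauge_function \<phi>" "\<phi> 0 = 1" "regular_set \<phi> \<Gamma>"
proof -
  obtain M where M: "0 \<le> M" "\<And>x. hausdorff_outer (\<Gamma> \<inter> ball x 1) \<le> ennreal M"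
    using unit_ball_le by metis
  define \<phi> where "\<phi> r = (if r < sep then 1 else M / (2 * sep))" for r
  have "continuous (at 0 within {0..<1}) \<phi>"
  proof -
    have "\<forall>\<^sub>F r in nhds (0::real). r < sep" using sep_pos by (rule order_tendstoD(2)[OF filterlim_ident])
    then have "\<forall>\<^sub>F r in nhds 0. \<phi> r = 1" by eventually_elim (simp add: \<phi>_def)
    then have "isCont \<phi> 0"
      using isCont_cong[of \<phi> "\<lambda>_. 1" 0] by simp
    then show ?thesis by (simp add: continuous_at_imp_continuous_within)
  qed
  then have "gauge_function \<phi>" using M sep_pos by (simp add: gauge_function_def \<phi>_def)
  moreover have "regular_set \<phi> \<Gamma>"
    unfolding regular_set_def regular_measure_def
  proof (intro conjI allI ballI closed_\<Gamma>)
    fix x :: "real^2" and r :: real assume r: "r \<in> {0<..<1}"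
    have "emeasure (density hausdorff_measure (indicator \<Gamma>)) (ball x r) = emeasure hausdorff_measure (\<Gamma> \<inter> ball x r)"
      by (rule emeasure_restricted) (simp_all add: borel_closed closed_\<Gamma>)
    also have "\<dots> = hausdorff_outer (\<Gamma> \<inter> ball x r)"
      by (intro emeasure_hausdorff_measure sets.Int borel_closed closed_\<Gamma> borel_open open_ball)
    also have "\<dots> \<le> ennreal (2 * \<phi> r * r)"
    proof (cases "r < sep")
      case True
      then show ?thesis using small_ball_le[of r x] r by (simp add: \<phi>_def)
    next
      case False
      have "hausdorff_outer (\<Gamma> \<inter> ball x r) \<le> hausdorff_outer (\<Gamma> \<inter> ball x 1)"
        using r by (intro hausdorff_outer_mono) auto
      also have "\<dots> \<le> ennreal M" by (rule M)
      also have "\<dots> \<le> ennreal (2 * \<phi> r * r)"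
      proof (rule ennreal_leI)
        have "M * sep \<le> M * r" using False M by (intro mult_left_mono) auto
        then show "M \<le> 2 * \<phi> r * r" using sep_pos False by (simp add: \<phi>_def field_simps)
      qed
      finally show ?thesis .
    qed
    finally show "emeasure (density hausdorff_measure (indicator \<Gamma>)) (ball x r) \<le> ennreal (2 * \<phi> r * r)" .
  qed
  moreover have "\<phi> 0 = 1" using sep_pos by (simp add: \<phi>_def)
  ultimately show ?thesis by (intro that)
qed

end

section \<open>Fourier inversion for test functions\<close>

abbreviation wave :: "real^2 \<Rightarrow> real^2 \<Rightarrow> complex" where
  "wave x \<xi> \<equiv> exp (2 * pi * \<i> * of_real (x \<bullet> \<xi>))"

lemma norm_wave [simp]: "norm (wave x \<xi>) = 1"
  by (simp add: norm_exp_eq_Re)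

lemma wave_measurable [measurable]:
  assumes [measurable]: "f \<in> borel_measurable M" "g \<in> borel_measurable M"
  shows "(\<lambda>x. wave (f x) (g x)) \<in> borel_measurable M"
proof -
  have "(\<lambda>z::complex. exp z) \<in> borel_measurable borel"
    by (intro borel_measurable_continuous_onI continuous_intros)
  then show ?thesis by measurable
qed

text \<open>Lebesgue measure is the image of a product of one-dimensional ones, so integrals of
  products over the coordinates factor. This serves both the Gaussian and the integrable majorant of
  a transform.\<close>

lemma lborel_prod_function:
  fixes g :: "'a::euclidean_space \<Rightarrow> real \<Rightarrow> 'b::{real_normed_field,banach,second_countable_topology}"
  assumes g: "\<And>b. b \<in> Basis \<Longrightarrow> integrable lborel (g b)"
  shows "integrable lborel (\<lambda>x. \<Prod>b\<in>Basis. g b (x \<bullet> b))" (is ?I)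
    and "(LINT x|lborel. (\<Prod>b\<in>Basis. g b (x \<bullet> b))) = (\<Prod>b\<in>Basis. LINT t|lborel. g b t)" (is ?E)
proof -
  interpret product_sigma_finite "\<lambda>_::'a. lborel :: real measure" ..
  let ?P = "\<Pi>\<^sub>M b\<in>(Basis :: 'a set). (lborel :: real measure)"
  let ?e = "\<lambda>f. \<Sum>b\<in>(Basis :: 'a set). f b *\<^sub>R b"
  have [measurable]: "g b \<in> borel_measurable borel" if "b \<in> Basis" for b
    using g[OF that] by (simp add: borel_measurable_integrable)
  have e [measurable]: "?e \<in> borel_measurable ?P" by measurable
  have F: "(\<lambda>x. \<Prod>b\<in>Basis. g b (x \<bullet> b)) \<in> borel_measurable borel" by measurable
  have eq: "(\<Prod>b\<in>Basis. g b (?e f \<bullet> b)) = (\<Prod>b\<in>Basis. g b (f b))" for f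
    by (intro prod.cong refl) (simp add: inner_sum_left inner_Basis if_distrib sum.delta cong: if_cong)
  show ?I
    unfolding lborel_eq[where 'a = 'a]
    by (subst integrable_distr_eq[OF e F]) (unfold eq, intro product_integrable_prod g finite_Basis)
  have "(LINT x|lborel. (\<Prod>b\<in>Basis. g b (x \<bullet> b))) = (LINT f|?P. (\<Prod>b\<in>Basis. g b (f b)))"
    by (subst lborel_eq, subst integral_distr[OF e F]) (unfold eq, rule refl)
  also have "\<dots> = (\<Prod>b\<in>Basis. LINT t|lborel. g b t)"
    by (rule product_integral_prod) (auto intro: g)
  finally show ?E .
qed

text \<open>Scaling by \<open>c\<close> reduces the claim to the characteristic function of the
  standard normal distribution.\<close>

lemma gauss_fourier_real:
  assumes c: "0 < c"
  shows "integrable lborel (\<lambda>t::real. of_real (exp (- t\<^sup>2 / (2 * c\<^sup>2))) * exp (2 * pi * \<i> * of_real (t * y)))" (is "integrable _ ?f")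
    and "(LINT t|lborel. of_real (exp (- t\<^sup>2 / (2 * c\<^sup>2))) * exp (2 * pi * \<i> * of_real (t * y)) :: complex) =
      of_real (c * sqrt (2 * pi) * exp (- 2 * pi\<^sup>2 * c\<^sup>2 * y\<^sup>2))"
proof -
  define s where "s = 2 * pi * c * y"
  let ?g = "\<lambda>t. std_normal_density t *\<^sub>R exp (\<i> * complex_of_real (s * t))"
  have m: "(\<lambda>t. exp (\<i> * complex_of_real (s * t))) \<in> borel_measurable lborel"
  proof -
    have "(\<lambda>t. exp (\<i> * complex_of_real (s * t))) \<in> borel_measurable borel"
      by (intro borel_measurable_continuous_onI continuous_intros)
    then show ?thesis by simp
  qed
  have int: "integrable lborel ?g"
  proof (rule Bochner_Integration.integrable_bound)
    show "integrable lborel std_normal_density" by (rule integrable_normal_density) simp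
    show "?g \<in> borel_measurable lborel" using m by (intro borel_measurable_scaleR) simp_all
  qed auto
  have val: "(LINT t|lborel. ?g t) = of_real (exp (- s\<^sup>2 / 2))"
  proof -
    have "(LINT t|lborel. ?g t) = char std_normal_distribution s"
      unfolding char_def by (subst integral_density) (use m in auto)
    then show ?thesis by (simp add: char_std_normal_distribution)
  qed
  have scale: "?f (0 + c * t) = of_real (sqrt (2 * pi)) * ?g t" for t
  proof -
    have 1: "- (c * t)\<^sup>2 / (2 * c\<^sup>2) = - t\<^sup>2 / 2" using c by (simp add: field_simps)
    have 2: "2 * pi * \<i> * of_real (c * t * y) = \<i> * of_real (s * t)" by (simp add: s_def)
    show ?thesis
      unfolding add_0 1 2 by (simp add: std_normal_density_def scaleR_conv_of_real)
  qed
  have "integrable lborel (\<lambda>t. ?f (0 + c * t))" unfolding scale by (intro integrable_mult_right int)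
  then show "integrable lborel ?f" using c by (subst (asm) lborel_integrable_real_affine_iff) auto
  have "(LINT t|lborel. ?f t) = c *\<^sub>R (LINT t|lborel. ?f (0 + c * t))"
    using lborel_integral_real_affine[of c ?f 0] c by simp
  also have "\<dots> = of_real (c * sqrt (2 * pi) * exp (- s\<^sup>2 / 2))"
    unfolding scale integral_mult_right_zero val by (simp add: scaleR_conv_of_real)
  also have "- s\<^sup>2 / 2 = - 2 * pi\<^sup>2 * c\<^sup>2 * y\<^sup>2" by (simp add: s_def power_mult_distrib)
  finally show "(LINT t|lborel. ?f t) = of_real (c * sqrt (2 * pi) * exp (- 2 * pi\<^sup>2 * c\<^sup>2 * y\<^sup>2))" .
qed

definition gauss :: "real \<Rightarrow> real^2 \<Rightarrow> real" where
  "gauss c x = exp (- (norm x)\<^sup>2 / (2 * c\<^sup>2))"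

lemma gauss_nonneg [simp]: "0 \<le> gauss c x"
  by (simp add: gauss_def)

lemma norm_sq_Basis: "(norm (x::'a::euclidean_space))\<^sup>2 = (\<Sum>b\<in>Basis. (x \<bullet> b)\<^sup>2)"
  unfolding power2_norm_eq_inner by (subst euclidean_inner) (simp add: power2_eq_square)

lemma gauss_fourier:
  assumes c: "0 < c"
  shows "integrable lborel (\<lambda>x. of_real (gauss c x) * wave x y)"
    and "(LINT x|lborel. of_real (gauss c x) * wave x y) = of_real (2 * pi * c\<^sup>2 * exp (- 2 * pi\<^sup>2 * c\<^sup>2 * (norm y)\<^sup>2))"
proof -
  let ?g = "\<lambda>b t. complex_of_real (exp (- t\<^sup>2 / (2 * c\<^sup>2))) * exp (2 * pi * \<i> * of_real (t * (y \<bullet> b)))"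
  have eq: "of_real (gauss c x) * wave x y = (\<Prod>b\<in>Basis. ?g b (x \<bullet> b))" for x
  proof -
    have "gauss c x = (\<Prod>b\<in>Basis. exp (- (x \<bullet> b)\<^sup>2 / (2 * c\<^sup>2)))"
      unfolding gauss_def norm_sq_Basis by (simp add: exp_sum[symmetric] sum_negf sum_divide_distrib)
    moreover have "wave x y = (\<Prod>b\<in>Basis. exp (2 * pi * \<i> * of_real ((x \<bullet> b) * (y \<bullet> b))))"
      by (subst euclidean_inner) (simp add: exp_sum[symmetric] sum_distrib_left)
    ultimately show ?thesis by (simp add: prod.distrib)
  qed
  show "integrable lborel (\<lambda>x. of_real (gauss c x) * wave x y)"
    unfolding eq by (intro lborel_prod_function gauss_fourier_real c)
  have "(LINT x|lborel. of_real (gauss c x) * wave x y) =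
      (\<Prod>b\<in>Basis. of_real (c * sqrt (2 * pi) * exp (- 2 * pi\<^sup>2 * c\<^sup>2 * (y \<bullet> b)\<^sup>2)))"
    unfolding eq by (subst lborel_prod_function) (intro gauss_fourier_real c, simp only: gauss_fourier_real(2)[OF c])
  also have "\<dots> = of_real (\<Prod>b\<in>Basis. (c * sqrt (2 * pi)) * exp (- 2 * pi\<^sup>2 * c\<^sup>2 * (y \<bullet> b)\<^sup>2))"
    by simp
  also have "(\<Prod>b\<in>(Basis::(real^2) set). (c * sqrt (2 * pi)) * exp (- 2 * pi\<^sup>2 * c\<^sup>2 * (y \<bullet> b)\<^sup>2)) =
      (c * sqrt (2 * pi)) ^ 2 * exp (- 2 * pi\<^sup>2 * c\<^sup>2 * (norm y)\<^sup>2)"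
    unfolding norm_sq_Basis prod.distrib
    by (simp add: exp_sum[symmetric] sum_distrib_left sum_negf power_mult_distrib)
  also have "(c * sqrt (2 * pi)) ^ 2 = 2 * pi * c\<^sup>2" by (simp add: power_mult_distrib)
  finally show "(LINT x|lborel. of_real (gauss c x) * wave x y) = of_real (2 * pi * c\<^sup>2 * exp (- 2 * pi\<^sup>2 * c\<^sup>2 * (norm y)\<^sup>2))" .
qed

lemma norm_fourier_le: "norm (fourier \<psi> \<xi>) \<le> (LINT x|lborel. norm (\<psi> x))"
  unfolding fourier_def
  by (rule order_trans[OF integral_norm_bound]) (simp add: norm_mult)

lemma fourier_measurable:
  assumes [measurable]: "\<psi> \<in> borel_measurable borel"
  shows "fourier \<psi> \<in> borel_measurable borel"
proof -
  have "(\<lambda>\<xi>. LINT x|lborel. \<psi> x * wave x \<xi>) \<in> borel_measurable lborel"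
    by (rule lborel.borel_measurable_lebesgue_integral) (simp add: split_beta', measurable)
  then show ?thesis by (simp add: fourier_def[abs_def])
qed

text \<open>Fourier inversion at a point \<open>-p\<close> near which \<open>\<psi>\<close> vanishes, by Gaussian regularisation.\<close>

lemma integral_fourier_eq_0:
  assumes \<psi>: "integrable lborel \<psi>" and F: "integrable lborel (fourier \<psi>)"
    and \<rho>: "0 < \<rho>" and zero: "\<And>y. norm (y + p) < \<rho> \<Longrightarrow> \<psi> y = 0"
  shows "(LINT x|lborel. fourier \<psi> x * wave x p) = 0"
proof -
  have \<psi>m [measurable]: "\<psi> \<in> borel_measurable borel" using borel_measurable_integrable[OF \<psi>] by simp
  have Fm [measurable]: "fourier \<psi> \<in> borel_measurable borel" by (rule fourier_measurable[OF \<psi>m])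
  have gm [measurable]: "gauss c \<in> borel_measurable borel" for c
    unfolding gauss_def by measurable
  \<comment> \<open>The Gaussian factors increase to 1, so dominated convergence identifies the
    limit of \<open>L\<close> with the integral in question. A second evaluation of
    \<open>L n\<close> shows that the limit is 0.\<close>
  define L where "L n = (LINT x|lborel. of_real (gauss (real (Suc n)) x) * (fourier \<psi> x * wave x p))" for n
  have "L \<longlonglongrightarrow> (LINT x|lborel. fourier \<psi> x * wave x p)"
    unfolding L_def
  proof (rule integral_dominated_convergence[where w = "\<lambda>x. norm (fourier \<psi> x)"])
    show "AE x in lborel. (\<lambda>n. of_real (gauss (real (Suc n)) x) * (fourier \<psi> x * wave x p)) \<longlonglongrightarrow> fourier \<psi> x * wave x p"
    proof (rule AE_I2)
      fix x :: "real^2"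
      have "(\<lambda>n. exp (- (norm x)\<^sup>2 / 2 * (inverse (real (Suc n)))\<^sup>2)) \<longlonglongrightarrow> exp (- (norm x)\<^sup>2 / 2 * 0\<^sup>2)"
        by (intro tendsto_intros LIMSEQ_inverse_real_of_nat)
      also have "(\<lambda>n. exp (- (norm x)\<^sup>2 / 2 * (inverse (real (Suc n)))\<^sup>2)) = (\<lambda>n. gauss (real (Suc n)) x)"
        unfolding gauss_def by (simp add: field_simps del: of_nat_Suc)
      finally have "(\<lambda>n. gauss (real (Suc n)) x) \<longlonglongrightarrow> 1" by simp
      then have "(\<lambda>n. of_real (gauss (real (Suc n)) x) * (fourier \<psi> x * wave x p)) \<longlonglongrightarrow> of_real 1 * (fourier \<psi> x * wave x p)"
        by (intro tendsto_mult tendsto_of_real tendsto_const)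
      then show "(\<lambda>n. of_real (gauss (real (Suc n)) x) * (fourier \<psi> x * wave x p)) \<longlonglongrightarrow> fourier \<psi> x * wave x p"
        by simp
    qed
    show "AE x in lborel. norm (of_real (gauss (real (Suc n)) x) * (fourier \<psi> x * wave x p)) \<le> norm (fourier \<psi> x)" for n
      by (rule AE_I2) (simp add: norm_mult gauss_def mult_left_le_one_le)
    show "integrable lborel (\<lambda>x. norm (fourier \<psi> x))" using F by (rule integrable_norm)
  qed measurable
  \<comment> \<open>Fubini moves the transform from \<open>\<psi>\<close> to the Gaussian. The
    resulting kernel is peaked at \<open>-p\<close>; at distance at least \<open>\<rho>\<close> from
    there, the only place where \<open>\<psi>\<close> can be nonzero, it is exponentially
    small.\<close>
  moreover have le: "norm (L n) \<le> (2 * pi * (real (Suc n))\<^sup>2 * exp (- 2 * pi\<^sup>2 * (real (Suc n))\<^sup>2 * \<rho>\<^sup>2)) * (LINT y|lborel. norm (\<psi> y))" for n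
  proof -
    define c where "c = real (Suc n)"
    have c: "0 < c" by (simp add: c_def)
    have gi: "integrable lborel (gauss c)"
      using gauss_fourier(1)[OF c, of 0] by (simp add: complex_of_real_integrable_eq)
    define H where "H y x = of_real (gauss c x) * (\<psi> y * wave y x * wave x p)" for x y
    have int: "integrable (lborel \<Otimes>\<^sub>M lborel) (case_prod H)"
    proof (rule lborel_pair.Fubini_integrable)
      show "case_prod H \<in> borel_measurable (lborel \<Otimes>\<^sub>M lborel)"
        unfolding H_def split_beta' by measurable
      have "integrable lborel (\<lambda>y. norm (\<psi> y) * (LINT x|lborel. gauss c x))"
        using \<psi> by simp
      then show "integrable lborel (\<lambda>y. LINT x|lborel. norm (case (y, x) of (y, x) \<Rightarrow> H y x))"
        by (simp add: H_def norm_mult mult.commute)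
      have "integrable lborel (\<lambda>x. H y x)" for y
        by (rule Bochner_Integration.integrable_bound[of _ "\<lambda>x. norm (\<psi> y) * gauss c x"])
          (use gi in \<open>auto simp: H_def norm_mult\<close>)
      then show "AE y in lborel. integrable lborel (\<lambda>x. case (y, x) of (y, x) \<Rightarrow> H y x)" by simp
    qed
    have "L n = (LINT x|lborel. LINT y|lborel. H y x)"
      unfolding L_def H_def fourier_def c_def[symmetric] by simp
    also have "\<dots> = (LINT y|lborel. LINT x|lborel. H y x)"
      by (rule lborel_pair.Fubini_integral[OF int])
    also have "\<dots> = (LINT y|lborel. \<psi> y * of_real (2 * pi * c\<^sup>2 * exp (- 2 * pi\<^sup>2 * c\<^sup>2 * (norm (y + p))\<^sup>2)))"
    proof (rule Bochner_Integration.integral_cong[OF refl])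
      fix y
      have "H y x = \<psi> y * (of_real (gauss c x) * wave x (y + p))" for x
        by (simp add: H_def inner_add_right inner_commute[of y x] distrib_left exp_add)
      then show "(LINT x|lborel. H y x) = \<psi> y * of_real (2 * pi * c\<^sup>2 * exp (- 2 * pi\<^sup>2 * c\<^sup>2 * (norm (y + p))\<^sup>2))"
        using gauss_fourier[OF c, of "y + p"] by simp
    qed
    finally have Ln: "L n = (LINT y|lborel. \<psi> y * of_real (2 * pi * c\<^sup>2 * exp (- 2 * pi\<^sup>2 * c\<^sup>2 * (norm (y + p))\<^sup>2)))" .
    have "norm (L n) \<le> (LINT y|lborel. (2 * pi * c\<^sup>2 * exp (- 2 * pi\<^sup>2 * c\<^sup>2 * \<rho>\<^sup>2)) * norm (\<psi> y))"
      unfolding Ln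
    proof (rule Bochner_Integration.integral_norm_bound_integral)
      fix y
      show "norm (\<psi> y * of_real (2 * pi * c\<^sup>2 * exp (- 2 * pi\<^sup>2 * c\<^sup>2 * (norm (y + p))\<^sup>2))) \<le>
          (2 * pi * c\<^sup>2 * exp (- 2 * pi\<^sup>2 * c\<^sup>2 * \<rho>\<^sup>2)) * norm (\<psi> y)"
      proof (cases "norm (y + p) < \<rho>")
        case True
        then show ?thesis using zero by simp
      next
        case False
        then have "\<rho>\<^sup>2 \<le> (norm (y + p))\<^sup>2" using \<rho> by (intro power_mono) auto
        then have "2 * pi\<^sup>2 * c\<^sup>2 * \<rho>\<^sup>2 \<le> 2 * pi\<^sup>2 * c\<^sup>2 * (norm (y + p))\<^sup>2" by (intro mult_left_mono) auto
        then have "2 * pi * c\<^sup>2 * exp (- 2 * pi\<^sup>2 * c\<^sup>2 * (norm (y + p))\<^sup>2) \<le> 2 * pi * c\<^sup>2 * exp (- 2 * pi\<^sup>2 * c\<^sup>2 * \<rho>\<^sup>2)"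
          by (intro mult_left_mono) auto
        then have "norm (\<psi> y) * (2 * pi * c\<^sup>2 * exp (- 2 * pi\<^sup>2 * c\<^sup>2 * (norm (y + p))\<^sup>2)) \<le>
            norm (\<psi> y) * (2 * pi * c\<^sup>2 * exp (- 2 * pi\<^sup>2 * c\<^sup>2 * \<rho>\<^sup>2))" by (rule mult_left_mono) simp
        moreover have "\<bar>2 * pi * c\<^sup>2 * exp (- 2 * pi\<^sup>2 * c\<^sup>2 * (norm (y + p))\<^sup>2)\<bar> =
            2 * pi * c\<^sup>2 * exp (- 2 * pi\<^sup>2 * c\<^sup>2 * (norm (y + p))\<^sup>2)"
          by (intro abs_of_nonneg) simp
        ultimately show ?thesis unfolding norm_mult norm_of_real by (simp only: mult.commute)
      qed
    next
      show "integrable lborel (\<lambda>y. \<psi> y * of_real (2 * pi * c\<^sup>2 * exp (- 2 * pi\<^sup>2 * c\<^sup>2 * (norm (y + p))\<^sup>2)))"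
      proof (rule Bochner_Integration.integrable_bound[of _ "\<lambda>y. (2 * pi * c\<^sup>2) * norm (\<psi> y)"])
        show "AE y in lborel. norm (\<psi> y * of_real (2 * pi * c\<^sup>2 * exp (- 2 * pi\<^sup>2 * c\<^sup>2 * (norm (y + p))\<^sup>2)))
            \<le> norm ((2 * pi * c\<^sup>2) * norm (\<psi> y))"
        proof (rule AE_I2)
          fix y
          let ?X = "2 * pi * c\<^sup>2 * exp (- 2 * pi\<^sup>2 * c\<^sup>2 * (norm (y + p))\<^sup>2)"
          have "\<bar>?X\<bar> \<le> 2 * pi * c\<^sup>2" by (simp add: abs_mult mult_left_le)
          then have "norm (\<psi> y) * \<bar>?X\<bar> \<le> norm (\<psi> y) * (2 * pi * c\<^sup>2)" by (rule mult_left_mono) simp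
          also have "\<dots> = norm ((2 * pi * c\<^sup>2) * norm (\<psi> y))" by (simp add: abs_mult)
          finally show "norm (\<psi> y * of_real ?X) \<le> norm ((2 * pi * c\<^sup>2) * norm (\<psi> y))"
            unfolding norm_mult norm_of_real .
        qed
      qed (use \<psi> in auto)
    qed (use \<psi> in simp)
    then show ?thesis unfolding c_def[symmetric] by simp
  qed
  moreover have lim: "(\<lambda>n. (2 * pi * (real (Suc n))\<^sup>2 * exp (- 2 * pi\<^sup>2 * (real (Suc n))\<^sup>2 * \<rho>\<^sup>2)) * (LINT y|lborel. norm (\<psi> y))) \<longlonglongrightarrow> 0"
  proof -
    define k where "k = 2 * pi\<^sup>2 * \<rho>\<^sup>2"
    have k: "0 < k" using \<rho> by (simp add: k_def)
    have "((\<lambda>u::real. u ^ 1 / exp u) \<longlongrightarrow> 0) at_top" by (rule tendsto_power_div_exp_0)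
    moreover have "filterlim (\<lambda>n. k * (real (Suc n))\<^sup>2) at_top sequentially"
      by (intro filterlim_tendsto_pos_mult_at_top[OF tendsto_const k] filterlim_pow_at_top
          filterlim_compose[OF filterlim_real_sequentially filterlim_Suc]) simp
    ultimately have "(\<lambda>n. (k * (real (Suc n))\<^sup>2) ^ 1 / exp (k * (real (Suc n))\<^sup>2)) \<longlonglongrightarrow> 0"
      by (rule filterlim_compose)
    then have "(\<lambda>n. (2 * pi / k) * ((k * (real (Suc n))\<^sup>2) ^ 1 / exp (k * (real (Suc n))\<^sup>2)) * (LINT y|lborel. norm (\<psi> y))) \<longlonglongrightarrow>
        (2 * pi / k) * 0 * (LINT y|lborel. norm (\<psi> y))"
      by (intro tendsto_intros)
    moreover have eq: "(2 * pi / k) * ((k * t) ^ 1 / exp (k * t)) = 2 * pi * t * exp (- 2 * pi\<^sup>2 * t * \<rho>\<^sup>2)" for t :: real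
    proof -
      have "exp (- 2 * pi\<^sup>2 * t * \<rho>\<^sup>2) = inverse (exp (k * t))" by (simp add: k_def exp_minus[symmetric] mult_ac)
      then show ?thesis using k by (simp add: field_simps)
    qed
    ultimately show ?thesis unfolding eq by (simp only: mult_zero_right mult_zero_left)
  qed
  moreover have "L \<longlonglongrightarrow> 0"
    by (rule Lim_null_comparison[OF always_eventually lim]) (use le in blast)
  ultimately show ?thesis using LIMSEQ_unique by blast
qed

text \<open>The partial derivative is obtained by differentiating the translates of \<open>g\<close> under the integral.\<close>

lemma fourier_partial:
  fixes g :: "real^2 \<Rightarrow> complex" and i :: 2
  defines "g' \<equiv> \<lambda>x. frechet_derivative g (at x) (axis i 1)"
  assumes diff: "\<And>x. g differentiable (at x)" and cont: "continuous_on UNIV g'"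
    and S: "compact S" and g0: "\<And>x. x \<notin> S \<Longrightarrow> g x = 0" and g'0: "\<And>x. x \<notin> S \<Longrightarrow> g' x = 0"
  shows "fourier g' \<xi> = - (2 * pi * \<i> * of_real (\<xi> $ i)) * fourier g \<xi>"
proof -
  let ?e = "axis i 1 :: real^2"
  have ne: "norm ?e = 1" by simp
  have cg: "continuous_on UNIV g"
    using diff by (intro continuous_at_imp_continuous_on ballI differentiable_imp_continuous_within) auto
  have gm [measurable]: "g \<in> borel_measurable borel" "g' \<in> borel_measurable borel"
    using cg cont by (auto intro: borel_measurable_continuous_onI)
  obtain R where R: "\<And>x. x \<in> S \<Longrightarrow> norm x \<le> R"
    using compact_imp_bounded[OF S] unfolding bounded_iff by blast
  obtain C where C: "\<And>x. x \<in> S \<Longrightarrow> norm (g' x) \<le> C"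
    using compact_imp_bounded[OF compact_continuous_image[OF continuous_on_subset[OF cont] S]]
    unfolding bounded_iff by auto
  \<comment> \<open>\<open>C\<close> may be negative if \<open>S\<close> is empty.\<close>
  define C1 where "C1 = max C 0"
  have C1: "norm (g' x) \<le> C1" "0 \<le> C1" for x
    using C[of x] g'0[of x] by (cases "x \<in> S"; auto simp: C1_def)+
  have der: "(g has_derivative frechet_derivative g (at x)) (at x)" for x
    using diff frechet_derivative_works by blast
  have lin: "frechet_derivative g (at x) (h *\<^sub>R ?e) = h *\<^sub>R g' x" for x h
    unfolding g'_def by (rule linear_scale[OF has_derivative_linear[OF der]])
  have lip: "norm (g (x + t *\<^sub>R ?e) - g x) \<le> C1 * t" if t: "0 < t" for x t
  proof -
    have d: "((\<lambda>s. g (x + s *\<^sub>R ?e)) has_derivative (\<lambda>h. h *\<^sub>R g' (x + s *\<^sub>R ?e))) (at s)" for s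
    proof -
      have "((\<lambda>s. x + s *\<^sub>R ?e) has_derivative (\<lambda>h. h *\<^sub>R ?e)) (at s)"
        by (auto intro!: derivative_eq_intros)
      from has_derivative_compose[OF this der] show ?thesis by (simp add: lin)
    qed
    have "continuous_on {0..t} (\<lambda>s. g (x + s *\<^sub>R ?e))"
      by (intro continuous_at_imp_continuous_on ballI has_derivative_continuous[OF d])
    from mvt_general[OF t this d] obtain s where
      "norm (g (x + t *\<^sub>R ?e) - g (x + 0 *\<^sub>R ?e)) \<le> norm ((t - 0) *\<^sub>R g' (x + s *\<^sub>R ?e))" by blast
    also have "\<dots> \<le> C1 * t" using C1(1)[of "x + s *\<^sub>R ?e"] t by (simp add: mult.commute mult_left_mono)
    finally show ?thesis by simp
  qed
  define t where "t n = inverse (real (Suc n))" for n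
  have t: "0 < t n" "t n \<le> 1" for n by (simp_all add: t_def divide_simps)
  have t0: "t \<longlonglongrightarrow> 0" unfolding t_def by (rule LIMSEQ_inverse_real_of_nat)
  have gi: "integrable lborel g"
  proof -
    have "integrable lborel (\<lambda>x. indicator S x *\<^sub>R g x)"
      using borel_integrable_compact[OF S continuous_on_subset[OF cg]] by simp
    moreover have "(\<lambda>x. indicator S x *\<^sub>R g x) = g" using g0 by (auto simp: fun_eq_iff indicator_def)
    ultimately show ?thesis by simp
  qed
  define Q where "Q n x = (g (x + t n *\<^sub>R ?e) - g x) /\<^sub>R t n" for n x
  \<comment> \<open>All steps \<open>t n\<close> are at most 1, so every difference quotient
    vanishes outside the ball of radius R + 1; inside, the mean value theorem bounds it by
    \<open>C1\<close>.\<close>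
  have "(\<lambda>n. LINT x|lborel. Q n x * wave x \<xi>) \<longlonglongrightarrow> (LINT x|lborel. g' x * wave x \<xi>)"
  proof (rule integral_dominated_convergence[where w = "\<lambda>x. indicator (cball 0 (R + 1)) x *\<^sub>R C1"])
    show "integrable lborel (\<lambda>x::real^2. indicator (cball 0 (R + 1)) x *\<^sub>R C1)"
      by (rule borel_integrable_compact) auto
    show "AE x in lborel. norm (Q n x * wave x \<xi>) \<le> indicator (cball 0 (R + 1)) x *\<^sub>R C1" for n
    proof (rule AE_I2)
      fix x :: "real^2"
      show "norm (Q n x * wave x \<xi>) \<le> indicator (cball 0 (R + 1)) x *\<^sub>R C1"
      proof (cases "norm x \<le> R + 1")
        case True
        have "norm (Q n x * wave x \<xi>) = norm (g (x + t n *\<^sub>R ?e) - g x) / t n"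
          using t(1)[of n] by (simp add: Q_def norm_mult divide_inverse mult.commute)
        also have "\<dots> \<le> C1" using lip[OF t(1), of x n] t(1)[of n] by (simp add: divide_le_eq)
        finally show ?thesis using True by simp
      next
        case False
        then have "x \<notin> S" using R[of x] by auto
        moreover have "x + t n *\<^sub>R ?e \<notin> S"
        proof
          assume "x + t n *\<^sub>R ?e \<in> S"
          then have "norm (x + t n *\<^sub>R ?e) \<le> R" by (rule R)
          moreover have "norm x \<le> norm (x + t n *\<^sub>R ?e) + norm (t n *\<^sub>R ?e)"
            using norm_triangle_ineq4[of "x + t n *\<^sub>R ?e" "t n *\<^sub>R ?e"] by simp
          ultimately show False using False t[of n] ne by simp
        qed
        ultimately show ?thesis using g0 by (simp add: Q_def C1)
      qed
    qed
    show "AE x in lborel. (\<lambda>n. Q n x * wave x \<xi>) \<longlonglongrightarrow> g' x * wave x \<xi>"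
    proof (rule AE_I2)
      fix x
      have "(\<lambda>h. norm (g (x + h) - g x - frechet_derivative g (at x) h) / norm h) \<midarrow>0\<rightarrow> 0"
        using der[of x] unfolding has_derivative_at by blast
      moreover have "filterlim (\<lambda>n. t n *\<^sub>R ?e) (at 0) sequentially"
      proof (rule filterlim_atI)
        have "(\<lambda>n. t n *\<^sub>R ?e) \<longlonglongrightarrow> 0 *\<^sub>R ?e" by (intro tendsto_scaleR t0 tendsto_const)
        then show "(\<lambda>n. t n *\<^sub>R ?e) \<longlonglongrightarrow> 0" by simp
        show "\<forall>\<^sub>F n in sequentially. t n *\<^sub>R ?e \<noteq> 0"
          using t ne by (intro always_eventually allI) (auto simp: less_imp_neq[symmetric] axis_eq_0_iff)
      qed
      ultimately have "(\<lambda>n. norm (g (x + t n *\<^sub>R ?e) - g x - frechet_derivative g (at x) (t n *\<^sub>R ?e)) / norm (t n *\<^sub>R ?e)) \<longlonglongrightarrow> 0"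
        by (rule filterlim_compose)
      moreover have "norm (g (x + t n *\<^sub>R ?e) - g x - frechet_derivative g (at x) (t n *\<^sub>R ?e)) / norm (t n *\<^sub>R ?e) = norm (Q n x - g' x)" for n
      proof -
        have "g (x + t n *\<^sub>R ?e) - g x - t n *\<^sub>R g' x = t n *\<^sub>R (Q n x - g' x)"
          using t(1)[of n] by (simp add: Q_def scaleR_diff_right)
        then show ?thesis using t(1)[of n] ne by (simp add: lin)
      qed
      ultimately have "(\<lambda>n. Q n x) \<longlonglongrightarrow> g' x"
        by (simp add: tendsto_norm_zero_iff LIM_zero_iff)
      then show "(\<lambda>n. Q n x * wave x \<xi>) \<longlonglongrightarrow> g' x * wave x \<xi>" by (intro tendsto_mult tendsto_const)
    qed
  qed (simp_all add: Q_def)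
  \<comment> \<open>Translation invariance turns the shift of \<open>g\<close> into a phase factor,
    so the transform of the quotient is a scalar multiple of that of \<open>g\<close>. The scalar is
    itself a difference quotient of the exponential at 0.\<close>
  moreover have "(LINT x|lborel. Q n x * wave x \<xi>) = (exp (- (2 * pi * \<i> * of_real (\<xi> $ i)) * of_real (t n)) - 1) / of_real (t n) * fourier g \<xi>" for n
  proof -
    let ?w = "exp (- (2 * pi * \<i> * of_real (\<xi> $ i)) * of_real (t n))"
    let ?F = "\<lambda>y. ?w * (g y * wave y \<xi>)"
    have int: "integrable lborel (\<lambda>y. g y * wave y \<xi>)"
      by (rule Bochner_Integration.integrable_bound[OF gi]) (auto simp: norm_mult)
    have sh: "g (x + t n *\<^sub>R ?e) * wave x \<xi> = ?F (t n *\<^sub>R ?e + x)" for x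
    proof -
      have "wave (t n *\<^sub>R ?e + x) \<xi> = exp ((2 * pi * \<i> * of_real (\<xi> $ i)) * of_real (t n)) * wave x \<xi>"
        by (simp add: inner_add_left inner_axis' distrib_left exp_add mult_ac)
      then have "?w * wave (t n *\<^sub>R ?e + x) \<xi> = wave x \<xi>"
        by (simp add: exp_minus)
      then show ?thesis by (simp add: add.commute mult_ac)
    qed
    have "(LINT x|lborel. ?F (t n *\<^sub>R ?e + x)) = (LINT x|distr lborel borel ((+) (t n *\<^sub>R ?e)). ?F x)"
      by (rule integral_distr[symmetric]) auto
    also have "\<dots> = (LINT x|lborel. ?F x)" by (simp only: lborel_distr_plus)
    finally have shift: "(LINT x|lborel. g (x + t n *\<^sub>R ?e) * wave x \<xi>) = ?w * fourier g \<xi>"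
      unfolding sh fourier_def by simp
    have int2: "integrable lborel (\<lambda>x. g (x + t n *\<^sub>R ?e) * wave x \<xi>)"
    proof -
      have "integrable (distr lborel borel ((+) (t n *\<^sub>R ?e))) ?F" unfolding lborel_distr_plus using int by simp
      then show ?thesis unfolding sh by (subst (asm) integrable_distr_eq) auto
    qed
    have "(LINT x|lborel. Q n x * wave x \<xi>) = (LINT x|lborel. inverse (of_real (t n)) * (g (x + t n *\<^sub>R ?e) * wave x \<xi> - g x * wave x \<xi>))"
      by (simp add: Q_def scaleR_conv_of_real left_diff_distrib right_diff_distrib mult.assoc)
    also have "\<dots> = inverse (of_real (t n)) * (?w * fourier g \<xi> - fourier g \<xi>)"
      using int int2 shift by (simp add: fourier_def)
    finally show ?thesis by (simp add: field_simps)
  qed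
  moreover have "(\<lambda>n. (exp (- (2 * pi * \<i> * of_real (\<xi> $ i)) * of_real (t n)) - 1) / of_real (t n) * fourier g \<xi>)
      \<longlonglongrightarrow> - (2 * pi * \<i> * of_real (\<xi> $ i)) * fourier g \<xi>"
  proof -
    let ?a = "- (2 * pi * \<i> * complex_of_real (\<xi> $ i))"
    have "DERIV (\<lambda>z. exp (?a * z)) 0 :> ?a" by (auto intro!: derivative_eq_intros)
    then have "(\<lambda>h. (exp (?a * h) - 1) / h) \<midarrow>0\<rightarrow> ?a" by (simp add: DERIV_def)
    moreover have "filterlim (\<lambda>n. complex_of_real (t n)) (at 0) sequentially"
      using t tendsto_of_real[OF t0, where 'a = complex]
      by (intro filterlim_atI) (auto simp: less_imp_neq[symmetric])
    ultimately have "(\<lambda>n. (exp (?a * of_real (t n)) - 1) / of_real (t n)) \<longlonglongrightarrow> ?a"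
      by (rule filterlim_compose)
    then show ?thesis by (intro tendsto_mult tendsto_const)
  qed
  ultimately show ?thesis unfolding fourier_def[of g'] by (simp add: LIMSEQ_unique)
qed

section \<open>Integrability of the transform of a test function\<close>

lemma iterated_partial_eq_0:
  assumes "closed S" "\<And>x. x \<notin> S \<Longrightarrow> \<psi> x = 0" "x \<notin> S"
  shows "iterated_partial is \<psi> x = 0"
  using assms(3)
proof (induction "is" arbitrary: x)
  case Nil
  then show ?case using assms by simp
next
  case (Cons i "is")
  have "((\<lambda>_. 0) has_derivative (\<lambda>_. 0)) (at x)" by simp
  then have "(iterated_partial is \<psi> has_derivative (\<lambda>_. 0)) (at x)"
    by (rule has_derivative_transform_within_open[OF _ open_Compl[OF assms(1)]]) (use Cons in auto)
  from fun_cong[OF frechet_derivative_at[OF this], of "axis i 1"] show ?case by simp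
qed

context
  fixes \<psi> :: "real^2 \<Rightarrow> complex" and S :: "(real^2) set"
  assumes smooth: "smooth \<psi>" and S: "compact S" and supp: "\<And>x. x \<notin> S \<Longrightarrow> \<psi> x = 0"
begin

lemma iterated_partial_zero: "x \<notin> S \<Longrightarrow> iterated_partial is \<psi> x = 0"
  by (rule iterated_partial_eq_0[OF compact_imp_closed[OF S] supp])

lemma continuous_iterated_partial: "continuous_on T (iterated_partial is \<psi>)"
  using smooth unfolding smooth_def
  by (intro continuous_at_imp_continuous_on ballI differentiable_imp_continuous_within) blast

lemma fourier_iterated_partial:
  "fourier (iterated_partial (i # is) \<psi>) \<xi> = - (2 * pi * \<i> * of_real (\<xi> $ i)) * fourier (iterated_partial is \<psi>) \<xi>"
  unfolding iterated_partial.simps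
proof (rule fourier_partial[OF _ _ S])
  show "iterated_partial is \<psi> differentiable (at x)" for x using smooth by (simp add: smooth_def)
  show "continuous_on UNIV (\<lambda>x. frechet_derivative (iterated_partial is \<psi>) (at x) (axis i 1))"
    using continuous_iterated_partial[of UNIV "i # is"] by simp
  show "frechet_derivative (iterated_partial is \<psi>) (at x) (axis i 1) = 0" if "x \<notin> S" for x
    using iterated_partial_zero[OF that, of "i # is"] by simp
qed (rule iterated_partial_zero)

lemma integrable_smooth: "integrable lborel \<psi>"
proof -
  have "integrable lborel (\<lambda>x. indicator S x *\<^sub>R \<psi> x)"
    using borel_integrable_compact[OF S continuous_iterated_partial[of S "[]"]] by simp
  moreover have "(\<lambda>x. indicator S x *\<^sub>R \<psi> x) = \<psi>" using supp by (auto simp: fun_eq_iff indicator_def)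
  ultimately show ?thesis by simp
qed

text \<open>Second derivatives multiply the transform by -a and -b, the squares of the scaled
  frequencies, and the mixed fourth derivative multiplies it by ab. So
  \<open>(1 + a) * (1 + b)\<close> times the transform is a combination of four bounded transforms,
  and the reciprocal weight is dominated by an integrable product.\<close>

lemma integrable_fourier: "integrable lborel (fourier \<psi>)"
proof -
  define N where "N is = (LINT x|lborel. norm (iterated_partial is \<psi> x))" for "is"
  define C where "C = N [] + N [1, 1] + N [2, 2] + N [1, 1, 2, 2]"
  have bound: "norm (fourier \<psi> \<xi>) \<le> norm (C * (inverse (1 + (\<xi> $ 1)\<^sup>2) * inverse (1 + (\<xi> $ 2)\<^sup>2)))" for \<xi>
  proof -
    let ?F = "\<lambda>is. fourier (iterated_partial is \<psi>) \<xi>"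
    define a where "a = (2 * pi * \<xi> $ 1)\<^sup>2"
    define b where "b = (2 * pi * \<xi> $ 2)\<^sup>2"
    have ab: "0 \<le> a" "0 \<le> b" by (simp_all add: a_def b_def)
    have sq: "- (2 * pi * \<i> * of_real y) * (- (2 * pi * \<i> * of_real y) * z) = - of_real ((2 * pi * y)\<^sup>2) * z"
      for y and z :: complex by (simp add: power2_eq_square algebra_simps)
    have "?F [1, 1] = - of_real a * ?F []" "?F [2, 2] = - of_real b * ?F []"
      "?F [1, 1, 2, 2] = of_real a * of_real b * ?F []"
      unfolding fourier_iterated_partial sq a_def b_def by (simp_all only: mult.assoc minus_mult_left[symmetric] minus_mult_right[symmetric] minus_minus)
    then have "of_real ((1 + a) * (1 + b)) * fourier \<psi> \<xi> = ?F [] - ?F [1, 1] - ?F [2, 2] + ?F [1, 1, 2, 2]"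
      by (simp add: algebra_simps)
    then have "norm (of_real ((1 + a) * (1 + b)) * fourier \<psi> \<xi>) \<le> norm (?F []) + norm (?F [1, 1]) + norm (?F [2, 2]) + norm (?F [1, 1, 2, 2])"
      using norm_triangle_ineq[of "?F [] - ?F [1, 1] - ?F [2, 2]" "?F [1, 1, 2, 2]"]
        norm_triangle_ineq4[of "?F [] - ?F [1, 1]" "?F [2, 2]"] norm_triangle_ineq4[of "?F []" "?F [1, 1]"]
      by (simp only:)
    also have "\<dots> \<le> C" unfolding C_def N_def by (intro add_mono norm_fourier_le)
    finally have 1: "((1 + a) * (1 + b)) * norm (fourier \<psi> \<xi>) \<le> C"
      unfolding norm_mult norm_of_real by (simp add: abs_mult ab)
    have "1 \<le> (2 * pi)\<^sup>2" using pi_gt3 by (intro one_le_power) simp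
    then have "(\<xi> $ 1)\<^sup>2 \<le> a" "(\<xi> $ 2)\<^sup>2 \<le> b"
      unfolding a_def b_def power_mult_distrib[of "2 * pi"] by (simp_all add: mult_le_cancel_right1)
    then have "(1 + (\<xi> $ 1)\<^sup>2) * (1 + (\<xi> $ 2)\<^sup>2) * norm (fourier \<psi> \<xi>) \<le> ((1 + a) * (1 + b)) * norm (fourier \<psi> \<xi>)"
      by (intro mult_right_mono mult_mono) (auto simp: a_def)
    with 1 have 2: "(1 + (\<xi> $ 1)\<^sup>2) * (1 + (\<xi> $ 2)\<^sup>2) * norm (fourier \<psi> \<xi>) \<le> C" by linarith
    have p: "0 < 1 + (\<xi> $ 1)\<^sup>2" "0 < 1 + (\<xi> $ 2)\<^sup>2" by (simp_all add: add_pos_nonneg)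
    have "norm (fourier \<psi> \<xi>) \<le> C / ((1 + (\<xi> $ 1)\<^sup>2) * (1 + (\<xi> $ 2)\<^sup>2))"
      by (subst pos_le_divide_eq) (use p 2 in \<open>simp_all only: mult_pos_pos mult.commute\<close>)
    then have "norm (fourier \<psi> \<xi>) \<le> C * (inverse (1 + (\<xi> $ 1)\<^sup>2) * inverse (1 + (\<xi> $ 2)\<^sup>2))"
      by (simp add: divide_inverse)
    then show ?thesis by (rule order_trans) simp
  qed
  have 1: "integrable lborel (\<lambda>t::real. inverse (1 + t\<^sup>2))"
    using integrable_inverse_1_plus_square by (simp add: set_integrable_def)
  have "(\<Prod>b\<in>Basis. inverse (1 + (\<xi> \<bullet> b)\<^sup>2)) = inverse (1 + (\<xi> $ 1)\<^sup>2) * inverse (1 + (\<xi> $ 2)\<^sup>2)" for \<xi> :: "real^2"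
  proof -
    have B: "(Basis :: (real^2) set) = {axis 1 1, axis 2 1}" by (auto simp: Basis_vec_def UNIV_2)
    show ?thesis unfolding B by (simp add: axis_eq_axis inner_axis)
  qed
  then have "integrable lborel (\<lambda>\<xi>::real^2. C * (inverse (1 + (\<xi> $ 1)\<^sup>2) * inverse (1 + (\<xi> $ 2)\<^sup>2)))"
    using lborel_prod_function(1)[where g = "\<lambda>_::real^2. \<lambda>t. inverse (1 + t\<^sup>2)", OF 1] by simp
  then show ?thesis
  proof (rule Bochner_Integration.integrable_bound)
    show "fourier \<psi> \<in> borel_measurable lborel"
      using fourier_measurable[of \<psi>] borel_measurable_integrable[OF integrable_smooth] by simp
  qed (use bound in blast)
qed

end

section \<open>Products of cosines\<close>

text \<open>A cosine is the mean of two opposite waves, so each factor removed splits the integral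
  into two with \<open>p\<close> shifted by plus or minus its frequency; the induction must
  therefore leave \<open>p\<close> free. Once all factors are gone, the point is a full sign sum and
  lies in \<open>K\<close>.\<close>

lemma integral_prod_cos_fourier:
  fixes \<xi> :: "'i \<Rightarrow> real^2"
  assumes F: "integrable lborel \<phi>" and I: "finite I"
    and zero: "\<And>p. p \<in> K \<Longrightarrow> (LINT x|lborel. \<phi> x * wave x p) = 0"
    and signs: "\<And>\<epsilon>::'i \<Rightarrow> real. (\<And>i. \<epsilon> i \<in> {-1, 1}) \<Longrightarrow> p + (\<Sum>i\<in>I. \<epsilon> i *\<^sub>R \<xi> i) \<in> K"
  shows "(LINT x|lborel. of_real (\<Prod>i\<in>I. cos (2 * pi * (x \<bullet> \<xi> i))) * (\<phi> x * wave x p)) = 0"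
  using I signs
proof (induction I arbitrary: p rule: finite_induct)
  case empty
  from empty(1)[of "\<lambda>_. 1"] have "p \<in> K" by simp
  from zero[OF this] show ?case by simp
next
  case (insert j I)
  define P where "P x = complex_of_real (\<Prod>i\<in>I. cos (2 * pi * (x \<bullet> \<xi> i)))" for x
  have [measurable]: "\<phi> \<in> borel_measurable borel" using borel_measurable_integrable[OF F] by simp
  have [measurable]: "P \<in> borel_measurable borel"
    unfolding P_def by (intro borel_measurable_continuous_onI continuous_intros)
  have nP: "norm (P x) \<le> 1" for x
    unfolding P_def norm_of_real abs_prod by (intro prod_le_1) auto
  have int: "integrable lborel (\<lambda>x. P x * (\<phi> x * wave x q))" for q
    by (rule Bochner_Integration.integrable_bound[OF F])
      (auto simp: norm_mult intro!: AE_I2 mult_left_le_one_le nP)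
  have z: "(LINT x|lborel. P x * (\<phi> x * wave x (p + s *\<^sub>R \<xi> j))) = 0" if s: "s \<in> {-1, 1}" for s
    unfolding P_def
  proof (rule insert.IH)
    fix \<epsilon> :: "'i \<Rightarrow> real" assume \<epsilon>: "\<And>i. \<epsilon> i \<in> {-1, 1}"
    have "p + (\<Sum>i\<in>insert j I. (\<epsilon>(j := s)) i *\<^sub>R \<xi> i) \<in> K"
      by (rule insert.prems) (use \<epsilon> s in auto)
    also have "(\<Sum>i\<in>insert j I. (\<epsilon>(j := s)) i *\<^sub>R \<xi> i) = s *\<^sub>R \<xi> j + (\<Sum>i\<in>I. \<epsilon> i *\<^sub>R \<xi> i)"
      using insert.hyps by (auto intro!: sum.cong)
    finally show "p + s *\<^sub>R \<xi> j + (\<Sum>i\<in>I. \<epsilon> i *\<^sub>R \<xi> i) \<in> K" by (simp add: add.assoc)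
  qed
  have "of_real (\<Prod>i\<in>insert j I. cos (2 * pi * (x \<bullet> \<xi> i))) * (\<phi> x * wave x p) =
      (P x * (\<phi> x * wave x (p + 1 *\<^sub>R \<xi> j)) + P x * (\<phi> x * wave x (p + (-1) *\<^sub>R \<xi> j))) / 2" for x
  proof -
    have c: "complex_of_real (cos (2 * pi * (x \<bullet> \<xi> j))) = (wave x (\<xi> j) + wave x (- \<xi> j)) / 2"
      by (simp add: cos_of_real[symmetric] cos_exp_eq mult_ac)
    have e: "wave x (p + 1 *\<^sub>R \<xi> j) = wave x p * wave x (\<xi> j)" "wave x (p + (-1) *\<^sub>R \<xi> j) = wave x p * wave x (- \<xi> j)"
      by (simp_all add: inner_add_right inner_diff_right distrib_left right_diff_distrib exp_add[symmetric])
    have s: "of_real (\<Prod>i\<in>insert j I. cos (2 * pi * (x \<bullet> \<xi> i))) = complex_of_real (cos (2 * pi * (x \<bullet> \<xi> j))) * P x"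
      using insert.hyps by (simp add: P_def)
    have "(a + b) / 2 * r * (t * q) = (r * (t * (q * a)) + r * (t * (q * b))) / 2" for a b q r t :: complex
      by (simp add: field_simps)
    then show ?thesis unfolding s c e .
  qed
  then have "(LINT x|lborel. of_real (\<Prod>i\<in>insert j I. cos (2 * pi * (x \<bullet> \<xi> i))) * (\<phi> x * wave x p)) =
      (LINT x|lborel. (P x * (\<phi> x * wave x (p + 1 *\<^sub>R \<xi> j)) + P x * (\<phi> x * wave x (p + (-1) *\<^sub>R \<xi> j))) / 2)"
    by (simp only:)
  also have "\<dots> = 0"
    unfolding integral_divide_zero
    by (subst Bochner_Integration.integral_add[OF int int]) (simp add: z[of 1, simplified] z[of "-1", simplified])
  finally show ?case .
qed

text \<open>Both exponentials carry the same sign, so inversion leads to the reflected point; hence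
  the condition on \<open>- p\<close>.\<close>

lemma integral_fourier_eq_0_off_support:
  assumes \<psi>: "\<psi> \<in> schwartz" and S: "compact (closure {x. \<psi> x \<noteq> 0})"
    and p: "- p \<notin> closure {x. \<psi> x \<noteq> 0}"
  shows "(LINT x|lborel. fourier \<psi> x * wave x p) = 0"
proof -
  let ?S = "closure {x. \<psi> x \<noteq> 0}"
  have sm: "smooth \<psi>" using \<psi> by (simp add: schwartz_def)
  have supp: "\<psi> x = 0" if "x \<notin> ?S" for x
    using that closure_subset[of "{x. \<psi> x \<noteq> 0}"] by blast
  have "open (- ?S)" by (intro open_Compl closed_closure)
  then obtain \<rho> where \<rho>: "0 < \<rho>" "ball (- p) \<rho> \<subseteq> - ?S" using p open_contains_ball by blast
  show ?thesis
  proof (rule integral_fourier_eq_0[OF integrable_smooth[OF sm S supp] integrable_fourier[OF sm S supp] \<rho>(1)])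
    fix y assume "norm (y + p) < \<rho>"
    moreover have "dist (- p) y = norm (y + p)"
      by (simp add: dist_norm norm_minus_commute[of "- p"])
    ultimately have "y \<in> ball (- p) \<rho>" by simp
    with \<rho>(2) supp show "\<psi> y = 0" by blast
  qed
qed

text \<open>In effect the pairing with \<open>\<psi>\<close> averages its values at the negatives of
  the sign sums. The symmetry of \<open>K\<close> absorbs the reflection, and a test function
  supported off \<open>K\<close> gives 0.\<close>

lemma dist_support_prod_cos:
  fixes \<xi> :: "'i \<Rightarrow> real^2"
  assumes K: "closed K" and sym: "\<And>x. x \<in> K \<Longrightarrow> - x \<in> K" and I: "finite I"
    and signs: "\<And>\<epsilon>::'i \<Rightarrow> real. (\<And>i. \<epsilon> i \<in> {-1, 1}) \<Longrightarrow> (\<Sum>i\<in>I. \<epsilon> i *\<^sub>R \<xi> i) \<in> K"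
  shows "dist_support (dist_fourier (dist_of_fun (\<lambda>x. of_real (\<Prod>i\<in>I. cos (2 * pi * (x \<bullet> \<xi> i)))))) \<subseteq> K"
proof -
  let ?f = "\<lambda>x. complex_of_real (\<Prod>i\<in>I. cos (2 * pi * (x \<bullet> \<xi> i)))"
  have "dist_vanishes_on (dist_fourier (dist_of_fun ?f)) (- K)"
    unfolding dist_vanishes_on_def
  proof (intro ballI impI)
    fix \<psi> assume \<psi>: "\<psi> \<in> schwartz"
      and S: "compact (closure {x. \<psi> x \<noteq> 0}) \<and> closure {x. \<psi> x \<noteq> 0} \<subseteq> - K"
    have sm: "smooth \<psi>" using \<psi> by (simp add: schwartz_def)
    have supp: "\<psi> x = 0" if "x \<notin> closure {x. \<psi> x \<noteq> 0}" for x
      using that closure_subset[of "{x. \<psi> x \<noteq> 0}"] by blast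
    have "(LINT x|lborel. ?f x * (fourier \<psi> x * wave x 0)) = 0"
    proof (rule integral_prod_cos_fourier[OF _ I])
      show "integrable lborel (fourier \<psi>)" using S by (intro integrable_fourier[OF sm _ supp]) auto
      show "(LINT x|lborel. fourier \<psi> x * wave x p) = 0" if "p \<in> K" for p
        using S sym[OF that] by (intro integral_fourier_eq_0_off_support[OF \<psi>]) auto
      show "0 + (\<Sum>i\<in>I. \<epsilon> i *\<^sub>R \<xi> i) \<in> K" if "\<And>i. \<epsilon> i \<in> {-1, 1}" for \<epsilon>
        using signs[OF that] by simp
    qed
    then show "dist_fourier (dist_of_fun ?f) \<psi> = 0" by (simp add: dist_fourier_def dist_of_fun_def)
  qed
  then show ?thesis using K unfolding dist_support_def by (auto simp: open_Compl)
qed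

text \<open>An essential supremum below 1 would make a whole neighbourhood of the origin a null set,
  by continuity.\<close>

lemma Linf_norm_eq_1:
  assumes cont: "continuous_on UNIV f" and le: "\<And>x. norm (f x) \<le> 1" and f0: "norm (f 0) = 1"
  shows "Linf_norm f = 1" and "f \<in> Linf"
proof -
  have m: "f \<in> borel_measurable lborel" using borel_measurable_continuous_onI[OF cont] by simp
  then have me: "(\<lambda>x. ereal (norm (f x))) \<in> borel_measurable lborel" by measurable
  have "Linf_norm f \<le> 1"
    unfolding Linf_norm_def using le by (intro esssup_I[OF me] AE_I2) simp
  moreover have "\<not> Linf_norm f < 1"
  proof
    assume "Linf_norm f < 1"
    then obtain c where c: "Linf_norm f < ereal c" "ereal c < 1" using ereal_dense2 by blast
    define U where "U = {x. c < norm (f x)}"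
    have U: "open U" unfolding U_def by (intro open_Collect_less continuous_intros cont)
    have "0 \<in> U" using c f0 by (simp add: U_def)
    then obtain e where e: "0 < e" "ball 0 e \<subseteq> U" using U open_contains_ball by blast
    have "AE x in lborel. ereal (norm (f x)) \<le> Linf_norm f" unfolding Linf_norm_def by (rule esssup_AE)
    then have "AE x in lborel. x \<notin> U"
    proof eventually_elim
      case (elim x)
      then have "ereal (norm (f x)) < ereal c" using c(1) by (rule le_less_trans)
      then show ?case by (simp add: U_def)
    qed
    then have "U \<in> null_sets lborel" using U by (subst AE_iff_null_sets) auto
    then have "ball (0::real^2) e \<in> null_sets lborel" using e(2) null_sets_subset[of U lborel "ball 0 e"] by simp
    then have "measure lborel (ball (0::real^2) e) = 0" by (simp add: null_sets_def measure_def)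
    with e(1) show False by simp
  qed
  ultimately show "Linf_norm f = 1" by simp
  then show "f \<in> Linf" using m by (simp add: Linf_def)
qed

section \<open>Choice of the parameters\<close>

lemma le_tan:
  assumes "0 \<le> x" "x < pi / 2"
  shows "x \<le> tan (x::real)"
proof -
  have "(\<lambda>x. tan x - x) 0 \<le> (\<lambda>x. tan x - x) x"
  proof (rule DERIV_nonneg_imp_nondecreasing[OF assms(1)])
    fix t assume t: "0 \<le> t" "t \<le> x"
    then have pos: "0 < cos t" using assms by (intro cos_gt_zero_pi) auto
    then have "1 \<le> inverse ((cos t)\<^sup>2)" by (simp add: one_le_inverse_iff power_le_one)
    moreover have "DERIV (\<lambda>x. tan x - x) t :> inverse ((cos t)\<^sup>2) - 1"
      using pos by (auto intro!: derivative_eq_intros)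
    ultimately show "\<exists>y. DERIV (\<lambda>x. tan x - x) t :> y \<and> 0 \<le> y" by (intro exI[of _ "inverse ((cos t)\<^sup>2) - 1"]) simp
  qed
  then show ?thesis by simp
qed

theorem theorem1p3:
  fixes K :: "(real^2) set" and \<delta> :: real
  assumes "convex_body K" and "quarter_turn_symmetric K" and "\<delta> > 0"
  shows "\<exists>(f :: real^2 \<Rightarrow> complex) (\<phi> :: real \<Rightarrow> real) (\<Gamma> :: (real^2) set).
           f \<in> Linf \<and> continuous_on UNIV f \<and> f 0 = 1 \<and> Linf_norm f = 1 \<and>
           dist_support (dist_fourier (dist_of_fun f)) \<subseteq> K \<and>
           gauge_function \<phi> \<and> \<phi> 0 = 1 \<and>
           regular_set \<phi> \<Gamma> \<and> \<Gamma> \<subseteq> {x. f x = 0} \<and>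
           enn2ereal (lower_surface_density \<Gamma>) > ereal ((pi / 2 - \<delta>) * mean_width K)"
proof -
  have K: "compact K" "convex K" "interior K \<noteq> {}" using assms(1) by (auto simp: convex_body_def)
  have sym: "- x \<in> K" if "x \<in> K" for x using convex_body_symmetric[OF assms(2) that] .
  obtain x0 \<rho> where \<rho>: "0 < \<rho>" "ball x0 \<rho> \<subseteq> K" using K(3) by (auto simp: mem_interior)
  have "ball 0 \<rho> \<subseteq> K"
  proof
    fix y :: "real^2" assume "y \<in> ball 0 \<rho>"
    \<comment> \<open>\<open>y\<close> is the midpoint of \<open>x0 + y\<close> and of the
      reflection of \<open>x0 - y\<close>.\<close>
    then have "x0 + y \<in> ball x0 \<rho>" "x0 - y \<in> ball x0 \<rho>" by (simp_all add: dist_norm)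
    then have "x0 + y \<in> K" "- (x0 - y) \<in> K" using \<rho> sym by blast+
    from convexD_alt[OF K(2) this, of "1/2"] show "y \<in> K" by (simp add: algebra_simps flip: scaleR_add_left)
  qed
  moreover obtain B where "\<And>x. x \<in> K \<Longrightarrow> norm x \<le> B"
    using compact_imp_bounded[OF K(1)] unfolding bounded_iff by blast
  ultimately interpret symmetric_body K \<rho> B by unfold_locales (use K sym \<rho> in auto)

  define W where "W = mean_width K"
  have W: "0 \<le> W" unfolding W_def by (rule mean_width_nonneg)
  \<comment> \<open>The target is clipped at 0 because densities are \<open>ennreal\<close>.
    \<open>E\<close> will bound the sum of the edges from below; its second entry keeps
    \<open>Q < E\<close> strict in the case \<open>W = 0\<close>, which has not been
    excluded.\<close>
  define Q where "Q = max 0 ((pi / 2 - \<delta>) * W)"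
  define E where "E = max (pi / 2 * W) (pi * \<rho>)"
  have QE: "Q < E"
  proof (cases "W = 0")
    case True
    then show ?thesis using rho by (simp add: Q_def E_def)
  next
    case False
    with W have W: "0 < W" by simp
    then have "(pi / 2 - \<delta>) * W < pi / 2 * W" "0 < pi / 2 * W" using assms(3) by simp_all
    then show ?thesis unfolding Q_def E_def by auto
  qed
  \<comment> \<open>The shrinking factor from \<open>scaled_sum_mem\<close>. It tends to 1, so some
    N leaves the shrunken length above \<open>Q\<close>.\<close>
  define c where "c N = 1 + 5 * B * pi / (\<rho> * real N)" for N
  have "(\<lambda>N. E / (1 + 5 * B * pi / \<rho> * (1 / real N))) \<longlonglongrightarrow> E / (1 + 5 * B * pi / \<rho> * 0)"
    by (intro tendsto_intros lim_1_over_n) simp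
  moreover have "(\<lambda>N. E / (1 + 5 * B * pi / \<rho> * (1 / real N))) = (\<lambda>N. E / c N)"
    by (simp add: c_def)
  ultimately have "(\<lambda>N. E / c N) \<longlonglongrightarrow> E" by simp
  then have "\<forall>\<^sub>F N in sequentially. Q < E / c N" using QE by (rule order_tendstoD)
  then have "\<forall>\<^sub>F N in sequentially. Q < E / c N \<and> 8 \<le> N"
    using eventually_ge_at_top[of 8] by eventually_elim simp
  then obtain N where NQ: "Q < E / c N" "8 \<le> N" using eventually_happens by fastforce
  have c: "1 \<le> c N" using B_pos rho by (simp add: c_def)
  obtain \<alpha> where \<alpha>: "real N * W \<le> 2 * (\<Sum>m<N. h (dir (\<alpha> + pi * real m / real N)))"
    unfolding W_def using NQ by (auto intro: mean_width_le_grid_sum[of N])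
  interpret circumscribed K \<rho> B \<alpha> N by unfold_locales (use NQ in simp)

  have sum_hh: "real N * W \<le> 2 * (\<Sum>m<N. hh (int m))"
    using \<alpha> by (simp add: hh_def ang_def)
  have "(\<Sum>m<N. \<rho>) \<le> (\<Sum>m<N. hh (int m))"
    by (intro sum_mono) (simp add: hh_def rho_le_h)
  then have sum_hh': "real N * \<rho> \<le> (\<Sum>m<N. hh (int m))" by simp
  have E_le: "E \<le> (\<Sum>m<N. edge (int m))"
  proof -
    let ?t = "pi / (2 * real N)"
    have t: "?t \<le> tan ?t"
      using N by (intro le_tan) (auto simp: field_simps)
    have "2 * ?t * (\<Sum>m<N. hh (int m)) \<le> 2 * tan ?t * (\<Sum>m<N. hh (int m))"
    proof (rule mult_right_mono)
      have "0 \<le> real N * \<rho>" using rho by simp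
      with sum_hh' show "0 \<le> (\<Sum>m<N. hh (int m))" by linarith
    qed (use t in simp)
    also have "\<dots> = (\<Sum>m<N. edge (int m))" by (rule sum_edge[symmetric])
    finally have *: "pi / real N * (\<Sum>m<N. hh (int m)) \<le> (\<Sum>m<N. edge (int m))" by simp
    have "pi / 2 * W = pi / real N * (real N * W / 2)" using N by simp
    also have "\<dots> \<le> pi / real N * (\<Sum>m<N. hh (int m))"
      using sum_hh by (intro mult_left_mono) auto
    also note *
    finally have 1: "pi / 2 * W \<le> (\<Sum>m<N. edge (int m))" .
    have "pi * \<rho> = pi / real N * (real N * \<rho>)" using N by simp
    also have "\<dots> \<le> pi / real N * (\<Sum>m<N. hh (int m))"
      using sum_hh' by (intro mult_left_mono) auto
    also note *
    finally show ?thesis using 1 by (simp add: E_def)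
  qed

  \<comment> \<open>Degenerate edges give constant factors 1 and no lines; dropping them secures
    \<open>\<xi> i \<noteq> 0\<close> without changing any sign sum.\<close>
  define I where "I = {m\<in>{..<N}. 0 < edge (int m)}"
  define \<xi> where "\<xi> m = inverse (c N) *\<^sub>R gen m" for m
  \<comment> \<open>The density of all the lines before cutting.\<close>
  define T where "T = 2 * (\<Sum>m\<in>I. norm (\<xi> m))"
  have gen0: "gen m = 0" if "m \<in> {..<N} - I" for m
  proof -
    have "\<not> 0 < edge (int m)" using that unfolding I_def by blast
    with edge_nonneg[of "int m"] have "edge (int m) = 0" by linarith
    then show ?thesis unfolding gen_def by simp
  qed
  have "T = 2 * (\<Sum>m<N. norm (\<xi> m))"
  proof -
    have "(\<Sum>m\<in>I. norm (\<xi> m)) = (\<Sum>m<N. norm (\<xi> m))"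
    proof (rule sum.mono_neutral_left)
      show "\<forall>m\<in>{..<N} - I. norm (\<xi> m) = 0" using gen0 unfolding \<xi>_def by simp
    qed (auto simp: I_def)
    then show ?thesis by (simp add: T_def)
  qed
  also have "\<dots> = (\<Sum>m<N. edge (int m)) / c N"
  proof -
    have "norm (\<xi> m) = edge (int m) / (2 * c N)" for m
    proof -
      have "\<bar>inverse (c N)\<bar> = inverse (c N)" using c by (intro abs_of_nonneg) simp
      then show ?thesis unfolding \<xi>_def norm_scaleR norm_gen using c by (simp only: inverse_eq_divide) simp
    qed
    then have "(\<Sum>m<N. norm (\<xi> m)) = (\<Sum>m<N. edge (int m)) / (2 * c N)"
      unfolding sum_divide_distrib by (intro sum.cong refl)
    then show ?thesis by simp
  qed
  finally have T: "T = (\<Sum>m<N. edge (int m)) / c N" .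
  have "E / c N \<le> T" unfolding T using c by (intro divide_right_mono E_le) simp
  with NQ(1) have QT: "Q < T" by (rule less_le_trans)
  \<comment> \<open>The intermediate value leaves slack on both sides: below it for the strict
    inequality of the theorem, above it for the loss at the crossings.\<close>
  then obtain q where q: "Q < q" "q < T" using dense by blast
  have Q0: "0 \<le> Q" by (simp add: Q_def)
  have I: "finite I" by (simp add: I_def)
  have I_ne: "I \<noteq> {}"
  proof
    assume "I = {}"
    then have "T = 0" by (simp add: T_def)
    with QT Q0 show False by simp
  qed
  define n where "n = real (card I)"
  have n: "0 < n" using I I_ne by (simp add: n_def card_gt_0_iff)
  \<comment> \<open>The second entry spends half of the slack: \<open>defect\<close> is at most
    \<open>(T - q) / (2 * T)\<close>, so the remaining density is at least
    \<open>(T + q) / 2\<close>. The first entry keeps \<open>\<tau>\<close> below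
    \<open>pi / 2\<close>.\<close>
  define \<tau> where "\<tau> = min (pi / 4) (pi * (T - q) / (4 * n * T))"
  have \<tau>: "0 < \<tau>" "\<tau> < pi / 2" "2 * n * \<tau> / pi \<le> (T - q) / (2 * T)"
  proof -
    show "0 < \<tau>" using q Q0 n by (simp add: \<tau>_def)
    have "\<tau> \<le> pi / 4" by (simp add: \<tau>_def)
    then show "\<tau> < pi / 2" using pi_gt_zero by linarith
    have "2 * n / pi * \<tau> \<le> 2 * n / pi * (pi * (T - q) / (4 * n * T))"
      using n by (intro mult_left_mono) (auto simp: \<tau>_def)
    also have "\<dots> = (T - q) / (2 * T)" using n q Q0 by (simp add: field_simps)
    finally show "2 * n * \<tau> / pi \<le> (T - q) / (2 * T)" by simp
  qed
  have half: "(T - q) / (2 * T) \<le> 1" using q Q0 by (simp add: field_simps)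
  interpret L: line_system I \<xi> \<tau>
  proof unfold_locales
    show "\<xi> i \<noteq> 0" if "i \<in> I" for i
      using that c norm_gen[of i] by (auto simp: \<xi>_def I_def)
    show "\<xi> i $ 1 * \<xi> j $ 2 \<noteq> \<xi> i $ 2 * \<xi> j $ 1" if "i \<in> I" "j \<in> I" "i \<noteq> j" for i j
      using gen_not_parallel[of i j] that c by (auto simp: \<xi>_def I_def)
    show "2 * real (card I) * \<tau> \<le> pi"
      using order_trans[OF \<tau>(3) half] by (simp add: n_def divide_le_eq)
  qed (use I I_ne \<tau> in auto)

  define f where "f x = complex_of_real (\<Prod>i\<in>I. cos (2 * pi * (x \<bullet> \<xi> i)))" for x
  have cont: "continuous_on UNIV f" unfolding f_def by (intro continuous_intros)
  have f0: "f 0 = 1" by (simp add: f_def)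
  have "norm (f x) \<le> 1" for x unfolding f_def norm_of_real abs_prod by (intro prod_le_1) auto
  note Linf = Linf_norm_eq_1[OF cont this, unfolded f0, simplified]
  have supp: "dist_support (dist_fourier (dist_of_fun f)) \<subseteq> K"
    unfolding f_def[abs_def]
  proof (rule dist_support_prod_cos[OF compact_imp_closed[OF K(1)] sym I])
    fix \<epsilon> :: "nat \<Rightarrow> real" assume \<epsilon>: "\<And>i. \<epsilon> i \<in> {-1, 1}"
    have "\<bar>\<epsilon> m\<bar> \<le> 1" for m using \<epsilon>[of m] by auto
    from scaled_sum_mem[OF this NQ(2)] have "(\<Sum>m<N. \<epsilon> m *\<^sub>R \<xi> m) \<in> K"
      by (simp add: \<xi>_def c_def)
    also have "(\<Sum>m<N. \<epsilon> m *\<^sub>R \<xi> m) = (\<Sum>m\<in>I. \<epsilon> m *\<^sub>R \<xi> m)"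
    proof (rule sum.mono_neutral_right)
      show "\<forall>m\<in>{..<N} - I. \<epsilon> m *\<^sub>R \<xi> m = 0" using gen0 unfolding \<xi>_def by simp
    qed (auto simp: I_def)
    finally show "(\<Sum>m\<in>I. \<epsilon> m *\<^sub>R \<xi> m) \<in> K" .
  qed
  obtain \<phi> where \<phi>: "gauge_function \<phi>" "\<phi> 0 = 1" "regular_set \<phi> L.\<Gamma>" by (rule L.regular_\<Gamma>)
  have zeros: "L.\<Gamma> \<subseteq> {x. f x = 0}"
    using L.\<Gamma>_subset unfolding f_def L.z_def of_real_eq_0_iff .
  have "q < (1 - L.defect) * T"
  proof -
    have "L.defect * T \<le> (T - q) / (2 * T) * T"
      using \<tau>(3) q Q0 by (intro mult_right_mono) (auto simp: L.defect_def n_def)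
    also have "\<dots> = (T - q) / 2" using q Q0 by simp
    finally show ?thesis using q by (simp add: algebra_simps)
  qed
  then have "ennreal q \<le> lower_surface_density L.\<Gamma>"
    unfolding T_def by (rule L.lower_surface_density_ge)
  then have "enn2ereal (ennreal q) \<le> enn2ereal (lower_surface_density L.\<Gamma>)"
    by (simp add: less_eq_ennreal.rep_eq)
  moreover have "enn2ereal (ennreal q) = ereal q" using q Q0 by (simp add: enn2ereal_ennreal)
  moreover have "ereal ((pi / 2 - \<delta>) * mean_width K) < ereal q" using q by (simp add: Q_def W_def)
  ultimately have dens: "ereal ((pi / 2 - \<delta>) * mean_width K) < enn2ereal (lower_surface_density L.\<Gamma>)"
    by (metis less_le_trans)
  show ?thesis
    using Linf cont f0 supp \<phi> zeros dens by blast
qed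

end
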